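(* Assume the Riemann Hypothesis. Let $\beta$ be a fixed number with $\frac14<\beta<\frac12$ and let $\varepsilon>0$ be fixed. Then for every real number $x>5$ and every $Y$ with $x^{\varepsilon}\ll Y\ll x^{\frac12-\varepsilon}$, $$E_{\mu}(x)=\sum_{\ell\le Y}(\mu*\mu)(\ell)\,\Delta\left(\frac{x}{\ell^{2}}\right)+O\left(x^{\frac12+\varepsilon}\,Y^{\frac{1-4\beta}{4-4\beta}+\varepsilon}\right),$$ where the sum is over positive integers $\ell\le Y$ and the implied constant depends only on $\varepsilon$, $\beta$ and the implied constants in the range of $Y$.
   Context: $\mu$ is the Möbius function, $\zeta$ is the Riemann zeta-function, $\zeta'$ is its first derivative, and $\gamma$ is the Euler--Mascheroni constant. For arithmetic functions $f,g$, the Dirichlet convolution is $(f*g)(n)=\sum_{d\mid n}f(d)g(n/d)$. Define $$S_{\mu}(x)=\sum_{mn\le x}\mu(\gcd(m,n)),$$ the sum running over all ordered pairs $(m,n)$ of positive integers with $mn\le x$. The error term $E_{\mu}(x)$ is defined by $$E_{\mu}(x)=S_{\mu}(x)-\frac{x}{\zeta^{2}(2)}\left(\log x+2\gamma-1-4\frac{\zeta'(2)}{\zeta(2)}\right).$$ The error term $\Delta$ in the Dirichlet divisor problem is defined for real $y>0$ by $$\Delta(y)=\sum_{n\le y}\tau(n)-y(\log y+2\gamma-1),$$ where $\tau(n)$ is the number of positive divisors of $n$. *)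

theory Defs
  imports "HOL-Complex_Analysis.Complex_Analysis" "HOL-Computational_Algebra.Squarefree"
begin

section \<open>The Riemann zeta function\<close>

text \<open>
  The zeta function is the analytic continuation of the Dirichlet series to the complex plane
  without the point 1. The value 0 at the pole is a dummy that makes the description unique.
\<close>

definition is_zeta :: "(complex \<Rightarrow> complex) \<Rightarrow> bool" where
  "is_zeta f \<longleftrightarrow>
     f holomorphic_on (- {1}) \<and>
     (\<forall>s. 1 < Re s \<longrightarrow> (\<lambda>n. of_nat (Suc n) powr (- s)) sums f s) \<and>
     f 1 = 0"

definition zeta :: "complex \<Rightarrow> complex" where
  "zeta = (THE f. is_zeta f)"

definition riemann_hypothesis :: bool where
  "riemann_hypothesis \<longleftrightarrow> (\<forall>s. 0 < Re s \<and> Re s < 1 \<and> zeta s = 0 \<longrightarrow> Re s = 1 / 2)"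


subsection \<open>Existence and uniqueness of the continuation\<close>

text \<open>
  Put \<open>H s = (s - 1) * zeta s\<close>. Taylor expansion of \<open>x powr (1 - s)\<close> at \<open>x = n + 1\<close>, evaluated
  at \<open>n + 2\<close> and summed over \<open>n\<close>, expresses \<open>H s\<close> through \<open>H (s + 1), H (s + 2), \<dots>\<close> and a
  remainder series converging in the half-plane \<open>Re s > 1 - k\<close>. This continues \<open>H\<close> one unit to
  the left at a time.
\<close>

definition falling :: "nat \<Rightarrow> complex \<Rightarrow> complex" where
  "falling i a = (\<Prod>j<i. a - of_nat j)"

definition zeta_rem :: "nat \<Rightarrow> complex \<Rightarrow> nat \<Rightarrow> complex" where
  "zeta_rem k s n = of_nat (n + 2) powr (1 - s) -
     (\<Sum>i\<le>k. falling i (1 - s) * of_nat (n + 1) powr (1 - s - of_nat i) / fact i)"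

lemma falling_simps:
  "falling 0 a = 1" "falling (Suc i) a = falling i a * (a - of_nat i)"
  by (simp_all add: falling_def mult.commute)

lemma holomorphic_falling [holomorphic_intros]:
  "f holomorphic_on A \<Longrightarrow> (\<lambda>s. falling i (f s)) holomorphic_on A"
  unfolding falling_def by (intro holomorphic_intros)

lemma holomorphic_zeta_rem: "(\<lambda>s. zeta_rem k s n) holomorphic_on A"
  unfolding zeta_rem_def by (intro holomorphic_intros) (auto simp del: of_nat_Suc of_nat_add)

lemma norm_zeta_rem_le:
  assumes "Re s > - real k"
  shows "norm (zeta_rem k s n) \<le>
           norm (falling (Suc k) (1 - s)) * real (Suc n) powr (- Re s - real k) / fact k"
proof -
  define S where "S = closed_segment (of_nat (Suc n) :: complex) (of_nat (Suc n + 1))"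
  have S: "\<exists>u. x = complex_of_real u \<and> real (Suc n) \<le> u" if "x \<in> S" for x
  proof -
    have "S = complex_of_real ` closed_segment (real (Suc n)) (real (Suc n + 1))"
      unfolding S_def by (metis closed_segment_of_real of_real_of_nat_eq)
    with that show ?thesis by (auto simp: closed_segment_eq_real_ivl)
  qed
  define f where "f i x = falling i (1 - s) * x powr (1 - s - of_nat i)" for i and x :: complex
  have "norm (f 0 (of_nat (Suc n + 1)) -
          (\<Sum>i\<le>k. f i (of_nat (Suc n)) * (of_nat (Suc n + 1) - of_nat (Suc n)) ^ i / fact i))
        \<le> (norm (falling (Suc k) (1 - s)) * real (Suc n) powr (- Re s - real k)) *
          norm (of_nat (Suc n + 1) - of_nat (Suc n) :: complex) ^ Suc k / fact k"
  proof (rule field_Taylor[where S = S])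
    fix i x assume "x \<in> S" "i \<le> k"
    then obtain u where u: "x = complex_of_real u" "real (Suc n) \<le> u" using S by blast
    hence "x \<notin> \<real>\<^sub>\<le>\<^sub>0" by (auto simp: complex_nonpos_Reals_iff)
    hence "(f i has_field_derivative
             falling i (1 - s) * ((1 - s - of_nat i) * x powr (1 - s - of_nat i - 1))) (at x)"
      unfolding f_def by (auto intro!: derivative_eq_intros)
    also have "falling i (1 - s) * ((1 - s - of_nat i) * x powr (1 - s - of_nat i - 1)) =
               f (Suc i) x"
      by (simp add: f_def falling_simps algebra_simps)
    finally show "(f i has_field_derivative f (Suc i) x) (at x within S)"
      by (rule has_field_derivative_at_within)
  next
    fix x assume "x \<in> S"
    then obtain u where u: "x = complex_of_real u" "real (Suc n) \<le> u" using S by blast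
    have "norm (x powr (1 - s - of_nat (Suc k))) = u powr (- Re s - real k)"
      using u by (simp add: norm_powr_real_powr)
    also have "\<dots> \<le> real (Suc n) powr (- Re s - real k)"
      using u assms by (intro powr_mono2') auto
    finally show "norm (f (Suc k) x) \<le>
        norm (falling (Suc k) (1 - s)) * real (Suc n) powr (- Re s - real k)"
      unfolding f_def norm_mult by (intro mult_left_mono) auto
  qed (auto simp: S_def)
  thus ?thesis by (simp add: zeta_rem_def f_def falling_simps add_ac)
qed

lemma summable_Suc_powr: "r < -1 \<Longrightarrow> summable (\<lambda>n. real (Suc n) powr r)"
  using summable_real_powr_iff[of r] by (subst summable_Suc_iff) simp

lemma zeta_rem_holomorphic_suminf:
  "(\<lambda>s. \<Sum>n. zeta_rem k s n) holomorphic_on {s. Re s > 1 - real k}"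
proof (rule holomorphic_uniform_sequence)
  show "open {s. Re s > 1 - real k}" by (rule open_halfspace_Re_gt)
  show "(\<lambda>s. \<Sum>n<N. zeta_rem k s n) holomorphic_on {s. Re s > 1 - real k}" for N
    by (intro holomorphic_intros holomorphic_zeta_rem)
next
  fix x assume x: "x \<in> {s. Re s > 1 - real k}"
  define d where "d = (Re x - (1 - real k)) / 2"
  define r where "r = Re x - d"
  have d: "d > 0" and r: "r > 1 - real k" using x by (auto simp: d_def r_def field_simps)
  have Re: "Re s \<ge> r" if "s \<in> cball x d" for s
    using that abs_Re_le_cmod[of "x - s"] by (auto simp: r_def dist_norm)
  have "compact ((\<lambda>s. falling (Suc k) (1 - s)) ` cball x d)"
    by (intro compact_continuous_image holomorphic_on_imp_continuous_on holomorphic_intros) auto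
  hence "\<exists>M. \<forall>s\<in>cball x d. norm (falling (Suc k) (1 - s)) \<le> M"
    by (auto dest!: compact_imp_bounded simp: bounded_iff simp del: mem_cball)
  then obtain M where M: "\<And>s. s \<in> cball x d \<Longrightarrow> norm (falling (Suc k) (1 - s)) \<le> M"
    by (elim exE) blast
  have M0: "M \<ge> 0" using M[of x] d by (intro order_trans[OF norm_ge_zero]) auto
  have "uniform_limit (cball x d) (\<lambda>N s. \<Sum>n<N. zeta_rem k s n) (\<lambda>s. \<Sum>n. zeta_rem k s n) sequentially"
  proof (rule Weierstrass_m_test)
    fix n s assume s: "s \<in> cball x d"
    have "norm (zeta_rem k s n) \<le>
           norm (falling (Suc k) (1 - s)) * real (Suc n) powr (- Re s - real k) / fact k"
      using Re[OF s] r by (intro norm_zeta_rem_le) auto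
    also have "\<dots> \<le> M * real (Suc n) powr (- r - real k) / fact k"
      using M[OF s] M0 Re[OF s] by (intro divide_right_mono mult_mono powr_mono) auto
    finally show "norm (zeta_rem k s n) \<le> M * real (Suc n) powr (- r - real k) / fact k" .
  next
    show "summable (\<lambda>n. M * real (Suc n) powr (- r - real k) / fact k)"
      using r by (intro summable_divide summable_mult summable_Suc_powr) auto
  qed
  moreover have "cball x d \<subseteq> {s. Re s > 1 - real k}"
    using Re r by (intro subsetI CollectI) (rule less_le_trans)
  ultimately show "\<exists>d>0. cball x d \<subseteq> {s. Re s > 1 - real k} \<and>
      uniform_limit (cball x d) (\<lambda>N s. \<Sum>n<N. zeta_rem k s n) (\<lambda>s. \<Sum>n. zeta_rem k s n) sequentially"
    using d by blast
qed

definition zeta_series :: "complex \<Rightarrow> complex" where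
  "zeta_series s = (\<Sum>n. of_nat (Suc n) powr (- s))"

lemma zeta_series_sums:
  assumes "Re s > 1"
  shows "(\<lambda>n. of_nat (Suc n) powr (- s)) sums zeta_series s"
proof -
  have "summable (\<lambda>n. norm (complex_of_nat (Suc n) powr (- s)))"
  proof -
    have "norm (complex_of_nat (Suc n) powr (- s)) = real (Suc n) powr (- Re s)" for n
      by (simp add: norm_powr_real_powr del: of_nat_Suc)
    thus ?thesis using summable_Suc_powr[of "- Re s"] assms by simp
  qed
  thus ?thesis unfolding zeta_series_def by (rule summable_sums[OF summable_norm_cancel])
qed

lemma zeta_series_recurrence:
  assumes s: "Re s > 1"
  shows "(s - 1) * zeta_series s = 1 + (\<Sum>n. zeta_rem (Suc k) s n) -
           (\<Sum>i\<in>{2..Suc k}. falling (i - 1) (1 - s) / fact i *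
              ((s + of_nat (i - 1) - 1) * zeta_series (s + of_nat (i - 1))))"
proof -
  define t where "t i n = falling i (1 - s) / fact i * of_nat (Suc n) powr (1 - s - of_nat i)"
    for i and n :: nat
  have t: "t i sums (falling i (1 - s) / fact i * zeta_series (s + of_nat (i - 1)))"
    if "i \<ge> 1" for i
  proof -
    have "1 - s - of_nat i = - (s + of_nat (i - 1))" using that by (simp add: of_nat_diff)
    thus ?thesis unfolding t_def using s by (simp only:) (intro sums_mult zeta_series_sums, auto)
  qed
  have lim: "(\<lambda>n. of_nat (Suc n) powr (1 - s)) \<longlonglongrightarrow> (0 :: complex)"
  proof (rule tendsto_norm_zero_cancel)
    have "(\<lambda>n. real (Suc n) powr (1 - Re s)) \<longlonglongrightarrow> 0"
      using s by (intro tendsto_neg_powr filterlim_compose[OF filterlim_real_sequentially]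
                    filterlim_Suc) auto
    thus "(\<lambda>n. norm (of_nat (Suc n) powr (1 - s) :: complex)) \<longlonglongrightarrow> 0"
      by (simp add: norm_powr_real_powr del: of_nat_Suc)
  qed
  have "(\<lambda>n. of_nat (Suc (Suc n)) powr (1 - s) - of_nat (Suc n) powr (1 - s))
          sums (0 - of_nat (Suc 0) powr (1 - s) :: complex)"
    by (rule telescope_sums[OF lim])
  hence "(\<lambda>n. of_nat (Suc (Suc n)) powr (1 - s) - of_nat (Suc n) powr (1 - s) - (\<Sum>i\<in>{1..Suc k}. t i n))
          sums (-1 - (\<Sum>i\<in>{1..Suc k}. falling i (1 - s) / fact i * zeta_series (s + of_nat (i - 1))))"
    by (intro sums_diff sums_sum t) auto
  moreover have "of_nat (Suc (Suc n)) powr (1 - s) - of_nat (Suc n) powr (1 - s) -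
                   (\<Sum>i\<in>{1..Suc k}. t i n) = zeta_rem (Suc k) s n" for n
  proof -
    have "{..Suc k} = insert 0 {1..Suc k}" by auto
    hence "(\<Sum>i\<le>Suc k. t i n) = t 0 n + (\<Sum>i\<in>{1..Suc k}. t i n)" by simp
    moreover have "t 0 n = of_nat (Suc n) powr (1 - s)" by (simp add: t_def falling_simps)
    moreover have "zeta_rem (Suc k) s n = of_nat (Suc (Suc n)) powr (1 - s) - (\<Sum>i\<le>Suc k. t i n)"
      by (simp add: zeta_rem_def t_def del: sum.atMost_Suc of_nat_Suc)
    ultimately show ?thesis by simp
  qed
  ultimately have "(\<Sum>n. zeta_rem (Suc k) s n) =
      -1 - (\<Sum>i\<in>{1..Suc k}. falling i (1 - s) / fact i * zeta_series (s + of_nat (i - 1)))"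
    by (simp add: sums_iff)
  also have "(\<Sum>i\<in>{1..Suc k}. falling i (1 - s) / fact i * zeta_series (s + of_nat (i - 1))) =
      (\<Sum>i\<in>{1..Suc k}. - (falling (i - 1) (1 - s) / fact i *
              ((s + of_nat (i - 1) - 1) * zeta_series (s + of_nat (i - 1)))))"
  proof (rule sum.cong)
    fix i assume "i \<in> {1..Suc k}"
    then obtain j where "i = Suc j" by (cases i) auto
    thus "falling i (1 - s) / fact i * zeta_series (s + of_nat (i - 1)) =
      - (falling (i - 1) (1 - s) / fact i *
              ((s + of_nat (i - 1) - 1) * zeta_series (s + of_nat (i - 1))))"
      by (simp add: falling_simps divide_simps) (simp add: algebra_simps)
  qed simp
  also have "{1..Suc k} = insert 1 {2..Suc k}" by auto
  also have "(\<Sum>i\<in>insert 1 {2..Suc k}. - (falling (i - 1) (1 - s) / fact i *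
                ((s + of_nat (i - 1) - 1) * zeta_series (s + of_nat (i - 1))))) =
      - ((s - 1) * zeta_series s) - (\<Sum>i\<in>{2..Suc k}. falling (i - 1) (1 - s) / fact i *
                ((s + of_nat (i - 1) - 1) * zeta_series (s + of_nat (i - 1))))"
    by (subst sum.insert) (simp_all add: falling_simps sum_negf del: sum.cl_ivl_Suc)
  finally show ?thesis by simp
qed

lemma zeta_continuation_halfplane:
  "\<exists>h. h holomorphic_on {s. Re s > 1 - real (Suc k)} \<and>
       (\<forall>s. Re s > 1 \<longrightarrow> h s = (s - 1) * zeta_series s)"
proof (induction k)
  case 0
  show ?case
    by (rule exI[of _ "\<lambda>s. 1 + (\<Sum>n. zeta_rem (Suc 0) s n)"])
       (use zeta_rem_holomorphic_suminf[of "Suc 0"] zeta_series_recurrence[of _ 0]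
        in \<open>auto intro!: holomorphic_intros\<close>)
next
  case (Suc k)
  then obtain h where h: "h holomorphic_on {s. Re s > 1 - real (Suc k)}"
    "\<And>s. Re s > 1 \<Longrightarrow> h s = (s - 1) * zeta_series s" by blast
  define A where "A = {s. Re s > 1 - real (Suc (Suc k))}"
  let ?g = "\<lambda>s. 1 + (\<Sum>n. zeta_rem (Suc (Suc k)) s n) -
           (\<Sum>i\<in>{2..Suc (Suc k)}. falling (i - 1) (1 - s) / fact i * h (s + of_nat (i - 1)))"
  have "(\<lambda>s. h (s + of_nat (i - 1))) holomorphic_on A" if "i \<in> {2..Suc (Suc k)}" for i
  proof -
    have "h \<circ> (\<lambda>s. s + of_nat (i - 1)) holomorphic_on A"
      using that by (intro holomorphic_on_compose_gen[OF _ h(1)] holomorphic_intros)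
                    (auto simp: A_def of_nat_diff)
    thus ?thesis by (simp add: o_def)
  qed
  hence "?g holomorphic_on A"
    using zeta_rem_holomorphic_suminf[of "Suc (Suc k)"]
    by (intro holomorphic_intros) (auto simp: A_def)
  moreover have "?g s = (s - 1) * zeta_series s" if "Re s > 1" for s
    unfolding zeta_series_recurrence[OF that, of "Suc k"] using that
    by (intro arg_cong2[where f = "(-)"] refl sum.cong) (auto simp: h(2))
  ultimately show ?case unfolding A_def by blast
qed

lemma eq_on_halfplane:
  assumes "f holomorphic_on {s. Re s > c}" "g holomorphic_on {s. Re s > c}"
    and "\<And>s. Re s > 1 \<Longrightarrow> f s = g s" and "Re w > c"
  shows "f w = g w"
proof -
  define \<xi> where "\<xi> = complex_of_real (max 2 (c + 1))"
  have "f w - g w = 0"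
  proof (rule analytic_continuation[where f = "\<lambda>s. f s - g s" and S = "{s. Re s > c}"
          and U = "{s. Re s > max 1 c}" and \<xi> = \<xi>])
    show "\<xi> islimpt {s. Re s > max 1 c}"
      by (rule interior_limit_point)
         (simp only: interior_open open_halfspace_Re_gt, simp add: \<xi>_def less_max_iff_disj)
    show "(\<lambda>s. f s - g s) holomorphic_on {s. Re s > c}"
      by (intro holomorphic_intros assms)
    show "connected {s. Re s > c}"
      by (intro convex_connected convex_halfspace_Re_gt)
    show "open {s. Re s > c}"
      by (rule open_halfspace_Re_gt)
  qed (use assms in \<open>simp_all add: \<xi>_def subset_iff\<close>)
  thus ?thesis by simp
qed

lemma zeta_continuation_entire:
  "\<exists>h. h holomorphic_on UNIV \<and> (\<forall>s. Re s > 1 \<longrightarrow> h s = (s - 1) * zeta_series s)"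
proof -
  have "\<exists>h. \<forall>k. h k holomorphic_on {s. Re s > 1 - real (Suc k)} \<and>
              (\<forall>s. Re s > 1 \<longrightarrow> h k s = (s - 1) * zeta_series s)"
    by (intro choice allI zeta_continuation_halfplane)
  then obtain h where H: "\<forall>k. h k holomorphic_on {s. Re s > 1 - real (Suc k)} \<and>
              (\<forall>s. Re s > 1 \<longrightarrow> h k s = (s - 1) * zeta_series s)"
    by (rule exE)
  have h: "h k holomorphic_on {s. Re s > 1 - real (Suc k)}"
    "Re s > 1 \<Longrightarrow> h k s = (s - 1) * zeta_series s" for k s
    by (rule conjunct1[OF spec[OF H]], rule mp[OF spec[OF conjunct2[OF spec[OF H]]]])
  define g where "g s = h (nat \<lceil>- Re s\<rceil> + 1) s" for s
  have le: "h k s = h m s" if "k \<le> m" "Re s > 1 - real (Suc k)" for k m s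
  proof (rule eq_on_halfplane[OF h(1)[of k] _ _ that(2)])
    show "h m holomorphic_on {s. Re s > 1 - real (Suc k)}"
      by (rule holomorphic_on_subset[OF h(1)[of m]]) (use that(1) in auto)
  qed (simp add: h(2))
  have g: "g s = h k s" if "Re s > 1 - real (Suc k)" for k s
  proof -
    have "Re s > 1 - real (Suc (nat \<lceil>- Re s\<rceil> + 1))" by linarith
    thus ?thesis using le[of k "nat \<lceil>- Re s\<rceil> + 1" s] le[of "nat \<lceil>- Re s\<rceil> + 1" k s] that
      unfolding g_def by (cases "k \<le> nat \<lceil>- Re s\<rceil> + 1") simp_all
  qed
  have "g holomorphic_on (\<Union>k. {s. Re s > 1 - real (Suc k)})"
  proof (intro holomorphic_on_UN_open open_halfspace_Re_gt)
    fix k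
    show "g holomorphic_on {s. Re s > 1 - real (Suc k)}"
      using h(1)[of k] by (rule holomorphic_transform) (simp add: g)
  qed
  moreover have "(\<Union>k. {s. Re s > 1 - real (Suc k)}) = UNIV"
  proof -
    have "Re s > 1 - real (Suc (nat \<lceil>- Re s\<rceil> + 1))" for s by linarith
    thus ?thesis by blast
  qed
  moreover have "g s = (s - 1) * zeta_series s" if "Re s > 1" for s
    using that by (simp add: g_def h(2))
  ultimately show ?thesis by auto
qed

lemma is_zeta_exists: "\<exists>f. is_zeta f"
proof -
  obtain h where h: "h holomorphic_on UNIV"
    "\<And>s. Re s > 1 \<Longrightarrow> h s = (s - 1) * zeta_series s"
    using zeta_continuation_entire by blast
  have "is_zeta (\<lambda>s. h s / (s - 1))"
    unfolding is_zeta_def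
  proof safe
    show "(\<lambda>s. h s / (s - 1)) holomorphic_on - {1}"
      by (intro holomorphic_intros holomorphic_on_subset[OF h(1)]) auto
    fix s :: complex assume "1 < Re s"
    moreover from this have "s \<noteq> 1" by auto
    ultimately show "(\<lambda>n. of_nat (Suc n) powr (- s)) sums (h s / (s - 1))"
      using zeta_series_sums[of s] by (simp add: h(2))
  qed simp
  thus ?thesis by blast
qed

lemma is_zeta_unique:
  assumes "is_zeta f" "is_zeta g"
  shows "f = g"
proof
  fix w :: complex
  show "f w = g w"
  proof (cases "w = 1")
    case False
    have "f w - g w = 0"
    proof (rule analytic_continuation[where f = "\<lambda>s. f s - g s" and S = "- {1}"
            and U = "{s. Re s > 1}" and \<xi> = 2])
      show "2 islimpt {s. Re s > 1}"
        by (rule interior_limit_point) (simp only: interior_open open_halfspace_Re_gt, simp)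
      show "connected (- {1 :: complex})"
        by (rule connected_punctured_universe) simp
      show "f z - g z = 0" if "z \<in> {s. Re s > 1}" for z
      proof -
        have "f z = g z"
          by (rule sums_unique2[of "\<lambda>n. of_nat (Suc n) powr (- z)"])
             (use assms that in \<open>simp_all add: is_zeta_def\<close>)
        thus ?thesis by simp
      qed
      show "(\<lambda>s. f s - g s) holomorphic_on - {1}"
        using assms by (intro holomorphic_intros) (simp_all add: is_zeta_def)
    qed (use False in auto)
    thus ?thesis by simp
  qed (use assms in \<open>simp add: is_zeta_def\<close>)
qed

theorem is_zeta_zeta: "is_zeta zeta"
proof -
  have "\<exists>!f. is_zeta f" using is_zeta_exists is_zeta_unique by (rule ex_ex1I)
  thus ?thesis unfolding zeta_def by (rule theI')
qed


section \<open>Arithmetic functions and the two error terms\<close>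

definition moebius_mu :: "nat \<Rightarrow> int" where
  "moebius_mu n = (if squarefree n then (- 1) ^ card (prime_factors n) else 0)"

definition dirichlet_conv :: "(nat \<Rightarrow> int) \<Rightarrow> (nat \<Rightarrow> int) \<Rightarrow> nat \<Rightarrow> int" where
  "dirichlet_conv f g n = (\<Sum>d | d dvd n. f d * g (n div d))"

definition divisor_count :: "nat \<Rightarrow> nat" where
  "divisor_count n = card {d. d dvd n}"

definition S_mu :: "real \<Rightarrow> int" where
  "S_mu x = (\<Sum>(m, n) | 0 < m \<and> 0 < n \<and> real (m * n) \<le> x. moebius_mu (gcd m n))"

text \<open>
  The numbers \<open>zeta 2\<close> and \<open>deriv zeta 2\<close> are real, so taking real parts is only a conversion of
  types.
\<close>

definition E_mu :: "real \<Rightarrow> real" where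
  "E_mu x = of_int (S_mu x) -
     x / (Re (zeta 2))\<^sup>2 *
       (ln x + 2 * euler_mascheroni - 1 - 4 * (Re (deriv zeta 2) / Re (zeta 2)))"

definition divisor_error :: "real \<Rightarrow> real" where
  "divisor_error y =
     (\<Sum>n | 0 < n \<and> real n \<le> y. real (divisor_count n)) - y * (ln y + 2 * euler_mascheroni - 1)"

end

theory Submission
  imports Defs "HOL-Number_Theory.Prime_Powers"
begin

text \<open>
  Since \<open>\<mu> = 1 * \<mu> * \<mu>\<close>, the sum \<open>S_mu x\<close> equals \<open>\<Sum>l. (\<mu>*\<mu>)(l) D(x / l\<^sup>2)\<close> with \<open>D\<close> the summatory function of
  the divisor function, and the main terms add up to that of \<open>E_mu\<close>, so the difference to be bounded is
  the tail \<open>\<Sum>l>Y. (\<mu>*\<mu>)(l) \<Delta>(x / l\<^sup>2)\<close>. Following Montgomery and Vaughan, Perron's formula writes the tail as an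
  integral of \<open>zeta(s)\<^sup>2 f(2 s) x\<^sup>s / s\<close> over \<open>Re s = 1/2 + \<eta>\<close>, where \<open>f(w) = \<Sum>l>Y. (\<mu>*\<mu>)(l) l\<^sup>-\<^sup>w\<close>. A second
  application of Perron's formula, now with the contour moved to \<open>Re = 1/2 + \<eta>\<close>, gives
  \<open>f(w) = O(Y\<^sup>-\<^sup>1\<^sup>/\<^sup>2\<^sup>+\<^sup>\<theta> (1 + |Im w|)\<^sup>\<theta>)\<close> on \<open>Re w = 1 + 2 \<eta>\<close>. Both steps use that under the Riemann hypothesis
  \<open>zeta\<close> and \<open>1 / zeta\<close> grow more slowly than any power of \<open>|Im s|\<close> to the right of the critical line. The resulting
  exponent \<open>-1/2\<close> of \<open>Y\<close> is smaller than \<open>(1 - 4 \<beta>) / (4 - 4 \<beta>)\<close> for every \<open>\<beta> < 1/2\<close>.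

  All sums are averaged over \<open>[x, x + 1]\<close>, respectively \<open>[Y, Y + 1]\<close>. This makes the integrals absolutely
  convergent, and since such an interval contains a single new integer, the divisor bound
  \<open>\<tau>(n) = O(n\<^sup>\<delta>)\<close> controls the error.
\<close>

section \<open>The zeta function to the right of the imaginary axis\<close>

text \<open>The constants must be uniform in \<open>x\<close>, \<open>Y\<close> and the height
  \<open>t\<close>, but a contour can only be moved with decay constants that depend on these. The
  two uses are kept apart: a crude bound in the strip justifies a shift, and a separate estimate on
  the final vertical line is the one that counts. The exponents are read off from the positions of
  the lines. For Re s = 1/2 + \<eta> the tail is taken at w = 2 s, and moving its own variable z to
  Re z = -1/2 - \<eta> brings w + z back to Re = 1/2 + \<eta>. This gives Y to the power -1/2, while
  the outer line gives x to the power 1/2 + \<eta>. The dummy value \<open>zeta 1 = 0\<close> fits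
  in: with 1 / 0 = 0 the quotient \<open>1 / zeta\<close> takes its correct value 0 at the point 1,
  so it is holomorphic there. Undoing the average in x for all l at once needs an extra remark. The
  interval from x / l^2 to (x + 1) / l^2 contains a new integer n only if n l^2 = N, where N is the
  integer in (x, x + 1]. So only l with l^2 dividing N contribute, and their total is at most the
  cube of the number of divisors of N.\<close>

definition Hz :: "complex \<Rightarrow> complex" where
  "Hz s = 1 + (\<Sum>n. zeta_rem 1 s n)"

lemma Hz_holomorphic: "Hz holomorphic_on {s. 0 < Re s}"
  unfolding Hz_def using zeta_rem_holomorphic_suminf[of 1] by (intro holomorphic_intros) auto

lemma zeta_holomorphic: "zeta holomorphic_on - {1}"
  using is_zeta_zeta by (simp add: is_zeta_def)

lemma zeta_sums: "1 < Re s \<Longrightarrow> (\<lambda>n. of_nat (Suc n) powr (- s)) sums zeta s"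
  using is_zeta_zeta by (simp add: is_zeta_def)

text \<open>For \<open>k = 0\<close> the recurrence for \<open>zeta_series\<close> has an empty sum,
  so \<open>Hz\<close> is (s - 1) times the series for Re s > 1; uniqueness of the continuation
  extends this to Re s > 0. At s = 1 both sides are 0 by the conventions for the pole and for
  division.\<close>

lemma zeta_eq_Hz:
  assumes "0 < Re s"
  shows "zeta s = Hz s / (s - 1)"
proof -
  obtain h where h: "h holomorphic_on UNIV" "\<And>s. Re s > 1 \<Longrightarrow> h s = (s - 1) * zeta_series s"
    using zeta_continuation_entire by blast
  have "is_zeta (\<lambda>s. h s / (s - 1))"
    unfolding is_zeta_def
  proof safe
    show "(\<lambda>s. h s / (s - 1)) holomorphic_on - {1}"
      by (intro holomorphic_intros holomorphic_on_subset[OF h(1)]) auto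
    fix s :: complex assume "1 < Re s"
    moreover from this have "s \<noteq> 1" by auto
    ultimately show "(\<lambda>n. of_nat (Suc n) powr (- s)) sums (h s / (s - 1))"
      using zeta_series_sums[of s] by (simp add: h(2))
  qed simp
  hence z: "zeta = (\<lambda>s. h s / (s - 1))"
    using is_zeta_unique is_zeta_zeta by blast
  have "h s = Hz s"
  proof (rule eq_on_halfplane[OF _ Hz_holomorphic _ assms])
    show "h holomorphic_on {s. 0 < Re s}" using h(1) by (rule holomorphic_on_subset) auto
    fix s assume s: "1 < Re s"
    show "h s = Hz s" using zeta_series_recurrence[OF s, of 0] h(2)[OF s] by (simp add: Hz_def)
  qed
  thus ?thesis by (simp add: z)
qed

lemma Hz_eq: "0 < Re s \<Longrightarrow> s \<noteq> 1 \<Longrightarrow> Hz s = (s - 1) * zeta s"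
  by (simp add: zeta_eq_Hz)

lemma zeta_rem_1:
  "zeta_rem 1 s n = of_nat (n + 2) powr (1 - s) - of_nat (n + 1) powr (1 - s)
     - (1 - s) * of_nat (n + 1) powr (- s)"
  by (simp add: zeta_rem_def falling_simps algebra_simps)

lemma zeta_rem_1_bound:
  assumes "r \<le> Re s" "0 < r"
  shows "norm (zeta_rem 1 s n) \<le> (norm (1 - s) * norm s) * real (Suc n) powr (- r - 1)"
proof -
  have "norm (zeta_rem 1 s n) \<le> norm (falling (Suc 1) (1 - s)) * real (Suc n) powr (- Re s - real 1) / fact 1"
    using assms by (intro norm_zeta_rem_le) auto
  also have "falling (Suc 1) (1 - s) = (1 - s) * (- s)"
    by (simp add: falling_simps)
  also have "norm ((1 - s) * (- s)) * real (Suc n) powr (- Re s - real 1) / fact 1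
     \<le> (norm (1 - s) * norm s) * real (Suc n) powr (- r - 1)"
  proof -
    have "real (Suc n) powr (- Re s - 1) \<le> real (Suc n) powr (- r - 1)"
      using assms by (intro powr_mono) auto
    thus ?thesis unfolding of_nat_1 fact_1 div_by_1 norm_mult norm_minus_cancel
      by (intro mult_left_mono) auto
  qed
  finally show ?thesis .
qed

text \<open>Polynomial growth is all that is needed: it is the a priori bound for the real part of
  log zeta, which the Riemann hypothesis then improves to an arbitrarily small power.\<close>

lemma Hz_bound:
  assumes "0 < r"
  obtains C where "0 < C" "\<And>s. r \<le> Re s \<Longrightarrow> norm (Hz s) \<le> C * (1 + norm s) ^ 2"
proof
  define C where "C = (\<Sum>n. real (Suc n) powr (- r - 1))"
  have sm: "summable (\<lambda>n. real (Suc n) powr (- r - 1))"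
    using assms by (intro summable_Suc_powr) auto
  have C0: "0 \<le> C" unfolding C_def by (intro suminf_nonneg sm) auto
  show "0 < 1 + C" using C0 by simp
  fix s assume s: "r \<le> Re s"
  have "norm (\<Sum>n. zeta_rem 1 s n) \<le> (\<Sum>n. (norm (1 - s) * norm s) * real (Suc n) powr (- r - 1))"
    using zeta_rem_1_bound[OF s assms] by (intro norm_suminf_le summable_mult sm) auto
  also have "\<dots> = (norm (1 - s) * norm s) * C"
    unfolding C_def by (rule suminf_mult[OF sm])
  also have "\<dots> \<le> ((1 + norm s) * (1 + norm s)) * C"
    using C0 norm_triangle_ineq4[of 1 s] by (intro mult_right_mono mult_mono) auto
  finally have 1: "norm (\<Sum>n. zeta_rem 1 s n) \<le> C * (1 + norm s) ^ 2"
    by (simp add: power2_eq_square mult.commute)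
  have "1 \<le> (1 + norm s) ^ 2" by (rule one_le_power) simp
  have "norm (1 + X) \<le> (1 + norm s) ^ 2 + C * (1 + norm s) ^ 2"
    if "norm X \<le> C * (1 + norm s) ^ 2" for X :: complex
    using that norm_triangle_ineq[of 1 X] \<open>1 \<le> (1 + norm s) ^ 2\<close> unfolding norm_one by linarith
  from this[OF 1] have "norm (Hz s) \<le> (1 + norm s) ^ 2 + C * (1 + norm s) ^ 2"
    unfolding Hz_def .
  thus "norm (Hz s) \<le> (1 + C) * (1 + norm s) ^ 2" by (simp add: ring_distribs)
qed

lemma Hz_1: "Hz 1 = 1"
proof -
  have "zeta_rem 1 1 = (\<lambda>n. 0)"
    by (rule ext, simp only: zeta_rem_1) (simp del: of_nat_Suc of_nat_add)
  thus ?thesis unfolding Hz_def by simp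
qed

lemma DERIV_powr_minus:
  fixes c :: complex
  assumes "c \<noteq> 0"
  shows "((\<lambda>s. c powr (a - s)) has_field_derivative - (c powr (a - x) * ln c)) (at x)"
proof -
  have "(\<lambda>s. c powr (a - s)) = (\<lambda>s. exp ((a - s) * ln c))"
    using assms by (simp add: powr_def)
  moreover have "((\<lambda>s. exp ((a - s) * ln c)) has_field_derivative
      - (exp ((a - x) * ln c) * ln c)) (at x)"
    by (auto intro!: derivative_eq_intros)
  ultimately show ?thesis using assms by (simp add: powr_def)
qed

text \<open>The second Laurent coefficient of zeta at 1, which enters the residue at the double pole
  of zeta^2. It is found by differentiating the remainder series termwise; local uniform convergence
  comes from the bound for \<open>zeta_rem\<close> on Re s > 1/2.\<close>

lemma Hz_deriv_1: "(Hz has_field_derivative euler_mascheroni) (at 1)"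
proof -
  define S where "S = {s. 1/2 < Re s}"
  have S: "open S" "1 \<in> S" unfolding S_def by (rule open_halfspace_Re_gt, simp)
  define f' where "f' n s = - (of_nat (n + 2) powr (1 - s) * ln (of_nat (n + 2)))
     + of_nat (n + 1) powr (1 - s) * ln (of_nat (n + 1)) + of_nat (n + 1) powr (- s)
     + (1 - s) * (of_nat (n + 1) powr (- s) * ln (of_nat (n + 1)))" for n and s :: complex
  have "\<exists>g g'. \<forall>x\<in>S. ((\<lambda>n. zeta_rem 1 x n) sums g x) \<and> ((\<lambda>n. f' n x) sums g' x) \<and>
           (g has_field_derivative g' x) (at x)"
  proof (rule series_and_derivative_comparison_complex[OF S(1)])
    fix n x assume "x \<in> S"
    show "((\<lambda>x. zeta_rem 1 x n) has_field_derivative f' n x) (at x)"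
      unfolding zeta_rem_1 f'_def
      using DERIV_powr_minus[of "of_nat (n + 2)" 1 x] DERIV_powr_minus[of "of_nat (n + 1)" 1 x]
        DERIV_powr_minus[of "of_nat (n + 1)" 0 x]
      by (auto intro!: derivative_eq_intros simp: algebra_simps simp del: of_nat_Suc of_nat_add)
  next
    fix x assume x: "x \<in> S"
    define B where "B = (2 + norm x) * (1 + norm x)"
    define h where "h n = complex_of_real (B * real (Suc n) powr (- (1/2) - 1))" for n
    have "summable h" unfolding h_def summable_of_real_iff
      by (intro summable_mult summable_Suc_powr) auto
    moreover have "range h \<subseteq> \<real>\<^sub>\<ge>\<^sub>0" by (auto simp: h_def B_def)
    moreover have "norm (zeta_rem 1 y n) \<le> norm (h n)" if y: "y \<in> ball x 1 \<inter> S" for y n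
    proof -
      have ny: "norm y \<le> 1 + norm x" using y norm_triangle_ineq2[of y x] by (auto simp: dist_norm norm_minus_commute)
      have "norm (zeta_rem 1 y n) \<le> (norm (1 - y) * norm y) * real (Suc n) powr (- (1/2) - 1)"
        using y by (intro zeta_rem_1_bound) (auto simp: S_def)
      also have "\<dots> \<le> B * real (Suc n) powr (- (1/2) - 1)"
        unfolding B_def using ny norm_triangle_ineq4[of 1 y] by (intro mult_right_mono mult_mono) auto
      also have "\<dots> = norm (h n)" unfolding h_def norm_of_real by (simp add: B_def del: of_nat_Suc)
      finally show ?thesis .
    qed
    ultimately show "\<exists>d (h :: nat \<Rightarrow> complex). 0 < d \<and> summable h \<and> range h \<subseteq> \<real>\<^sub>\<ge>\<^sub>0 \<and>
       (\<forall>\<^sub>F n in sequentially. \<forall>y\<in>ball x d \<inter> S. norm (zeta_rem 1 y n) \<le> norm (h n))"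
      by (intro exI[of _ "1::real"] exI[of _ h] conjI always_eventually allI ballI) auto
  qed
  then obtain g g' where g: "\<And>x. x \<in> S \<Longrightarrow> (\<lambda>n. zeta_rem 1 x n) sums g x"
    "\<And>x. x \<in> S \<Longrightarrow> (\<lambda>n. f' n x) sums g' x" "\<And>x. x \<in> S \<Longrightarrow> (g has_field_derivative g' x) (at x)"
    by blast
  \<comment> \<open>At s = 1 the last summand of \<open>f'\<close> vanishes and the others become
    the terms 1 / (n + 1) + ln (n + 1) - ln (n + 2) of the classical series for the Euler-Mascheroni
    constant.\<close>
  have "(\<lambda>n. f' n 1) = (\<lambda>n. inverse (of_nat (n+1)) + of_real (ln (of_nat (n+1))) - of_real (ln (of_nat (n+2))))"
    by (auto simp: f'_def powr_minus Ln_of_nat fun_eq_iff simp del: of_nat_Suc of_nat_add)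
  hence "g' 1 = euler_mascheroni"
    using g(2)[OF S(2)] euler_mascheroni_sum[where 'a = complex] sums_unique2 by metis
  hence "((\<lambda>s. 1 + g s) has_field_derivative euler_mascheroni) (at 1)"
    using g(3)[OF S(2)] by (auto intro!: derivative_eq_intros)
  thus ?thesis
  proof (rule has_field_derivative_transform_within_open[OF _ S])
    fix x assume "x \<in> S"
    thus "1 + g x = Hz x" using g(1)[of x] by (simp add: Hz_def sums_iff)
  qed
qed

section \<open>Arithmetic functions\<close>

lemma finite_nat_real_le [simp]: "finite {n :: nat. real n \<le> y}"
  by (rule finite_subset[of _ "{..nat \<lfloor>y\<rfloor>}"]) (auto simp: le_nat_floor)

lemma finite_nat_real_le' [simp]: "finite {n :: nat. 0 < n \<and> real n \<le> y}"
  by (rule finite_subset[OF _ finite_nat_real_le[of y]]) auto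

lemma abs_moebius_mu_le: "\<bar>moebius_mu n\<bar> \<le> 1"
  by (simp add: moebius_mu_def power_abs)

lemma moebius_mu_prime_mult:
  assumes "prime p" "\<not> p dvd d" "squarefree d"
  shows "moebius_mu (p * d) = - moebius_mu d"
proof -
  have d: "d \<noteq> 0" using assms(2) by (metis dvd_0_right)
  have cop: "coprime p d" using assms by (intro prime_imp_coprime)
  have "squarefree (p * d)"
    using cop assms by (intro squarefree_mult_coprime) (auto intro: squarefree_prime)
  moreover have "prime_factors (p * d) = insert p (prime_factors d)"
    using assms d by (subst prime_factors_product) (auto simp: prime_prime_factors)
  moreover have "p \<notin> prime_factors d" using assms by auto
  ultimately show ?thesis using assms by (simp add: moebius_mu_def)
qed

text \<open>For a prime p dividing n, multiplication by p pairs the squarefree divisors prime to p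
  with those divisible by p, and the two terms of a pair cancel.\<close>

lemma sum_moebius_mu:
  assumes "0 < n"
  shows "(\<Sum>d | d dvd n. moebius_mu d) = (if n = 1 then 1 else 0)"
proof (cases "n = 1")
  case True
  have "{d :: nat. d dvd 1} = {1}" by auto
  thus ?thesis using True by (simp add: moebius_mu_def)
next
  case False
  then obtain p where p: "prime p" "p dvd n" using prime_factor_nat by blast
  define A where "A = {d. d dvd n \<and> squarefree d \<and> \<not> p dvd d}"
  define B where "B = {d. d dvd n \<and> squarefree d \<and> p dvd d}"
  have fin: "finite A" "finite B" using assms unfolding A_def B_def by auto
  have "B = (*) p ` A"
  proof safe
    fix e assume e: "e \<in> B"
    then obtain d where d: "e = p * d" by (auto simp: B_def)
    have "\<not> p dvd d"
    proof
      assume "p dvd d"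
      hence "p ^ 2 dvd e" by (simp add: d power2_eq_square)
      with e p show False by (auto simp: B_def squarefree_def)
    qed
    moreover have "squarefree d" using e squarefree_multD(2)[of p d] by (simp add: B_def d)
    moreover have "d dvd n" using e d unfolding B_def by (metis (lifting) dvd_mult_right mem_Collect_eq)
    ultimately show "e \<in> (*) p ` A" unfolding d by (intro imageI) (simp add: A_def)
  next
    fix d assume d: "d \<in> A"
    hence cop: "coprime p d" using p by (auto simp: A_def intro: prime_imp_coprime)
    have "p * d dvd n" using d p cop by (auto simp: A_def intro: divides_mult)
    moreover have "squarefree (p * d)"
      using cop p d by (intro squarefree_mult_coprime) (auto simp: A_def intro: squarefree_prime)
    ultimately show "p * d \<in> B" by (simp add: B_def)
  qed
  moreover have "inj_on ((*) p) A" using p by (auto simp: inj_on_def)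
  ultimately have "(\<Sum>d\<in>B. moebius_mu d) = (\<Sum>d\<in>A. moebius_mu (p * d))"
    by (simp add: sum.reindex)
  also have "\<dots> = (\<Sum>d\<in>A. - moebius_mu d)"
    using p by (intro sum.cong) (auto simp: A_def moebius_mu_prime_mult)
  finally have "(\<Sum>d\<in>A \<union> B. moebius_mu d) = 0"
    by (subst sum.union_disjoint) (use fin in \<open>auto simp: A_def B_def sum_negf\<close>)
  also have "(\<Sum>d\<in>A \<union> B. moebius_mu d) = (\<Sum>d | d dvd n. moebius_mu d)"
    using assms by (intro sum.mono_neutral_left) (auto simp: A_def B_def moebius_mu_def)
  finally show ?thesis using False by simp
qed

text \<open>Associativity of the Dirichlet convolution as a reindexing: the chain e | d | k
  corresponds to the pair (e, d / e). It turns 1 * \<mu> * \<mu> into \<mu> * (1 * \<mu>).\<close>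

lemma sum_divisors_divisors:
  fixes h :: "nat \<Rightarrow> nat \<Rightarrow> 'a :: comm_monoid_add"
  assumes "0 < k"
  shows "(\<Sum>d | d dvd k. \<Sum>e | e dvd d. h e (d div e)) = (\<Sum>e | e dvd k. \<Sum>f | f dvd k div e. h e f)"
proof -
  have fin: "finite {e. e dvd d}" if "d dvd k" for d
    using that assms by (metis dvd_pos_nat finite_divisors_nat)
  have div: "k div e dvd k" if "e dvd k" for e using that by (metis dvd_div_mult_self dvd_triv_left)
  have "(\<Sum>d | d dvd k. \<Sum>e | e dvd d. h e (d div e)) =
        (\<Sum>(d, e)\<in>(SIGMA d:{d. d dvd k}. {e. e dvd d}). h e (d div e))"
    using fin assms by (intro sum.Sigma) auto
  also have "\<dots> = (\<Sum>(e, f)\<in>(SIGMA e:{e. e dvd k}. {f. f dvd k div e}). h e f)"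
  proof (rule sum.reindex_bij_witness[of _ "\<lambda>(e, f). (e * f, e)" "\<lambda>(d, e). (e, d div e)"])
    fix a assume "a \<in> (SIGMA d:{d. d dvd k}. {e. e dvd d})"
    then obtain d e where a: "a = (d, e)" "d dvd k" "e dvd d" by auto
    thus "(\<lambda>(d, e). (e, d div e)) a \<in> (SIGMA e:{e. e dvd k}. {f. f dvd k div e})"
      by (auto simp: div_dvd_div intro: dvd_trans)
  next
    fix b assume "b \<in> (SIGMA e:{e. e dvd k}. {f. f dvd k div e})"
    then obtain e f where b: "b = (e, f)" "e dvd k" "f dvd k div e" by auto
    hence e: "e \<noteq> 0" using assms by auto
    have "e * f dvd k" using b mult_dvd_mono[of e e f "k div e"] by auto
    thus "(\<lambda>(e, f). (e * f, e)) b \<in> (SIGMA d:{d. d dvd k}. {e. e dvd d})"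
      using b by auto
    show "(\<lambda>(d, e). (e, d div e)) ((\<lambda>(e, f). (e * f, e)) b) = b" using b e by auto
  qed auto
  also have "\<dots> = (\<Sum>e | e dvd k. \<Sum>f | f dvd k div e. h e f)"
    using fin[OF div] assms by (intro sum.Sigma[symmetric]) auto
  finally show ?thesis .
qed

abbreviation mu2 :: "nat \<Rightarrow> int" where
  "mu2 \<equiv> dirichlet_conv moebius_mu moebius_mu"

lemma sum_mu2:
  assumes "0 < k"
  shows "(\<Sum>d | d dvd k. mu2 d) = moebius_mu k"
proof -
  have "(\<Sum>d | d dvd k. mu2 d) = (\<Sum>e | e dvd k. \<Sum>f | f dvd k div e. moebius_mu e * moebius_mu f)"
    unfolding dirichlet_conv_def by (rule sum_divisors_divisors[OF assms])
  also have "\<dots> = (\<Sum>e | e dvd k. if e = k then moebius_mu e else 0)"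
  proof (rule sum.cong)
    fix e assume "e \<in> {e. e dvd k}"
    hence e: "e dvd k" by simp
    hence "0 < k div e" using assms by (auto elim!: dvdE)
    moreover have "k div e = 1 \<longleftrightarrow> e = k" using e assms by (auto elim!: dvdE)
    ultimately show "(\<Sum>f | f dvd k div e. moebius_mu e * moebius_mu f) = (if e = k then moebius_mu e else 0)"
      using sum_moebius_mu[of "k div e"] by (simp flip: sum_distrib_left)
  qed simp
  also have "\<dots> = moebius_mu k" using assms by (simp add: sum.delta)
  finally show ?thesis .
qed

definition divisor_sum :: "real \<Rightarrow> nat" where
  "divisor_sum y = (\<Sum>n | 0 < n \<and> real n \<le> y. divisor_count n)"

lemma divisor_sum_eq_card:
  "divisor_sum y = card {(a, b). 0 < a \<and> 0 < b \<and> real (a * b) \<le> y}" and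
  finite_hyperbola: "finite {(a :: nat, b :: nat). 0 < a \<and> 0 < b \<and> real (a * b) \<le> y}"
proof -
  let ?N = "{n. 0 < n \<and> real n \<le> y}"
  have fin: "finite (SIGMA n:?N. {d. d dvd n})" by (intro finite_SigmaI) auto
  have bij: "bij_betw (\<lambda>(n, d). (d, n div d)) (SIGMA n:?N. {d. d dvd n})
      {(a, b). 0 < a \<and> 0 < b \<and> real (a * b) \<le> y}"
    by (rule bij_betwI[where g = "\<lambda>(a, b). (a * b, a)"])
       (auto simp: dvd_div_eq_0_iff simp flip: of_nat_mult intro: Nat.gr0I)
  show "divisor_sum y = card {(a, b). 0 < a \<and> 0 < b \<and> real (a * b) \<le> y}"
    unfolding bij_betw_same_card[OF bij, symmetric] divisor_sum_def divisor_count_def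
    by (subst card_SigmaI) auto
  show "finite {(a :: nat, b :: nat). 0 < a \<and> 0 < b \<and> real (a * b) \<le> y}"
    using bij fin bij_betw_finite by blast
qed

text \<open>Expand \<mu>(gcd(m, n)) as the sum of \<open>mu2 l\<close> over the common divisors l of
  m and n. Writing m = l a and n = l b, the condition m n \<le> x becomes a b \<le> x / l^2, and
  such pairs are counted by \<open>divisor_sum\<close>.\<close>

lemma S_mu_eq:
  "S_mu x = (\<Sum>l | 0 < l \<and> real l ^ 2 \<le> x. mu2 l * int (divisor_sum (x / real l ^ 2)))"
proof -
  let ?H = "\<lambda>y. {(a :: nat, b :: nat). 0 < a \<and> 0 < b \<and> real (a * b) \<le> y}"
  let ?L = "{l :: nat. 0 < l \<and> real l ^ 2 \<le> x}"
  let ?P = "Sigma (?H x) (\<lambda>(m, n). {l. l dvd gcd m n})"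
  let ?Q = "SIGMA l:?L. ?H (x / real l ^ 2)"
  have finL: "finite ?L"
    by (rule finite_subset[OF _ finite_nat_real_le[of x]])
       (auto, metis of_nat_1 of_nat_power of_nat_le_iff order_trans self_le_power zero_less_numeral Suc_leI One_nat_def)
  have "S_mu x = (\<Sum>(m, n)\<in>?H x. \<Sum>l | l dvd gcd m n. mu2 l)"
    unfolding S_mu_def
  proof (intro sum.cong refl, clarify)
    fix a b :: nat assume "0 < a"
    thus "moebius_mu (gcd a b) = (\<Sum>l | l dvd gcd a b. mu2 l)"
      using sum_mu2[of "gcd a b"] by simp
  qed
  also have "\<dots> = (\<Sum>(p, l)\<in>?P. mu2 l)"
    using finite_hyperbola[of x] by (subst sum.Sigma[symmetric]) (auto simp: case_prod_unfold)
  also have "\<dots> = (\<Sum>(l, p)\<in>?Q. mu2 l)"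
  proof (rule sum.reindex_bij_witness[of _ "\<lambda>(l, (a, b)). ((l * a, l * b), l)"
        "\<lambda>((m, n), l). (l, (m div l, n div l))"])
    fix q assume "q \<in> ?Q"
    then obtain l a b where q: "q = (l, (a, b))" "0 < l" "0 < a" "0 < b" "real (a * b) \<le> x / real l ^ 2"
      by auto
    have "real (a * b) * real l ^ 2 \<le> x" using q by (simp add: field_simps)
    hence "real (l * a * (l * b)) \<le> x" by (simp add: power2_eq_square mult_ac)
    thus "(\<lambda>(l, (a, b)). ((l * a, l * b), l)) q \<in> ?P" using q by auto
    show "(\<lambda>((m, n), l). (l, (m div l, n div l))) ((\<lambda>(l, (a, b)). ((l * a, l * b), l)) q) = q"
      using q by auto
  next
    fix p assume "p \<in> ?P"
    then obtain m n l where p: "p = ((m, n), l)" "0 < m" "0 < n" "real (m * n) \<le> x" "l dvd m" "l dvd n"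
      by auto
    then obtain a b where ab: "m = l * a" "n = l * b" by (auto elim!: dvdE)
    with p have pos: "0 < l" "0 < a" "0 < b" by auto
    have le: "real l ^ 2 * real (a * b) \<le> x" using p ab by (simp add: power2_eq_square mult_ac)
    have "real l ^ 2 * 1 \<le> real l ^ 2 * real (a * b)"
      using pos by (intro mult_left_mono) (auto simp: Suc_le_eq simp flip: of_nat_mult)
    with le have "real l ^ 2 \<le> x" by simp
    moreover have "real (a * b) \<le> x / real l ^ 2" using le pos by (simp add: field_simps)
    ultimately show "(\<lambda>((m, n), l). (l, (m div l, n div l))) p \<in> ?Q" using p ab pos by auto
    show "(\<lambda>(l, (a, b)). ((l * a, l * b), l)) ((\<lambda>((m, n), l). (l, (m div l, n div l))) p) = p"
      using p ab pos by auto
    show "(case (\<lambda>((m, n), l). (l, (m div l, n div l))) p of (l, p) \<Rightarrow> mu2 l) = (case p of (p, l) \<Rightarrow> mu2 l)"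
      using p by auto
  qed
  also have "\<dots> = (\<Sum>l\<in>?L. \<Sum>p\<in>?H (x / real l ^ 2). mu2 l)"
    using finL finite_hyperbola by (subst sum.Sigma) auto
  also have "\<dots> = (\<Sum>l\<in>?L. mu2 l * int (divisor_sum (x / real l ^ 2)))"
    by (simp add: divisor_sum_eq_card mult.commute)
  finally show ?thesis .
qed

section \<open>The divisor bound, obtained from moments\<close>

lemma divisor_count_mult_le:
  assumes "0 < a" "0 < b"
  shows "divisor_count (a * b) \<le> divisor_count a * divisor_count b"
proof -
  have "{d. d dvd a * b} \<subseteq> (\<lambda>(x, y). x * y) ` ({d. d dvd a} \<times> {d. d dvd b})"
  proof
    fix d assume "d \<in> {d. d dvd a * b}"
    then obtain x y where "d = x * y" "x dvd a" "y dvd b" using division_decomp[of d a b] by auto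
    thus "d \<in> (\<lambda>(x, y). x * y) ` ({d. d dvd a} \<times> {d. d dvd b})"
      by (intro image_eqI[of _ _ "(x, y)"]) auto
  qed
  hence "card {d. d dvd a * b} \<le> card ({d. d dvd a} \<times> {d. d dvd b})"
    using assms by (intro surj_card_le) auto
  thus ?thesis by (simp add: divisor_count_def card_cartesian_product)
qed

lemma divisor_count_mono_dvd:
  assumes "a dvd b" "0 < b"
  shows "divisor_count a \<le> divisor_count b"
  unfolding divisor_count_def using assms by (intro card_mono) (auto intro: dvd_trans)

text \<open>Induction on \<open>k\<close>: one factor of d(n)^(k+1) is read as the number of
  factorisations n = d e, so the sum runs over pairs, and submultiplicativity of the remaining power
  splits it into a product of two sums of the previous kind. Hence the bound C becomes C^2.\<close>

lemma divisor_count_moment: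
  "\<exists>C. \<forall>N. (\<Sum>n\<in>{1..N}. real (divisor_count n) ^ k / real n ^ 2) \<le> C"
proof (induction k)
  case 0
  have "(\<Sum>n\<in>{1..N}. real (divisor_count n) ^ 0 / real n ^ 2) \<le> (\<Sum>n. 1 / real n ^ 2)" for N
    using inverse_power_summable[of 2, where 'a = real]
    by (simp only: power_0) (intro sum_le_suminf, auto simp: inverse_eq_divide)
  thus ?case by blast
next
  case (Suc k)
  then obtain C where C: "\<And>N. (\<Sum>n\<in>{1..N}. real (divisor_count n) ^ k / real n ^ 2) \<le> C" by blast
  have "(\<Sum>n\<in>{1..N}. real (divisor_count n) ^ Suc k / real n ^ 2) \<le> C * C" for N
  proof -
    define t where "t n = real (divisor_count n) ^ k / real n ^ 2" for n
    have t0: "0 \<le> t n" for n by (simp add: t_def)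
    have "(\<Sum>n\<in>{1..N}. real (divisor_count n) ^ Suc k / real n ^ 2) =
          (\<Sum>n\<in>{1..N}. \<Sum>d | d dvd n. t n)"
      by (simp add: divisor_count_def t_def)
    also have "\<dots> = (\<Sum>(n, d)\<in>(SIGMA n:{1..N}. {d. d dvd n}). t n)"
      by (intro sum.Sigma) auto
    also have "\<dots> = (\<Sum>(d, e)\<in>(\<lambda>(n, d). (d, n div d)) ` (SIGMA n:{1..N}. {d. d dvd n}). t (d * e))"
    proof (subst sum.reindex)
      show "inj_on (\<lambda>(n, d). (d, n div d)) (SIGMA n:{1..N}. {d. d dvd n})"
        by (auto simp: inj_on_def elim!: dvdE)
    qed (intro sum.cong, auto)
    also have "\<dots> \<le> (\<Sum>(d, e)\<in>{1..N} \<times> {1..N}. t (d * e))"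
    proof (intro sum_mono2)
      show "(\<lambda>(n, d). (d, n div d)) ` (SIGMA n:{1..N}. {d. d dvd n}) \<subseteq> {1..N} \<times> {1..N}"
      proof -
        have "(d, n div d) \<in> {1..N} \<times> {1..N}" if "n \<in> {1..N}" "d dvd n" for n d
        proof -
          have "0 < d" "d \<le> n" "0 < n div d"
            using that dvd_imp_le[of d n] dvd_div_eq_0_iff[of d n] by (auto intro: Nat.gr0I)
          moreover have "n div d \<le> N" using that by (intro order_trans[OF div_le_dividend]) auto
          ultimately show ?thesis using that by auto
        qed
        thus ?thesis by (simp only: image_subset_iff Ball_def mem_Sigma_iff split_paired_All prod.case) blast
      qed
    qed (auto simp: t0)
    also have "\<dots> \<le> (\<Sum>(d, e)\<in>{1..N} \<times> {1..N}. t d * t e)"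
    proof (intro sum_mono, clarsimp)
      fix d e :: nat assume "Suc 0 \<le> d" "Suc 0 \<le> e"
      hence "real (divisor_count (d * e)) ^ k \<le> (real (divisor_count d) * real (divisor_count e)) ^ k"
        using divisor_count_mult_le[of d e] by (intro power_mono) (auto simp flip: of_nat_mult)
      thus "t (d * e) \<le> t d * t e"
        unfolding t_def times_divide_times_eq power_mult_distrib of_nat_mult
        by (rule divide_right_mono) simp
    qed
    also have "\<dots> = (\<Sum>n\<in>{1..N}. t n) * (\<Sum>n\<in>{1..N}. t n)"
      by (simp add: sum_product sum.cartesian_product)
    also have "\<dots> \<le> C * C" using C[of N] by (intro mult_mono) (auto simp: t_def intro!: sum_nonneg order_trans[OF _ C[of N]])
    finally show ?thesis .
  qed
  thus ?case by blast
qed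

text \<open>A single term of a bounded moment sum is bounded, so d(n)^k = O(n^2) for every k. The
  k-th root with k > 2 / \<delta> gives the exponent \<delta>, without any use of prime
  factorisations.\<close>

lemma divisor_count_bound:
  assumes "0 < \<delta>"
  obtains C where "0 < C" "\<And>n. 0 < n \<Longrightarrow> real (divisor_count n) \<le> C * real n powr \<delta>"
proof -
  obtain k :: nat where k: "2 / \<delta> < real k" using reals_Archimedean2 by blast
  have k0: "0 < k" using k assms by (metis divide_pos_pos less_trans of_nat_0_less_iff zero_less_numeral)
  obtain C where C: "\<And>N. (\<Sum>n\<in>{1..N}. real (divisor_count n) ^ k / real n ^ 2) \<le> C"
    using divisor_count_moment by blast
  show thesis
  proof
    show "0 < 1 + \<bar>C\<bar>" by simp
    fix n :: nat assume n: "0 < n"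
    have "real (divisor_count n) ^ k / real n ^ 2 \<le> (\<Sum>n\<in>{1..n}. real (divisor_count n) ^ k / real n ^ 2)"
      using n by (intro member_le_sum) auto
    also have "\<dots> \<le> 1 + \<bar>C\<bar>" using C[of n] by simp
    finally have "real (divisor_count n) ^ k \<le> (1 + \<bar>C\<bar>) * real n ^ 2"
      using n by (simp add: field_simps)
    also have "\<dots> \<le> (1 + \<bar>C\<bar>) ^ k * real n powr (\<delta> * real k)"
    proof (intro mult_mono)
      show "1 + \<bar>C\<bar> \<le> (1 + \<bar>C\<bar>) ^ k" using k0 by (intro self_le_power) auto
      have "real n ^ 2 = real n powr 2" using n by simp
      also have "\<dots> \<le> real n powr (\<delta> * real k)" using k n assms by (intro powr_mono) (auto simp: field_simps)
      finally show "real n ^ 2 \<le> real n powr (\<delta> * real k)" .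
    qed auto
    also have "\<dots> = ((1 + \<bar>C\<bar>) * real n powr \<delta>) ^ k"
      using n by (simp add: power_mult_distrib powr_powr flip: powr_realpow)
    finally show "real (divisor_count n) \<le> (1 + \<bar>C\<bar>) * real n powr \<delta>"
      using k0 by (subst (asm) power_mono_iff) auto
  qed
qed

lemma abs_dirichlet_conv_le:
  assumes "\<And>n. \<bar>f n\<bar> \<le> 1" "\<And>n. \<bar>g n\<bar> \<le> 1"
  shows "\<bar>dirichlet_conv f g n\<bar> \<le> int (divisor_count n)"
proof -
  have "\<bar>dirichlet_conv f g n\<bar> \<le> (\<Sum>d | d dvd n. \<bar>f d * g (n div d)\<bar>)"
    unfolding dirichlet_conv_def by (rule sum_abs)
  also have "\<dots> \<le> (\<Sum>d | d dvd n. 1)"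
  proof (intro sum_mono)
    fix d
    have "\<bar>f d\<bar> * \<bar>g (n div d)\<bar> \<le> 1 * 1" using assms by (intro mult_mono) auto
    thus "\<bar>f d * g (n div d)\<bar> \<le> 1" by (simp add: abs_mult)
  qed
  finally show ?thesis by (simp add: divisor_count_def)
qed

lemma abs_mu2_le: "\<bar>mu2 n\<bar> \<le> int (divisor_count n)"
  by (intro abs_dirichlet_conv_le abs_moebius_mu_le)

section \<open>Dirichlet series\<close>

text \<open>The index starts at 0 but \<open>0 powr _ = 0\<close>, so the value at 0 never matters.\<close>

definition ds :: "(nat \<Rightarrow> complex) \<Rightarrow> complex \<Rightarrow> complex" where
  "ds a s = (\<Sum>n. a n * of_nat n powr (- s))"

definition ds_abs :: "(nat \<Rightarrow> complex) \<Rightarrow> real \<Rightarrow> bool" where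
  "ds_abs a r \<longleftrightarrow> summable (\<lambda>n. norm (a n) * real n powr (- r))"

lemma norm_of_nat_powr: "norm (of_nat n powr s :: complex) = real n powr Re s"
  by (simp add: norm_powr_real_powr)

lemma norm_ds_term: "norm (a n * of_nat n powr (- s)) = norm (a n) * real n powr (- Re s)"
  by (simp add: norm_mult norm_of_nat_powr)

lemma ds_sums: "ds_abs a (Re s) \<Longrightarrow> (\<lambda>n. a n * of_nat n powr (- s)) sums ds a s"
  unfolding ds_def ds_abs_def
  by (intro summable_sums summable_norm_cancel[where f = "\<lambda>n. a n * of_nat n powr (- s)"])
     (simp only: norm_ds_term)

lemma ds_absI:
  assumes "\<And>n. 0 < n \<Longrightarrow> norm (a n) \<le> C * real n powr \<delta>" "1 + \<delta> < r"
  shows "ds_abs a r"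
  unfolding ds_abs_def
proof (rule summable_comparison_test)
  show "summable (\<lambda>n. C * real n powr (\<delta> - r))"
    using assms(2) by (intro summable_mult) (auto simp: summable_real_powr_iff)
  show "\<exists>N. \<forall>n\<ge>N. norm (norm (a n) * real n powr (- r)) \<le> C * real n powr (\<delta> - r)"
  proof (intro exI allI impI)
    fix n :: nat assume n: "1 \<le> n"
    have "norm (a n) * real n powr (- r) \<le> (C * real n powr \<delta>) * real n powr (- r)"
      using assms(1)[of n] n by (intro mult_right_mono) auto
    also have "\<dots> = C * real n powr (\<delta> - r)" by (simp add: powr_diff powr_minus field_simps)
    finally show "norm (norm (a n) * real n powr (- r)) \<le> C * real n powr (\<delta> - r)" by simp
  qed
qed

lemma ds_cong: "(\<And>n. 0 < n \<Longrightarrow> a n = b n) \<Longrightarrow> ds a s = ds b s"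
  unfolding ds_def
proof (intro suminf_cong)
  fix n assume "\<And>n. 0 < n \<Longrightarrow> a n = b n"
  thus "a n * of_nat n powr (- s) = b n * of_nat n powr (- s)" by (cases "n = 0") auto
qed

text \<open>Termwise differentiation; the absolutely convergent series at the abscissa
  \<open>r\<close> is a majorant on the whole half-plane to its right. The second claim is stated
  because \<open>ds\<close> is a \<open>suminf\<close>, whose value alone does not assert
  convergence.\<close>

lemma ds_deriv:
  assumes "ds_abs a r" "r < Re s"
  shows "(ds a has_field_derivative ds (\<lambda>n. - (a n * ln (of_nat n))) s) (at s)"
    and "(\<lambda>n. - (a n * ln (of_nat n)) * of_nat n powr (- s)) sums ds (\<lambda>n. - (a n * ln (of_nat n))) s"
proof -
  define S where "S = {s. r < Re s}"
  have S: "open S" "s \<in> S" unfolding S_def using assms by (rule_tac open_halfspace_Re_gt, simp)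
  have "\<exists>g g'. \<forall>x\<in>S. ((\<lambda>n. a n * of_nat n powr (- x)) sums g x) \<and>
      ((\<lambda>n. - (a n * ln (of_nat n)) * of_nat n powr (- x)) sums g' x) \<and>
      (g has_field_derivative g' x) (at x)"
  proof (rule series_and_derivative_comparison_complex[OF S(1)])
    fix n x
    show "((\<lambda>x. a n * of_nat n powr (- x)) has_field_derivative
             - (a n * ln (of_nat n)) * of_nat n powr (- x)) (at x)"
    proof (cases "n = 0")
      case False
      thus ?thesis using DERIV_cmult[OF DERIV_powr_minus[of "of_nat n" 0 x], of "a n"] by (simp add: mult_ac)
    qed simp
  next
    fix x assume x: "x \<in> S"
    define h where "h n = complex_of_real (norm (a n) * real n powr (- r))" for n
    have "summable h" using assms(1) unfolding h_def summable_of_real_iff ds_abs_def .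
    moreover have "range h \<subseteq> \<real>\<^sub>\<ge>\<^sub>0" by (auto simp: h_def)
    moreover have "norm (a n * of_nat n powr (- y)) \<le> norm (h n)" if y: "y \<in> ball x 1 \<inter> S" for y n
    proof -
      have "norm (a n) * real n powr (- Re y) \<le> norm (a n) * real n powr (- r)"
        using y by (cases "n = 0") (auto simp: S_def intro!: mult_left_mono powr_mono)
      thus ?thesis unfolding norm_ds_term h_def norm_of_real by simp
    qed
    ultimately show "\<exists>d (h :: nat \<Rightarrow> complex). 0 < d \<and> summable h \<and> range h \<subseteq> \<real>\<^sub>\<ge>\<^sub>0 \<and>
       (\<forall>\<^sub>F n in sequentially. \<forall>y\<in>ball x d \<inter> S. norm (a n * of_nat n powr (- y)) \<le> norm (h n))"
      by (intro exI[of _ "1::real"] exI[of _ h] conjI always_eventually allI ballI) auto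
  qed
  then obtain g g' where g: "\<And>x. x \<in> S \<Longrightarrow> (\<lambda>n. a n * of_nat n powr (- x)) sums g x"
    "\<And>x. x \<in> S \<Longrightarrow> (\<lambda>n. - (a n * ln (of_nat n)) * of_nat n powr (- x)) sums g' x"
    "\<And>x. x \<in> S \<Longrightarrow> (g has_field_derivative g' x) (at x)"
    by blast
  have g': "ds (\<lambda>n. - (a n * ln (of_nat n))) s = g' s"
    using g(2)[OF S(2)] by (simp add: ds_def sums_iff)
  show "(ds a has_field_derivative ds (\<lambda>n. - (a n * ln (of_nat n))) s) (at s)"
    unfolding g'
  proof (rule has_field_derivative_transform_within_open[OF g(3)[OF S(2)] S])
    fix x assume "x \<in> S"
    thus "g x = ds a x" using g(1)[of x] by (simp add: ds_def sums_iff)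
  qed
  show "(\<lambda>n. - (a n * ln (of_nat n)) * of_nat n powr (- s)) sums ds (\<lambda>n. - (a n * ln (of_nat n))) s"
    unfolding g' by (rule g(2)[OF S(2)])
qed

text \<open>The double series over pairs (d, e) converges absolutely, so it may be summed by rows,
  giving the product, or grouped by n = d e, giving the convolution.\<close>

lemma ds_mult_sums:
  assumes "ds_abs a (Re s)" "ds_abs b (Re s)"
  shows "(\<lambda>n. (\<Sum>d | d dvd n. a d * b (n div d)) * of_nat n powr (- s)) sums (ds a s * ds b s)"
proof -
  \<comment> \<open>Pairs are taken over positive integers only: grouping by the product fails at 0,
    which has infinitely many divisors.\<close>
  define N :: "nat set" where "N = {0<..}"
  define f where "f n = a n * of_nat n powr (- s)" for n
  define g where "g n = b n * of_nat n powr (- s)" for n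
  have sf: "summable (\<lambda>n. norm (f n))" and sg: "summable (\<lambda>n. norm (g n))"
    using assms unfolding f_def g_def norm_ds_term ds_abs_def by auto
  have f_UNIV: "(f has_sum ds a s) UNIV" and g_UNIV: "(g has_sum ds b s) UNIV"
    using norm_summable_imp_has_sum[OF sf] norm_summable_imp_has_sum[OF sg]
      ds_sums[OF assms(1)] ds_sums[OF assms(2)] unfolding f_def g_def by auto
  have f0: "f 0 = 0" "g 0 = 0" by (simp_all add: f_def g_def)
  have f_N: "(f has_sum ds a s) N"
    by (rule has_sum_cong_neutral[THEN iffD1, OF _ _ _ f_UNIV]) (use f0 in \<open>auto simp: N_def\<close>)
  have g_N: "(g has_sum ds b s) N"
    by (rule has_sum_cong_neutral[THEN iffD1, OF _ _ _ g_UNIV]) (use f0 in \<open>auto simp: N_def\<close>)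
  have absf: "(\<lambda>n. norm (f n)) summable_on N" and absg: "(\<lambda>n. norm (g n)) summable_on N"
    using norm_summable_imp_summable_on[of "\<lambda>n. norm (f n)"] norm_summable_imp_summable_on[of "\<lambda>n. norm (g n)"] sf sg
    by (auto intro: summable_on_subset_banach)
  have absF: "(\<lambda>p. norm (case p of (d, e) \<Rightarrow> f d * g e)) summable_on N \<times> N"
    unfolding Infinite_Sum.abs_summable_on_Sigma_iff
  proof (intro conjI ballI)
    show "(\<lambda>e. norm (case (d, e) of (d, e) \<Rightarrow> f d * g e)) summable_on N" for d
      using summable_on_cmult_right[OF absg, of "norm (f d)"] by (simp add: norm_mult)
    have "(\<lambda>d. norm (f d) * infsum (\<lambda>e. norm (g e)) N) summable_on N"
      using absf by (intro summable_on_cmult_left)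
    moreover have "0 \<le> infsum (\<lambda>e. norm (g e)) N" by (intro infsum_nonneg) auto
    ultimately show "(\<lambda>d. norm (\<Sum>\<^sub>\<infinity>e\<in>N. norm (case (d, e) of (d, e) \<Rightarrow> f d * g e))) summable_on N"
      unfolding prod.case norm_mult infsum_cmult_right' real_norm_def abs_mult
      by (simp only: abs_of_nonneg abs_norm_cancel)
  qed
  define T where "T = infsum (\<lambda>(d, e). f d * g e) (N \<times> N)"
  have F: "((\<lambda>(d, e). f d * g e) has_sum T) (N \<times> N)"
    unfolding T_def by (rule has_sum_infsum[OF Infinite_Sum.abs_summable_summable[OF absF]])
  have "((\<lambda>d. f d * ds b s) has_sum T) N"
    by (rule has_sum_SigmaD[OF F]) (auto intro!: has_sum_cmult_right g_N)
  moreover have "((\<lambda>d. f d * ds b s) has_sum (ds a s * ds b s)) N"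
    by (intro has_sum_cmult_left f_N)
  ultimately have T: "T = ds a s * ds b s" by (rule has_sum_unique)
  have "((\<lambda>(n, d). f d * g (n div d)) has_sum T) (SIGMA n:N. {d. d dvd n})"
    by (rule has_sum_reindex_bij_witness[THEN iffD1, OF _ _ _ _ _ _ F,
          of "\<lambda>(n, d). (d, n div d)" "\<lambda>(d, e). (d * e, d)"])
       (auto simp: N_def dvd_div_eq_0_iff intro: Nat.gr0I)
  hence "((\<lambda>n. \<Sum>d | d dvd n. f d * g (n div d)) has_sum T) N"
    by (rule has_sum_SigmaD) (auto simp: N_def intro!: has_sum_finite)
  also have "((\<lambda>n. \<Sum>d | d dvd n. f d * g (n div d)) has_sum T) N \<longleftrightarrow>
      ((\<lambda>n. (\<Sum>d | d dvd n. a d * b (n div d)) * of_nat n powr (- s)) has_sum T) UNIV"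
  proof (rule has_sum_cong_neutral)
    fix n assume "n \<in> N \<inter> UNIV"
    hence n: "0 < n" by (simp add: N_def)
    have "f d * g (n div d) = a d * b (n div d) * of_nat n powr (- s)" if dn: "d dvd n" for d
    proof -
      obtain e where e: "n = d * e" using dn by (elim dvdE)
      hence "0 < d" "0 < e" using n by auto
      thus ?thesis by (simp add: f_def g_def e powr_times_real)
    qed
    thus "(\<Sum>d | d dvd n. f d * g (n div d)) = (\<Sum>d | d dvd n. a d * b (n div d)) * of_nat n powr (- s)"
      by (simp add: sum_distrib_right)
  qed (auto simp: N_def)
  finally show ?thesis unfolding T by (rule has_sum_imp_sums)
qed

lemma ds_mult:
  assumes "ds_abs a (Re s)" "ds_abs b (Re s)"
  shows "ds (\<lambda>n. \<Sum>d | d dvd n. a d * b (n div d)) s = ds a s * ds b s"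
  using ds_mult_sums[OF assms] by (simp add: ds_def sums_iff)

section \<open>Zeta, its square, its inverse and its logarithmic derivative as Dirichlet
  series\<close>

lemma ds_abs_1: "1 < r \<Longrightarrow> ds_abs (\<lambda>_. 1) r"
  by (rule ds_absI[of _ 1 0]) (auto simp: powr_0)

lemma zeta_eq_ds:
  assumes "1 < Re s"
  shows "zeta s = ds (\<lambda>_. 1) s"
proof -
  have "(\<lambda>n. 1 * of_nat n powr (- s)) sums ds (\<lambda>_. 1) s"
    using assms by (intro ds_sums ds_abs_1)
  hence "(\<lambda>n. of_nat (Suc n) powr (- s)) sums ds (\<lambda>_. 1) s"
    by (subst sums_Suc_iff) simp
  thus ?thesis using zeta_sums[OF assms] sums_unique2 by blast
qed

lemma ds_abs_divisor_count:
  assumes "1 < r"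
  shows "ds_abs (\<lambda>n. of_nat (divisor_count n)) r"
proof -
  obtain C where C: "\<And>n. 0 < n \<Longrightarrow> real (divisor_count n) \<le> C * real n powr ((r - 1) / 2)"
    using divisor_count_bound[of "(r - 1) / 2"] assms by (auto simp: field_simps)
  show ?thesis by (rule ds_absI[of _ C "(r - 1) / 2"]) (use C assms in \<open>auto simp: field_simps\<close>)
qed

lemma ds_divisor_count:
  assumes "1 < Re s"
  shows "ds (\<lambda>n. of_nat (divisor_count n)) s = zeta s ^ 2"
  using ds_mult[OF ds_abs_1 ds_abs_1, OF assms assms] assms
  by (simp add: zeta_eq_ds divisor_count_def power2_eq_square)

lemma ds_abs_moebius_mu: "1 < r \<Longrightarrow> ds_abs (\<lambda>n. of_int (moebius_mu n)) r"
  by (rule ds_absI[of _ 1 0]) (use abs_moebius_mu_le in \<open>auto simp flip: of_int_abs\<close>)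

lemma ds_one: "ds (\<lambda>n. if n = 1 then 1 else 0) s = 1"
proof -
  have "(\<lambda>n. (if n = 1 then 1 else 0) * of_nat n powr (- s)) = (\<lambda>n. if n = 1 then 1 else 0)"
    by auto
  thus ?thesis unfolding ds_def using sums_single[of 1 "\<lambda>_. 1 :: complex"] by (simp add: sums_iff)
qed

lemma zeta_ds_moebius_mu:
  assumes "1 < Re s"
  shows "zeta s * ds (\<lambda>n. of_int (moebius_mu n)) s = 1"
proof -
  have "ds (\<lambda>n. \<Sum>d | d dvd n. of_int (moebius_mu d) * 1) s = ds (\<lambda>n. of_int (moebius_mu n)) s * ds (\<lambda>_. 1) s"
    using assms by (intro ds_mult ds_abs_1 ds_abs_moebius_mu)
  also have "ds (\<lambda>n. \<Sum>d | d dvd n. of_int (moebius_mu d) * 1) s = ds (\<lambda>n. if n = 1 then 1 else 0) s"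
    by (intro ds_cong) (auto simp: sum_moebius_mu simp flip: of_int_sum)
  finally show ?thesis using assms by (simp only: ds_one zeta_eq_ds mult.commute)
qed

lemma zeta_nonzero_gt_1: "1 < Re s \<Longrightarrow> zeta s \<noteq> 0"
  using zeta_ds_moebius_mu[of s] by auto

lemma ds_abs_mu2: "1 < r \<Longrightarrow> ds_abs (\<lambda>n. of_int (mu2 n)) r"
  unfolding ds_abs_def
proof (rule summable_comparison_test[OF _ ds_abs_divisor_count[unfolded ds_abs_def]], intro exI allI impI)
  fix n :: nat
  have "norm (of_int (mu2 n) :: complex) \<le> norm (of_nat (divisor_count n) :: complex)"
    unfolding norm_of_int norm_of_nat using abs_mu2_le[of n] by linarith
  thus "norm (norm (of_int (mu2 n) :: complex) * real n powr (- r))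
      \<le> norm (of_nat (divisor_count n) :: complex) * real n powr (- r)"
    by (subst real_norm_def, subst abs_of_nonneg)
       (auto intro!: mult_right_mono simp del: norm_of_int norm_of_nat)
qed

lemma ds_mu2:
  assumes "1 < Re s"
  shows "ds (\<lambda>n. of_int (mu2 n)) s = 1 / zeta s ^ 2"
proof -
  have "ds (\<lambda>n. of_int (mu2 n)) s = ds (\<lambda>n. of_int (moebius_mu n)) s ^ 2"
    using ds_mult[OF ds_abs_moebius_mu ds_abs_moebius_mu, OF assms assms]
    by (simp add: dirichlet_conv_def power2_eq_square)
  also have "ds (\<lambda>n. of_int (moebius_mu n)) s = 1 / zeta s"
    using zeta_ds_moebius_mu[OF assms] zeta_nonzero_gt_1[OF assms] by (simp add: field_simps)
  finally show ?thesis by (simp add: power_divide)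
qed

lemma zeta_deriv_ds:
  assumes "1 < Re s"
  shows "(zeta has_field_derivative ds (\<lambda>n. - ln (of_nat n)) s) (at s)"
proof -
  have "(ds (\<lambda>_. 1) has_field_derivative ds (\<lambda>n. - (1 * ln (of_nat n))) s) (at s)"
    using assms by (intro ds_deriv(1)[of _ "(1 + Re s) / 2"] ds_abs_1) auto
  hence "(ds (\<lambda>_. 1) has_field_derivative ds (\<lambda>n. - ln (of_nat n)) s) (at s)" by simp
  thus ?thesis
    by (rule has_field_derivative_transform_within_open[of _ _ _ "{s. 1 < Re s}"])
       (use assms in \<open>auto simp: zeta_eq_ds open_halfspace_Re_gt\<close>)
qed

text \<open>The von Mangoldt function is one nonnegative term of its own divisor sum, which equals
  ln n, and ln n is smaller than any power of n up to a constant.\<close>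

lemma ds_abs_mangoldt:
  assumes "1 < r"
  shows "ds_abs mangoldt r"
proof -
  define \<delta> where "\<delta> = (r - 1) / 2"
  have \<delta>: "0 < \<delta>" using assms by (simp add: \<delta>_def)
  have "norm (mangoldt n :: complex) \<le> (1 / \<delta>) * real n powr \<delta>" if n: "0 < n" for n
  proof -
    have "mangoldt n \<le> (\<Sum>d | d dvd n. mangoldt d :: real)"
      using n by (intro member_le_sum) (auto simp: mangoldt_nonneg)
    also have "\<dots> = ln (real n)" using mangoldt_sum[of n, where 'a = real] n by simp
    also have "\<dots> \<le> real n powr \<delta> / \<delta>" using n \<delta> ln_powr_bound[of "real n" \<delta>] by simp
    finally show ?thesis by simp
  qed
  thus ?thesis by (rule ds_absI) (use assms in \<open>auto simp: \<delta>_def field_simps\<close>)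
qed

lemma zeta_ds_mangoldt:
  assumes "1 < Re s"
  shows "deriv zeta s = - zeta s * ds mangoldt s"
proof -
  have "ds (\<lambda>n. \<Sum>d | d dvd n. mangoldt d * 1) s = ds mangoldt s * ds (\<lambda>_. 1) s"
    using assms by (intro ds_mult ds_abs_1 ds_abs_mangoldt)
  also have "ds (\<lambda>n. \<Sum>d | d dvd n. mangoldt d * 1) s = ds (\<lambda>n. ln (of_nat n)) s"
    by (intro ds_cong) (simp add: mangoldt_sum Ln_of_nat)
  also have "ds (\<lambda>n. ln (of_nat n)) s = - ds (\<lambda>n. - ln (of_nat n)) s"
    using ds_deriv(2)[of "\<lambda>_. 1" "(1 + Re s) / 2" s, OF ds_abs_1] assms
    by (simp add: ds_def sums_iff suminf_minus summable_minus_iff)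
  also have "\<dots> = - deriv zeta s" using zeta_deriv_ds[OF assms] DERIV_imp_deriv by metis
  finally have "deriv zeta s = - (ds mangoldt s * ds (\<lambda>_. 1) s)" by (metis minus_minus)
  thus ?thesis using assms by (simp add: zeta_eq_ds mult.commute)
qed

section \<open>Bounds for the zeta function under the Riemann hypothesis\<close>

lemma Re_mult_numeral: "Re (numeral k * z) = numeral k * Re z"
  by simp

text \<open>Termwise this is \<open>3 + 4 cos \<theta> + cos (2 \<theta>) = 2 (1 + cos \<theta>)\<^sup>2 \<ge> 0\<close> with \<open>\<theta> = t ln n\<close>.\<close>

lemma mangoldt_341:
  assumes "1 < \<sigma>"
  shows "0 \<le> Re (3 * ds mangoldt (of_real \<sigma>) + 4 * ds mangoldt (Complex \<sigma> t) + ds mangoldt (Complex \<sigma> (2 * t)))"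
proof -
  define m where "m n = (mangoldt n :: complex)" for n
  have sums: "(\<lambda>n. m n * of_nat n powr (- s)) sums ds m s" if "Re s = \<sigma>" for s
    unfolding m_def using that assms by (intro ds_sums ds_abs_mangoldt) auto
  have S: "(\<lambda>n. Re (3 * (m n * of_nat n powr (- of_real \<sigma>)) + 4 * (m n * of_nat n powr (- Complex \<sigma> t))
      + m n * of_nat n powr (- Complex \<sigma> (2 * t))))
      sums Re (3 * ds m (of_real \<sigma>) + 4 * ds m (Complex \<sigma> t) + ds m (Complex \<sigma> (2 * t)))"
    by (intro sums_Re sums_add sums_mult sums) auto
  have "0 \<le> Re (3 * (m n * of_nat n powr (- of_real \<sigma>)) + 4 * (m n * of_nat n powr (- Complex \<sigma> t))
      + m n * of_nat n powr (- Complex \<sigma> (2 * t)))" for n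
  proof (cases "n = 0")
    case False
    define c where "c = cos (t * ln (real n))"
    have pw: "of_nat n powr (- Complex \<sigma> u) = of_real (real n powr (- \<sigma>)) * cis (- u * ln (real n))" for u
    proof -
      have "- Complex \<sigma> u * ln (of_nat n) = complex_of_real (- \<sigma> * ln (real n)) + \<i> * of_real (- u * ln (real n))"
        using False by (simp add: Ln_of_nat complex_eq_iff)
      thus ?thesis using False
        by (simp add: powr_def exp_add cis_conv_exp exp_of_real[symmetric] del: of_real_mult of_real_minus)
    qed
    have pw0: "of_nat n powr (- complex_of_real \<sigma>) = of_real (real n powr (- \<sigma>))"
      using pw[of 0] by (simp add: complex_of_real_def)
    have m: "m n = of_real (mangoldt n)" by (simp add: m_def)
    have c2: "cos (2 * t * ln (real n)) = 2 * c ^ 2 - 1"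
      unfolding c_def using cos_double_cos[of "t * ln (real n)"] by (simp add: mult.assoc)
    define w where "w = mangoldt n * real n powr (- \<sigma>)"
    have Re: "Re (m n * (of_real (real n powr (- \<sigma>)) * cis (- u * ln (real n)))) = w * cos (u * ln (real n))" for u
      by (simp add: m w_def)
    have Re0: "Re (m n * of_real (real n powr (- \<sigma>))) = w"
      by (simp add: m w_def)
    have "Re (3 * (m n * of_nat n powr (- of_real \<sigma>)) + 4 * (m n * of_nat n powr (- Complex \<sigma> t))
      + m n * of_nat n powr (- Complex \<sigma> (2 * t))) = mangoldt n * real n powr (- \<sigma>) * (2 * (1 + c) ^ 2)"
      unfolding pw pw0 plus_complex.sel Re_mult_numeral Re Re0 c2 c_def[symmetric] w_def[symmetric]
      by (simp add: power2_eq_square algebra_simps)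
    thus ?thesis by (simp add: mangoldt_nonneg)
  qed auto
  hence "0 \<le> Re (3 * ds m (of_real \<sigma>) + 4 * ds m (Complex \<sigma> t) + ds m (Complex \<sigma> (2 * t)))"
    using sums_le[OF _ sums_zero S] by blast
  thus ?thesis unfolding m_def[abs_def] .
qed

text \<open>The Riemann hypothesis only speaks about the open strip, so the line \<open>Re s = 1\<close> needs its own
  argument: a zero at \<open>1 + t \<i>\<close> would make \<open>zeta(\<sigma>)\<^sup>3 zeta(\<sigma> + t \<i>)\<^sup>4 zeta(\<sigma> + 2 t \<i>)\<close> vanish as \<open>\<sigma> \<rightarrow> 1\<close>,
  although its modulus decreases in \<open>\<sigma>\<close>.\<close>

lemma zeta_nonzero_Re_1:
  assumes "t \<noteq> 0"
  shows "zeta (Complex 1 t) \<noteq> 0"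
proof
  assume z0: "zeta (Complex 1 t) = 0"
  define P where "P \<sigma> = zeta (of_real \<sigma>) ^ 3 * zeta (of_real \<sigma> + of_real t * \<i>) ^ 4 *
    zeta (of_real \<sigma> + of_real (2 * t) * \<i>)" for \<sigma> :: real
  have Cx: "Complex \<sigma> u = of_real \<sigma> + of_real u * \<i>" for \<sigma> u by (simp add: complex_eq_iff)
  have dz: "(zeta has_field_derivative deriv zeta s) (at s)" if "s \<noteq> 1" for s
    using zeta_holomorphic that by (intro holomorphic_derivI[of _ "- {1}"]) auto
  have mono: "norm (P 2) \<le> norm (P \<sigma>)" if \<sigma>: "1 < \<sigma>" "\<sigma> \<le> 2" for \<sigma>
  proof -
    \<comment> \<open>The squared modulus of \<open>P\<close>, written as a product with the
      conjugate so that it can be differentiated in the real variable. Its derivative is 2 |P|^2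
      times the real part of the logarithmic derivative L of \<open>P\<close>, and L is minus the
      combination in \<open>mangoldt_341\<close>.\<close>
    define Q where "Q x = Re (P x * cnj (P x))" for x
    have "Q 2 \<le> Q \<sigma>"
    proof (rule DERIV_nonpos_imp_nonincreasing[OF \<sigma>(2)])
      fix x assume x: "\<sigma> \<le> x" "x \<le> 2"
      define L where "L = - (3 * ds mangoldt (of_real x) + 4 * ds mangoldt (Complex x t) + ds mangoldt (Complex x (2 * t)))"
      have dz': "((\<lambda>y. zeta (y + of_real u * \<i>)) has_field_derivative
          - zeta (of_real x + of_real u * \<i>) * ds mangoldt (Complex x u)) (at (of_real x))" for u
      proof -
        have re: "1 < Re (of_real x + of_real u * \<i>)" using x \<sigma> by simp
        hence ne: "of_real x + of_real u * \<i> \<noteq> 1" by (metis less_irrefl one_complex.sel(1))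
        have d1: "((\<lambda>y. y + of_real u * \<i>) has_field_derivative 1) (at (complex_of_real x))"
          by (auto intro!: derivative_eq_intros)
        from DERIV_chain2[where f = zeta and g = "\<lambda>y. y + of_real u * \<i>" and Db = 1 and x = "of_real x" and s = UNIV, OF dz[OF ne] d1]
        show ?thesis unfolding zeta_ds_mangoldt[OF re] Cx by simp
      qed
      have "((\<lambda>y. zeta y ^ 3 * zeta (y + of_real t * \<i>) ^ 4 * zeta (y + of_real (2 * t) * \<i>))
          has_field_derivative P x * L) (at (of_real x))"
        using dz'[of 0] dz'[of t] dz'[of "2 * t"]
        by (auto intro!: derivative_eq_intros simp: P_def L_def Cx algebra_simps power_numeral_reduce)
      hence "((\<lambda>y. P y) has_vector_derivative P x * L) (at x)"
        unfolding P_def by (rule has_vector_derivative_real_field)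
      hence "(Q has_vector_derivative Re (P x * cnj (P x * L) + P x * L * cnj (P x))) (at x)"
        unfolding Q_def
        by (intro bounded_linear.has_vector_derivative[OF bounded_linear_Re] has_vector_derivative_mult
              bounded_linear.has_vector_derivative[OF bounded_linear_cnj])
      moreover have "Re (P x * cnj (P x * L) + P x * L * cnj (P x)) = 2 * (norm (P x) ^ 2 * Re L)"
        unfolding cmod_power2 by (simp add: algebra_simps power2_eq_square)
      moreover have "Re L \<le> 0" using mangoldt_341[of x t] x \<sigma> unfolding L_def by simp
      ultimately have "DERIV Q x :> 2 * (norm (P x) ^ 2 * Re L)" "2 * (norm (P x) ^ 2 * Re L) \<le> 0"
        by (simp_all only: has_real_derivative_iff_has_vector_derivative)
           (intro mult_nonneg_nonpos, auto)
      thus "\<exists>y. DERIV Q x :> y \<and> y \<le> 0" by blast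
    qed
    moreover have "Q x = norm (P x) ^ 2" for x by (simp only: Q_def complex_norm_square[symmetric] Re_complex_of_real)
    ultimately have "norm (P 2) ^ 2 \<le> norm (P \<sigma>) ^ 2" by (simp only:)
    thus ?thesis by (rule power2_le_imp_le) simp
  qed
  have "P 2 \<noteq> 0" unfolding P_def by (auto intro!: zeta_nonzero_gt_1)
  have lim: "(P \<longlongrightarrow> 0) (at_right 1)"
  proof -
    define p where "p = 1 + of_real t * \<i>"
    \<comment> \<open>Since \<sigma> + i t - p = \<sigma> - 1, the denominators of three difference
      quotients absorb the triple pole of zeta(\<sigma>)^3. The fourth factor zeta(\<sigma> + i t)
      stays over and forces the limit 0.\<close>
    let ?Q = "\<lambda>\<sigma>. Hz (of_real \<sigma>) ^ 3 * ((zeta (of_real \<sigma> + of_real t * \<i>) - zeta p) / (of_real \<sigma> + of_real t * \<i> - p)) ^ 3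
        * zeta (of_real \<sigma> + of_real t * \<i>) * zeta (of_real \<sigma> + of_real (2 * t) * \<i>)"
    have p: "p \<noteq> 1" "zeta p = 0" using assms z0 by (auto simp: p_def Cx)
    have sh: "((\<lambda>\<sigma>. complex_of_real \<sigma> + of_real u * \<i>) \<longlongrightarrow> 1 + of_real u * \<i>) (at_right 1)" for u
      by (auto intro!: tendsto_eq_intros)
    have at: "filterlim (\<lambda>\<sigma>. complex_of_real \<sigma> + of_real t * \<i>) (at p) (at_right 1)"
      unfolding filterlim_at p_def using sh by (auto simp: eventually_at_filter complex_eq_iff)
    have 1: "((\<lambda>\<sigma>. Hz (of_real \<sigma>)) \<longlongrightarrow> 1) (at_right 1)"
    proof -
      have "isCont Hz 1" using Hz_deriv_1 DERIV_isCont by blast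
      moreover have "((\<lambda>\<sigma>. complex_of_real \<sigma>) \<longlongrightarrow> 1) (at_right 1)" by (auto intro!: tendsto_eq_intros)
      ultimately show ?thesis using isCont_tendsto_compose Hz_1 by metis
    qed
    have 2: "((\<lambda>\<sigma>. (zeta (of_real \<sigma> + of_real t * \<i>) - zeta p) / (of_real \<sigma> + of_real t * \<i> - p)) \<longlongrightarrow> deriv zeta p) (at_right 1)"
      using dz[OF p(1)] unfolding has_field_derivative_iff by (rule filterlim_compose[OF _ at])
    have 3: "((\<lambda>\<sigma>. zeta (of_real \<sigma> + of_real u * \<i>)) \<longlongrightarrow> zeta (1 + of_real u * \<i>)) (at_right 1)" if "u \<noteq> 0" for u
    proof (rule isCont_tendsto_compose[OF _ sh])
      show "isCont zeta (1 + of_real u * \<i>)"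
        using that by (intro DERIV_isCont[OF dz]) (auto simp: complex_eq_iff)
    qed
    have A: "((\<lambda>\<sigma>. ?Q \<sigma>) \<longlongrightarrow>
        1 ^ 3 * deriv zeta p ^ 3 * zeta (1 + of_real t * \<i>) * zeta (1 + of_real (2 * t) * \<i>)) (at_right 1)"
      using assms by (intro tendsto_mult tendsto_power 1 2 3) auto
    have B: "1 ^ 3 * deriv zeta p ^ 3 * zeta (1 + of_real t * \<i>) * zeta (1 + of_real (2 * t) * \<i>) = 0"
      using p by (simp add: p_def)
    have C: "\<forall>\<^sub>F \<sigma> in at_right 1. ?Q \<sigma> = P \<sigma>"
    proof (unfold eventually_at_filter, rule always_eventually, intro allI impI)
      fix \<sigma> :: real assume \<sigma>: "\<sigma> \<noteq> 1" "\<sigma> \<in> {1<..}"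
      hence "of_real \<sigma> - 1 \<noteq> (0 :: complex)" "Hz (of_real \<sigma>) = (of_real \<sigma> - 1) * zeta (of_real \<sigma>)"
        by (simp, intro Hz_eq, auto)
      thus "?Q \<sigma> = P \<sigma>"
        unfolding P_def p(2) by (simp add: p_def power_divide power_mult_distrib power_numeral_reduce)
    qed
    show ?thesis by (rule Lim_transform_eventually[OF A[unfolded B] C])
  qed
  have "norm (P 2) \<le> norm (0 :: complex)"
  proof (rule tendsto_lowerbound[OF tendsto_norm[OF lim]])
    show "\<forall>\<^sub>F x in at_right 1. norm (P 2) \<le> norm (P x)"
      using eventually_at_right_real[of 1 2] by (rule eventually_mono) (use mono in auto)
  qed simp
  with \<open>P 2 \<noteq> 0\<close> show False by simp
qed

lemma RH_zeta_nonzero: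
  assumes "riemann_hypothesis" "1 / 2 < Re s" "s \<noteq> 1"
  shows "zeta s \<noteq> 0"
proof (cases "Re s" "1 :: real" rule: linorder_cases)
  case less
  have "0 < Re s" using assms(2) by linarith
  with less have "Re s = 1 / 2" if "zeta s = 0" using assms(1) that unfolding riemann_hypothesis_def by blast
  thus ?thesis using assms(2) by linarith
next
  case equal
  hence "s = Complex 1 (Im s)" by (simp add: complex_eq_iff)
  thus ?thesis using zeta_nonzero_Re_1[of "Im s"] assms(3) by (metis complex_eq_iff one_complex.sel(2) equal one_complex.sel(1))
qed (use zeta_nonzero_gt_1 in auto)

text \<open>
  Borel-Caratheodory and Hadamard three circles at once: \<open>g = f / (2 * A - f)\<close> is bounded by 1 on the
  large disc and small on the small one, and the maximum principle is applied to \<open>g z / z ^ n\<close> on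
  the annulus between them.
\<close>

lemma norm_le_of_Re_le_on_disc:
  fixes f :: "complex \<Rightarrow> complex"
  assumes f: "f holomorphic_on ball 0 R0" and R: "0 < r1" "r1 \<le> r2" "r2 \<le> R" "R < R0"
    and A: "0 < A" "\<And>z. norm z \<le> R \<Longrightarrow> Re (f z) \<le> A"
    and C: "\<And>z. norm z \<le> r1 \<Longrightarrow> norm (f z) \<le> C" "C \<le> A"
    and \<delta>: "\<delta> \<le> 1 / 2" "(r2 / R) ^ n \<le> \<delta>" "C * (r2 / r1) ^ n \<le> \<delta> * A"
    and z: "norm z \<le> r2"
  shows "norm (f z) \<le> 4 * A * \<delta>"
proof -
  define g where "g w = f w / (2 * of_real A - f w)" for w
  have C0: "0 \<le> C" using C(1)[of 0] R order_trans[OF norm_ge_zero] by fastforce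
  have R0: "0 < R" "0 < r2" using R by auto
  have nz: "2 * of_real A - f w \<noteq> 0" if "norm w \<le> R" for w
  proof
    assume "2 * of_real A - f w = 0"
    hence "Re (f w) = 2 * A" by (simp add: complex_eq_iff)
    with A(2)[OF that] A(1) show False by simp
  qed
  \<comment> \<open>The difference of the two squared moduli is 4 A (A - Re f): the half-plane Re
    \<le> A consists of points not farther from 0 than from 2 A. This is why g maps into the unit
    disc.\<close>
  have le: "norm (f w) \<le> norm (2 * of_real A - f w)" if "norm w \<le> R" for w
  proof -
    have "0 \<le> 4 * A * (A - Re (f w))" using A(1) A(2)[OF that] by simp
    hence "norm (f w) ^ 2 \<le> norm (2 * of_real A - f w) ^ 2"
      unfolding cmod_power2 by (simp add: power2_eq_square algebra_simps)
    thus ?thesis by (rule power2_le_imp_le) simp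
  qed
  have g1: "norm (g w) \<le> 1" if "norm w \<le> R" for w
    using le[OF that] nz[OF that] by (simp add: g_def norm_divide)
  have g2: "norm (g w) \<le> C / A" if w: "norm w \<le> r1" for w
  proof -
    have "A \<le> 2 * A - norm (f w)" using C(1)[OF w] C(2) by simp
    also have "\<dots> \<le> norm (2 * of_real A - f w)"
      using norm_triangle_ineq2[of "2 * of_real A" "f w"] A(1) by (simp add: norm_mult)
    finally show ?thesis unfolding g_def norm_divide using C(1)[OF w] A(1) C0 by (intro frac_le) auto
  qed
  \<comment> \<open>Because r2 / r1 is at least 1, the third hypothesis on \<delta> already settles
    the points of the inner disc, where the annulus is of no use.\<close>
  have "1 \<le> (r2 / r1) ^ n" using R by (intro one_le_power) auto
  hence "C * 1 \<le> C * (r2 / r1) ^ n" using C0 by (intro mult_left_mono)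
  hence CA: "C / A \<le> \<delta>" using \<delta>(3) A(1) by (simp add: field_simps)
  have g\<delta>: "norm (g z) \<le> \<delta>"
  proof (cases "norm z \<le> r1")
    case True
    thus ?thesis using g2[OF True] CA by simp
  next
    case False
    define S where "S = cball 0 R - ball (0 :: complex) r1"
    define B where "B = max (1 / R ^ n) (C / A / r1 ^ n)"
    define h where "h w = g w / w ^ n" for w
    have holo: "h holomorphic_on S"
    proof -
      have "f holomorphic_on S" by (rule holomorphic_on_subset[OF f]) (use R in \<open>auto simp: S_def\<close>)
      thus ?thesis unfolding h_def g_def using nz R by (intro holomorphic_intros) (auto simp: S_def)
    qed
    have closed: "closed S" by (auto simp: S_def)
    have "norm (h z) \<le> B"
    proof (rule maximum_modulus_frontier[of h S])
      show "h holomorphic_on interior S" using holo interior_subset holomorphic_on_subset by blast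
      show "continuous_on (closure S) h" using holo closed holomorphic_on_imp_continuous_on by simp
      show "bounded S" unfolding S_def by (intro bounded_diff) auto
      show "z \<in> S" using False z R by (auto simp: S_def)
      fix w assume "w \<in> frontier S"
      also have "frontier S = S - interior S" using closed by (simp add: frontier_def)
      finally have w: "w \<in> S" "w \<notin> interior S" by auto
      have "ball 0 R - cball 0 r1 \<subseteq> interior S" by (rule interior_maximal) (auto simp: S_def)
      hence "\<not> (norm w < R \<and> r1 < norm w)" using w(2) by auto
      moreover have "r1 \<le> norm w" "norm w \<le> R" using w(1) by (auto simp: S_def)
      ultimately consider "norm w = R" | "norm w = r1" by linarith
      thus "norm (h w) \<le> B"
      proof cases
        case 1
        hence "norm (h w) \<le> 1 / R ^ n"
          unfolding h_def norm_divide norm_power using g1[of w] R0 by (auto intro: divide_right_mono)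
        thus ?thesis by (simp add: B_def)
      next
        case 2
        hence "norm (h w) \<le> C / A / r1 ^ n"
          unfolding h_def norm_divide norm_power 2 using g2[of w] 2 R by (intro divide_right_mono) auto
        thus ?thesis by (simp add: B_def)
      qed
    qed
    moreover have "z \<noteq> 0" using False R by auto
    hence "norm (g z) = norm (h z) * norm z ^ n"
      by (simp add: h_def norm_divide norm_power)
    ultimately have "norm (g z) \<le> B * r2 ^ n"
      using z R0 R by (auto intro!: mult_mono power_mono simp: B_def le_max_iff_disj)
    also have "B * r2 ^ n = max (1 / R ^ n * r2 ^ n) (C / A / r1 ^ n * r2 ^ n)"
      unfolding B_def using R0 by (subst max_mult_distrib_right) simp
    also have "\<dots> = max ((r2 / R) ^ n) (C * (r2 / r1) ^ n / A)"
      by (simp add: power_divide mult_ac)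
    also have "\<dots> \<le> \<delta>"
      using \<delta>(2,3) A(1) by (intro max.boundedI) (simp_all only: pos_divide_le_eq)
    finally show ?thesis .
  qed
  have zR: "norm z \<le> R" using z R by simp
  \<comment> \<open>Solving for f gives f = 2 A g - f g. As |g| \<le> \<delta> \<le> 1/2, the last
    term is absorbed into the left side, which doubles the bound 2 A \<delta>.\<close>
  have "g z * (2 * of_real A - f z) = f z"
    using nz[OF zR] by (simp add: g_def)
  hence "f z = 2 * of_real A * g z - f z * g z"
    by (simp add: algebra_simps)
  hence "norm (f z) \<le> norm (2 * of_real A * g z) + norm (f z * g z)"
    using norm_triangle_ineq4 by metis
  also have "\<dots> = 2 * A * norm (g z) + norm (f z) * norm (g z)" using A(1) by (simp add: norm_mult)
  also have "\<dots> \<le> 2 * A * \<delta> + norm (f z) * (1 / 2)"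
    using g\<delta> \<delta>(1) A(1) by (intro add_mono mult_left_mono) auto
  finally show ?thesis by simp
qed

section \<open>Sub-polynomial growth of zeta and its inverse\<close>

lemma zeta_near_1:
  assumes "3 \<le> Re s"
  shows "norm (zeta s - 1) \<le> 1 / 2"
proof -
  have z: "(\<lambda>n. of_nat (Suc n) powr (- s)) sums zeta s" using assms by (intro zeta_sums) auto
  hence "(\<lambda>n. of_nat (Suc (Suc n)) powr (- s)) sums (zeta s - 1)"
    by (subst sums_Suc_iff) simp
  hence eq: "zeta s - 1 = (\<Sum>n. of_nat (Suc (Suc n)) powr (- s))" by (simp add: sums_iff)
  have tel: "(\<lambda>n. (inverse (real (Suc n)) - inverse (real (Suc (Suc n)))) / 2) sums ((inverse (real (Suc 0)) - 0) / 2)"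
    by (intro sums_divide telescope_sums' LIMSEQ_inverse_real_of_nat)
  have "norm (\<Sum>n. complex_of_nat (Suc (Suc n)) powr (- s)) \<le> (\<Sum>n. (inverse (real (Suc n)) - inverse (real (Suc (Suc n)))) / 2)"
  proof (rule norm_suminf_le)
    show "summable (\<lambda>n. (inverse (real (Suc n)) - inverse (real (Suc (Suc n)))) / 2)"
      using tel by (simp add: sums_iff)
    fix n
    have "norm (complex_of_nat (Suc (Suc n)) powr (- s)) = real (Suc (Suc n)) powr (- Re s)"
      by (simp add: norm_of_nat_powr del: of_nat_Suc)
    also have "\<dots> \<le> real (Suc (Suc n)) powr (- 3)" using assms by (intro powr_mono) auto
    also have "\<dots> = inverse (real (Suc (Suc n)) ^ 3)" by (simp add: powr_minus del: of_nat_Suc)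
    \<comment> \<open>For m = n + 2 this is 1 / m^3 \<le> 1 / (2 (m - 1) m), whose right side
      telescopes to the total 1/2.\<close>
    also have "\<dots> \<le> inverse (2 * real (Suc n) * real (Suc (Suc n)))"
    proof (rule le_imp_inverse_le)
      have "0 \<le> real n ^ 3 + 4 * real n ^ 2 + 6 * real n + 4" by simp
      thus "2 * real (Suc n) * real (Suc (Suc n)) \<le> real (Suc (Suc n)) ^ 3"
        by (simp add: power2_eq_square power3_eq_cube algebra_simps)
    qed simp
    also have "\<dots> = (inverse (real (Suc n)) - inverse (real (Suc (Suc n)))) / 2"
      by (simp add: field_simps)
    finally show "norm (complex_of_nat (Suc (Suc n)) powr (- s)) \<le> (inverse (real (Suc n)) - inverse (real (Suc (Suc n)))) / 2" .
  qed
  also have "\<dots> = 1 / 2" using tel by (simp add: sums_iff)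
  finally show ?thesis unfolding eq .
qed

text \<open>zeta lies within 1/2 of 1, so the real part of its logarithm is at most 1 in modulus,
  and the imaginary part of the principal branch at most \<pi> < 4. Positivity of the real part
  keeps zeta off the branch cut, so that \<open>Ln\<close> may be differentiated.\<close>

lemma norm_Ln_zeta_le:
  assumes "3 \<le> Re s"
  shows "norm (Ln (zeta s)) \<le> 5" "0 < Re (zeta s)"
proof -
  have 1: "norm (zeta s - 1) \<le> 1 / 2" by (rule zeta_near_1[OF assms])
  show 2: "0 < Re (zeta s)" using abs_Re_le_cmod[of "zeta s - 1"] 1 by simp
  hence nz: "zeta s \<noteq> 0" by auto
  have n1: "norm (zeta s) \<le> 3 / 2" using norm_triangle_ineq[of 1 "zeta s - 1"] 1 by simp
  have n2: "1 / 2 \<le> norm (zeta s)" using norm_triangle_ineq2[of 1 "1 - zeta s"] 1 by (simp add: norm_minus_commute)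
  have "ln (norm (zeta s)) \<le> 1" using ln_le_minus_one[of "norm (zeta s)"] n1 nz by simp
  moreover have "- ln (norm (zeta s)) \<le> 1"
  proof -
    have "inverse (norm (zeta s)) \<le> 2" using n2 nz by (simp add: field_simps)
    thus ?thesis using ln_le_minus_one[of "inverse (norm (zeta s))"] nz by (simp add: ln_inverse)
  qed
  ultimately have "\<bar>Re (Ln (zeta s))\<bar> \<le> 1" using nz by simp
  moreover have "\<bar>Im (Ln (zeta s))\<bar> \<le> 4" using mpi_less_Im_Ln[OF nz] Im_Ln_le_pi[OF nz] pi_less_4 by simp
  ultimately show "norm (Ln (zeta s)) \<le> 5" using cmod_le[of "Ln (zeta s)"] by linarith
qed

text \<open>The disc of radius 7/2 about c = 4 + i t touches the critical line, so under the Riemann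
  hypothesis zeta has a holomorphic logarithm f there. Re f = O(ln |t|) on a slightly smaller disc
  and f = O(1) on the unit disc, so the disc lemma gives |f| \<le> \<epsilon> ln |t| up to Re s =
  1/2 + \<eta>. Bounding the modulus of f rather than its real part controls zeta and its inverse
  together.\<close>

lemma RH_zeta_large_Im:
  assumes RH: "riemann_hypothesis" and \<eta>: "0 < \<eta>" "\<eta> \<le> 1" and \<epsilon>: "0 < \<epsilon>" "\<epsilon> \<le> 1"
  obtains T where "1 \<le> T" "\<And>s. \<lbrakk>1 / 2 + \<eta> \<le> Re s; Re s \<le> 4; T \<le> \<bar>Im s\<bar>\<rbrakk> \<Longrightarrow>
    norm (zeta s) \<le> \<bar>Im s\<bar> powr \<epsilon> \<and> norm (1 / zeta s) \<le> \<bar>Im s\<bar> powr \<epsilon>"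
proof -
  obtain C0 where C0: "0 < C0" "\<And>s. 1 / 2 \<le> Re s \<Longrightarrow> norm (Hz s) \<le> C0 * (1 + norm s) ^ 2"
    using Hz_bound[of "1 / 2"] by auto
  define R r2 where "R = 7 / 2 - \<eta> / 2" and "r2 = 7 / 2 - \<eta>"
  have R: "1 \<le> r2" "r2 < R" "R < 7 / 2" "0 < R" "0 < r2" using \<eta> by (auto simp: R_def r2_def)
  \<comment> \<open>The final bound is 4 A \<delta> with A = 3 ln |t|, so \<delta> = \<epsilon> / 12
    yields \<epsilon> ln |t|. The exponent \<open>n\<close> is fixed before the height
    \<open>T\<close>, which depends on it.\<close>
  obtain n where n: "(r2 / R) ^ n < \<epsilon> / 12"
    using real_arch_pow_inv[of "\<epsilon> / 12" "r2 / R"] R \<epsilon> by auto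
  \<comment> \<open>The entries in turn: 5 keeps the disc away from the pole, 9 C0 absorbs the
    constant of the quadratic bound into a third power of |t|, the next makes the bound 5 on the
    unit disc small relative to \<delta> A even after the factor r2^n, and exp 5 gives 5 \<le>
    A.\<close>
  define T where "T = Max {5, 9 * C0, exp (5 * r2 ^ n * 4 / \<epsilon>), exp 5}"
  have T: "5 \<le> T" "9 * C0 \<le> T" "exp (5 * r2 ^ n * 4 / \<epsilon>) \<le> T" "exp 5 \<le> T"
    unfolding T_def by (intro Max_ge; simp)+
  show thesis
  proof (rule that[of T])
    show "1 \<le> T" using T by simp
    fix s assume s: "1 / 2 + \<eta> \<le> Re s" "Re s \<le> 4" "T \<le> \<bar>Im s\<bar>"
    define t where "t = Im s"
    have t: "T \<le> \<bar>t\<bar>" "5 \<le> \<bar>t\<bar>" using s T by (auto simp: t_def)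
    define c where "c = Complex 4 t"
    define B where "B = ball (0 :: complex) (7 / 2)"
    have Re: "1 / 2 < Re (c + w)" and Im: "1 \<le> \<bar>Im (c + w)\<bar>" if "w \<in> B" for w
      using that abs_Re_le_cmod[of w] abs_Im_le_cmod[of w] t by (auto simp: B_def c_def)
    have ne1: "c + w \<noteq> 1" if "w \<in> B" for w using Im[OF that] by (auto simp del: plus_complex.sel)
    have nz: "zeta (c + w) \<noteq> 0" if "w \<in> B" for w
      using RH_zeta_nonzero[OF RH Re[OF that] ne1[OF that]] .
    have holo: "(\<lambda>w. zeta (c + w)) holomorphic_on B"
    proof -
      have "zeta \<circ> (\<lambda>w. c + w) holomorphic_on B"
        by (intro holomorphic_on_compose_gen[OF _ zeta_holomorphic] holomorphic_intros) (use ne1 in auto)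
      thus ?thesis by (simp add: o_def)
    qed
    obtain g where g: "g holomorphic_on B" "\<And>w. w \<in> B \<Longrightarrow> exp (g w) = zeta (c + w)"
      by (rule holomorphic_logarithm_exists[OF _ _ holo nz, of 0]) (auto simp: B_def)
    \<comment> \<open>A logarithm is determined up to a constant; this one is normalised to agree
      with the principal branch at the centre.\<close>
    define f where "f w = g w - g 0 + Ln (zeta c)" for w
    have f_holo: "f holomorphic_on B" unfolding f_def by (intro holomorphic_intros g)
    have zc: "zeta c \<noteq> 0" using nz[of 0] by (simp add: B_def)
    have f_exp: "exp (f w) = zeta (c + w)" if "w \<in> B" for w
      using g(2)[OF that] g(2)[of 0] zc by (simp add: f_def exp_add exp_diff B_def)
    have Re_f: "Re (f w) = ln (norm (zeta (c + w)))" if "w \<in> B" for w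
      using f_exp[OF that] by (metis norm_exp_eq_Re ln_exp)
    \<comment> \<open>On the unit disc Re (c + w) \<ge> 3, where the principal logarithm of zeta is
      holomorphic. It has the same derivative as f and the same value at 0, so its bound 5 carries
      over to f.\<close>
    have small: "norm (f w) \<le> 5" if w: "norm w \<le> 1" for w
    proof -
      define D where "D = cball (0 :: complex) 1"
      have DB: "D \<subseteq> B" by (auto simp: D_def B_def)
      have Re3: "3 \<le> Re (c + w)" if "w \<in> D" for w
        using that abs_Re_le_cmod[of w] by (auto simp: D_def c_def)
      have "\<exists>k. \<forall>w\<in>D. f w - Ln (zeta (c + w)) = k"
      proof (rule has_field_derivative_zero_constant)
        show "convex D" by (simp add: D_def)
        fix w assume w: "w \<in> D"
        hence wB: "w \<in> B" using DB by blast
        have df: "(f has_field_derivative deriv f w) (at w)"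
          using holomorphic_derivI[OF f_holo _ wB] by (simp add: B_def)
        define z' where "z' = deriv (\<lambda>w. zeta (c + w)) w"
        have dz: "((\<lambda>w. zeta (c + w)) has_field_derivative z') (at w)"
          using holomorphic_derivI[OF holo _ wB] by (simp add: B_def z'_def)
        have "((\<lambda>w. exp (f w)) has_field_derivative exp (f w) * deriv f w) (at w)"
          using df by (auto intro!: derivative_eq_intros)
        hence "((\<lambda>w. zeta (c + w)) has_field_derivative exp (f w) * deriv f w) (at w)"
          by (rule has_field_derivative_transform_within_open[of _ _ _ B]) (use wB f_exp in \<open>auto simp: B_def\<close>)
        hence "z' = zeta (c + w) * deriv f w" using dz DERIV_unique f_exp[OF wB] by metis
        moreover have "((\<lambda>w. Ln (zeta (c + w))) has_field_derivative z' / zeta (c + w)) (at w)"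
        proof -
          have "zeta (c + w) \<notin> \<real>\<^sub>\<le>\<^sub>0"
            using norm_Ln_zeta_le(2)[OF Re3[OF w]] by (auto simp: complex_nonpos_Reals_iff)
          from DERIV_chain2[OF has_field_derivative_Ln[OF this] dz]
          show ?thesis by (simp add: field_simps)
        qed
        ultimately have "((\<lambda>w. Ln (zeta (c + w))) has_field_derivative deriv f w) (at w)"
          using nz[OF wB] by simp
        from DERIV_diff[OF df this]
        show "((\<lambda>w. f w - Ln (zeta (c + w))) has_field_derivative 0) (at w within D)"
          by (simp add: has_field_derivative_at_within)
      qed
      then obtain k where k: "\<And>w. w \<in> D \<Longrightarrow> f w - Ln (zeta (c + w)) = k" by blast
      have "k = 0" using k[of 0] by (simp add: D_def f_def)
      with k[of w] w have "f w = Ln (zeta (c + w))" by (simp add: D_def)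
      thus ?thesis using norm_Ln_zeta_le(1)[OF Re3[of w]] w by (simp add: D_def)
    qed
    define A where "A = 3 * ln \<bar>t\<bar>"
    have lnt: "5 \<le> ln \<bar>t\<bar>" "5 * r2 ^ n * 4 / \<epsilon> \<le> ln \<bar>t\<bar>"
      using t T order_trans[OF T(3) t(1)] order_trans[OF T(4) t(1)] by (auto simp: ln_ge_iff)
    have A: "0 < A" "5 \<le> A" using lnt by (auto simp: A_def)
    have Re_le: "Re (f w) \<le> A" if "norm w \<le> R" for w
    proof -
      have w: "w \<in> B" using that R by (auto simp: B_def)
      have "norm (c + w) \<le> norm c + norm w" by (rule norm_triangle_ineq)
      also have "norm c \<le> 4 + \<bar>t\<bar>" using cmod_le[of c] by (simp add: c_def)
      finally have nw: "1 + norm (c + w) \<le> 3 * \<bar>t\<bar>" using that R t by simp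
      have w1: "1 \<le> norm (c + w - 1)" using Im[OF w] abs_Im_le_cmod[of "c + w - 1"] by simp
      have "norm (zeta (c + w)) = norm (Hz (c + w)) / norm (c + w - 1)"
        using Re[OF w] by (subst zeta_eq_Hz) (auto simp: norm_divide)
      also have "\<dots> \<le> norm (Hz (c + w)) / 1" using w1 by (intro divide_left_mono) auto
      also have "\<dots> \<le> C0 * (1 + norm (c + w)) ^ 2" using C0(2)[of "c + w"] Re[OF w] by simp
      also have "\<dots> \<le> C0 * (3 * \<bar>t\<bar>) ^ 2" using C0(1) nw by (intro mult_left_mono power_mono) auto
      also have "\<dots> = 9 * C0 * \<bar>t\<bar> ^ 2" by (simp add: power_mult_distrib)
      also have "\<dots> \<le> \<bar>t\<bar> * \<bar>t\<bar> ^ 2" using T t by (intro mult_right_mono) auto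
      finally have "norm (zeta (c + w)) \<le> \<bar>t\<bar> ^ 3" by (simp add: power_numeral_reduce)
      hence "ln (norm (zeta (c + w))) \<le> ln (\<bar>t\<bar> ^ 3)" using nz[OF w] t by (subst ln_le_cancel_iff) auto
      also have "\<dots> = A" unfolding A_def using t by (subst ln_realpow) auto
      finally show ?thesis using Re_f[OF w] by simp
    qed
    define z where "z = s - c"
    have z: "z = of_real (Re s - 4)" by (simp add: z_def c_def t_def complex_eq_iff)
    have nz': "norm z \<le> r2" unfolding z norm_of_real using s by (simp add: r2_def)
    hence zB: "z \<in> B" using R by (auto simp: B_def)
    have "norm (f z) \<le> 4 * A * (\<epsilon> / 12)"
    proof (rule norm_le_of_Re_le_on_disc[where f = f and z = z])
      show "f holomorphic_on ball 0 (7 / 2)" using f_holo by (simp add: B_def)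
      show "0 < (1 :: real)" "1 \<le> r2" "r2 \<le> R" "R < 7 / 2" "0 < A" "5 \<le> A"
        "(r2 / R) ^ n \<le> \<epsilon> / 12" "\<epsilon> / 12 \<le> 1 / 2" "norm z \<le> r2"
        using R A n nz' \<epsilon> by auto
      have "60 * r2 ^ n \<le> \<epsilon> * A" using lnt(2) \<epsilon> by (simp add: A_def field_simps)
      thus "5 * (r2 / 1) ^ n \<le> \<epsilon> / 12 * A" by simp
    qed (use Re_le small in auto)
    hence "norm (f z) \<le> \<epsilon> * ln \<bar>t\<bar>" by (simp add: A_def mult.commute)
    hence *: "\<bar>Re (f z)\<bar> \<le> \<epsilon> * ln \<bar>t\<bar>" using abs_Re_le_cmod[of "f z"] by simp
    have sz: "s = c + z" by (simp add: z_def)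
    have ns: "norm (zeta s) = exp (Re (f z))" using f_exp[OF zB] sz by (metis norm_exp_eq_Re)
    have "norm (1 / zeta s) = exp (- Re (f z))" by (simp add: norm_divide ns exp_minus field_simps)
    moreover have "\<bar>Im s\<bar> powr \<epsilon> = exp (\<epsilon> * ln \<bar>t\<bar>)" using t by (simp add: powr_def t_def)
    moreover have "Re (f z) \<le> \<epsilon> * ln \<bar>t\<bar>" "- Re (f z) \<le> \<epsilon> * ln \<bar>t\<bar>"
      using * by (simp_all only: abs_le_iff)
    ultimately show "norm (zeta s) \<le> \<bar>Im s\<bar> powr \<epsilon> \<and> norm (1 / zeta s) \<le> \<bar>Im s\<bar> powr \<epsilon>"
      using ns by simp
  qed
qed

text \<open>The point s = 1 is included: \<open>Hz 1 = 1\<close>, and both sides of the second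
  equation are 0 there. Thus 1 / zeta becomes a quotient of holomorphic functions on all of Re s >
  1/2.\<close>

lemma RH_inverse_zeta_eq:
  assumes "riemann_hypothesis" "1 / 2 < Re s"
  shows "Hz s \<noteq> 0" "1 / zeta s = (s - 1) / Hz s"
proof -
  show "Hz s \<noteq> 0"
  proof (cases "s = 1")
    case False
    thus ?thesis using RH_zeta_nonzero[OF assms False] Hz_eq[of s] assms(2) by simp
  qed (simp add: Hz_1)
  show "1 / zeta s = (s - 1) / Hz s" using assms(2) by (subst zeta_eq_Hz) auto
qed

lemma RH_inverse_zeta_holomorphic:
  assumes "riemann_hypothesis"
  shows "(\<lambda>s. 1 / zeta s) holomorphic_on {s. 1 / 2 < Re s}"
proof -
  have "(\<lambda>s. (s - 1) / Hz s) holomorphic_on {s. 1 / 2 < Re s}"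
    using RH_inverse_zeta_eq[OF assms]
    by (intro holomorphic_intros holomorphic_on_subset[OF Hz_holomorphic]) auto
  thus ?thesis by (rule holomorphic_transform) (use RH_inverse_zeta_eq[OF assms] in auto)
qed

abbreviation brk :: "real \<Rightarrow> real" where
  "brk v \<equiv> 1 + \<bar>v\<bar>"

text \<open>For |Im s| > T the previous estimate applies; the remaining part of the strip is a
  compact box, where continuity suffices. For zeta itself the pole must be avoided, and the closed
  set \<open>S\<close> allows the caller to choose how: a vertical line, or all s with |Im s| \<ge>
  1.\<close>

lemma RH_zeta_bounds:
  assumes RH: "riemann_hypothesis" and \<eta>: "0 < \<eta>" and \<epsilon>: "0 < \<epsilon>"
    and S: "closed S" "1 \<notin> S"
  obtains C where "0 < C"
    "\<And>s. \<lbrakk>1 / 2 + \<eta> \<le> Re s; Re s \<le> 4\<rbrakk> \<Longrightarrow> norm (1 / zeta s) \<le> C * brk (Im s) powr \<epsilon>"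
    "\<And>s. \<lbrakk>1 / 2 + \<eta> \<le> Re s; Re s \<le> 4; s \<in> S\<rbrakk> \<Longrightarrow> norm (zeta s) \<le> C * brk (Im s) powr \<epsilon>"
proof -
  define \<eta>' \<epsilon>' where "\<eta>' = min \<eta> 1" and "\<epsilon>' = min \<epsilon> 1"
  obtain T where T: "1 \<le> T" "\<And>s. \<lbrakk>1 / 2 + \<eta>' \<le> Re s; Re s \<le> 4; T \<le> \<bar>Im s\<bar>\<rbrakk> \<Longrightarrow>
    norm (zeta s) \<le> \<bar>Im s\<bar> powr \<epsilon>' \<and> norm (1 / zeta s) \<le> \<bar>Im s\<bar> powr \<epsilon>'"
    using RH_zeta_large_Im[of \<eta>' \<epsilon>'] RH \<eta> \<epsilon> by (auto simp: \<eta>'_def \<epsilon>'_def)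
  define K where "K = cbox (Complex (1 / 2 + \<eta>) (- T)) (Complex 4 T)"
  have K: "compact K" by (simp add: K_def)
  have K_iff: "s \<in> K \<longleftrightarrow> 1 / 2 + \<eta> \<le> Re s \<and> Re s \<le> 4 \<and> \<bar>Im s\<bar> \<le> T" for s
    by (auto simp: K_def in_cbox_complex_iff)
  have "compact ((\<lambda>s. 1 / zeta s) ` K)"
    using \<eta> by (intro compact_continuous_image K holomorphic_on_imp_continuous_on
        holomorphic_on_subset[OF RH_inverse_zeta_holomorphic[OF RH]]) (auto simp: K_iff)
  from compact_imp_bounded[OF this] obtain C1 where C1: "\<And>s. s \<in> K \<Longrightarrow> norm (1 / zeta s) \<le> C1"
    unfolding bounded_iff by blast
  have "compact (zeta ` (K \<inter> S))"
    by (intro compact_continuous_image compact_Int_closed K S holomorphic_on_imp_continuous_on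
        holomorphic_on_subset[OF zeta_holomorphic]) (use S in auto)
  from compact_imp_bounded[OF this] obtain C2 where C2: "\<And>s. s \<in> K \<Longrightarrow> s \<in> S \<Longrightarrow> norm (zeta s) \<le> C2"
    unfolding bounded_iff by blast
  define C where "C = 1 + \<bar>C1\<bar> + \<bar>C2\<bar>"
  have aux: "x \<le> C * brk y powr \<epsilon>" if "x \<le> C" for x y
  proof -
    have "C * 1 \<le> C * brk y powr \<epsilon>"
      using \<epsilon> ge_one_powr_ge_zero[of "1 + \<bar>y\<bar>" \<epsilon>] by (intro mult_left_mono) (auto simp: C_def)
    with that show ?thesis by simp
  qed
  have aux2: "x \<le> C * brk y powr \<epsilon>" if "x \<le> \<bar>y\<bar> powr \<epsilon>'" for x y
  proof -
    have "\<bar>y\<bar> powr \<epsilon>' \<le> brk y powr \<epsilon>'" using \<epsilon> by (intro powr_mono2) (auto simp: \<epsilon>'_def)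
    also have "\<dots> \<le> brk y powr \<epsilon>" by (intro powr_mono) (auto simp: \<epsilon>'_def)
    also have "\<dots> \<le> C * brk y powr \<epsilon>" by (simp add: C_def algebra_simps)
    finally show ?thesis using that by simp
  qed
  show thesis
  proof (rule that)
    show "0 < C" by (simp add: C_def)
    fix s assume s: "1 / 2 + \<eta> \<le> Re s" "Re s \<le> 4"
    show "norm (1 / zeta s) \<le> C * brk (Im s) powr \<epsilon>"
    proof (cases "\<bar>Im s\<bar> \<le> T")
      case True
      thus ?thesis using C1[of s] s by (intro aux) (auto simp: K_iff C_def)
    next
      case False
      thus ?thesis using T(2)[of s] s by (intro aux2) (auto simp: \<eta>'_def)
    qed
    assume "s \<in> S"
    show "norm (zeta s) \<le> C * brk (Im s) powr \<epsilon>"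
    proof (cases "\<bar>Im s\<bar> \<le> T")
      case True
      thus ?thesis using C2[of s] s \<open>s \<in> S\<close> by (intro aux) (auto simp: K_iff C_def)
    next
      case False
      thus ?thesis using T(2)[of s] s by (intro aux2) (auto simp: \<eta>'_def)
    qed
  qed
qed

section \<open>Integrals over vertical lines\<close>

lemma integrable_one_plus_abs_powr:
  assumes "1 < \<kappa>"
  shows "integrable lborel (\<lambda>v :: real. brk v powr (- \<kappa>))"
proof -
  define f where "f v = brk v powr (- \<kappa>)" for v :: real
  have f: "f \<in> borel_measurable borel" unfolding f_def by measurable
  have "(\<integral>\<^sup>+ x. ennreal (f x) * indicator {0..} x \<partial>lborel) = ennreal (0 - (- ((1 + 0) powr (1 - \<kappa>) / (\<kappa> - 1))))"
  proof (rule nn_integral_FTC_atLeast[OF f])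
    fix x :: real assume x: "0 \<le> x"
    have "((\<lambda>x. 1 + x) has_field_derivative 1) (at x)" by (auto intro!: derivative_eq_intros)
    from DERIV_minus[OF DERIV_cdivide[OF DERIV_chain2[OF has_real_derivative_powr[of "1 + x" "1 - \<kappa>"] this]]]
    have "((\<lambda>x. - ((1 + x) powr (1 - \<kappa>) / (\<kappa> - 1))) has_field_derivative
        - ((1 - \<kappa>) * (1 + x) powr (1 - \<kappa> - 1) * 1 / (\<kappa> - 1))) (at x)" using x by simp
    moreover have "- ((1 - \<kappa>) * (1 + x) powr (1 - \<kappa> - 1) * 1 / (\<kappa> - 1)) = f x"
      using assms x by (simp add: f_def field_simps)
    ultimately show "((\<lambda>x. - ((1 + x) powr (1 - \<kappa>) / (\<kappa> - 1))) has_field_derivative f x) (at x)"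
      by simp
  next
    have "((\<lambda>x. (1 + x) powr (1 - \<kappa>)) \<longlongrightarrow> 0) at_top"
      using assms by (intro tendsto_neg_powr filterlim_tendsto_add_at_top[OF tendsto_const filterlim_ident]) auto
    from tendsto_minus[OF tendsto_mult_left_zero[OF this, of "1 / (\<kappa> - 1)"]]
    show "((\<lambda>x. - ((1 + x) powr (1 - \<kappa>) / (\<kappa> - 1))) \<longlongrightarrow> 0) at_top" by simp
  qed (simp add: f_def)
  also have "\<dots> < \<infinity>" by simp
  finally have fin: "(\<integral>\<^sup>+ x. ennreal (f x) * indicator {0..} x \<partial>lborel) < \<infinity>" .
  have i1: "integrable lborel (\<lambda>v. f v * indicator {0..} v)"
    using f fin by (intro integrableI_nonneg) (auto simp: f_def ennreal_mult' ennreal_indicator)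
  have "integrable lborel (\<lambda>v. f (0 + (-1) * v) * indicator {0..} (0 + (-1) * v))"
    by (rule lborel_integrable_real_affine[OF i1]) simp
  with i1 have "integrable lborel (\<lambda>v. f v * indicator {0..} v + f (0 + (-1) * v) * indicator {0..} (0 + (-1) * v))"
    by (rule Bochner_Integration.integrable_add)
  thus ?thesis unfolding f_def[symmetric]
    by (rule Bochner_Integration.integrable_bound) (use f in \<open>auto simp: f_def indicator_def\<close>)
qed

definition J :: "real \<Rightarrow> real" where
  "J \<kappa> = (LINT v|lborel. brk v powr (- \<kappa>))"

lemma J_nonneg: "0 \<le> J \<kappa>"
  unfolding J_def by (intro integral_nonneg_AE) auto

lemma line_integral_bound:
  fixes g :: "real \<Rightarrow> complex"
  assumes "1 < \<kappa>" "continuous_on UNIV g" "\<And>v. norm (g v) \<le> C * brk v powr (- \<kappa>)"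
  shows "integrable lborel g" "norm (LINT v|lborel. g v) \<le> C * J \<kappa>"
proof -
  have int: "integrable lborel (\<lambda>v. C * brk v powr (- \<kappa>))"
    using integrable_one_plus_abs_powr[OF assms(1)] by simp
  show "integrable lborel g"
    by (rule Bochner_Integration.integrable_bound[OF int])
       (use assms in \<open>auto intro!: borel_measurable_continuous_onI AE_I2 order_trans[OF assms(3)]\<close>)
  have "norm (LINT v|lborel. g v) \<le> (LINT v|lborel. C * brk v powr (- \<kappa>))"
    by (rule Bochner_Integration.integral_norm_bound_integral[OF \<open>integrable lborel g\<close> int assms(3)])
  thus "norm (LINT v|lborel. g v) \<le> C * J \<kappa>" by (simp add: J_def)
qed

text \<open>Decay is required only for large |v|, since a compact interval merely enlarges the
  constant. This covers lines at whose low points no explicit bound is at hand.\<close>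

lemma line_integrable:
  fixes g :: "real \<Rightarrow> complex"
  assumes "1 < \<kappa>" "continuous_on UNIV g" "\<And>v. T \<le> \<bar>v\<bar> \<Longrightarrow> norm (g v) \<le> C * brk v powr (- \<kappa>)"
  shows "integrable lborel g"
proof -
  have "compact (g ` {-T..T})"
    by (intro compact_continuous_image continuous_on_subset[OF assms(2)]) auto
  from compact_imp_bounded[OF this] obtain M where M: "\<And>v. v \<in> {-T..T} \<Longrightarrow> norm (g v) \<le> M"
    unfolding bounded_iff by blast
  define D where "D = \<bar>C\<bar> + \<bar>M\<bar> * brk T powr \<kappa>"
  show ?thesis
  proof (rule line_integral_bound(1)[OF assms(1,2)])
    fix v
    show "norm (g v) \<le> D * brk v powr (- \<kappa>)"
    proof (cases "T \<le> \<bar>v\<bar>")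
      case True
      have "norm (g v) \<le> C * brk v powr (- \<kappa>)" by (rule assms(3)[OF True])
      also have "\<dots> \<le> D * brk v powr (- \<kappa>)" by (intro mult_right_mono) (auto simp: D_def intro: add_increasing2)
      finally show ?thesis .
    next
      case False
      have "v \<in> {-T..T}" using False by (simp, linarith)
      from M[OF this] have "norm (g v) \<le> \<bar>M\<bar>" by linarith
      also have "\<dots> = \<bar>M\<bar> * brk v powr \<kappa> * brk v powr (- \<kappa>)" by (simp add: powr_minus field_simps)
      also have "\<dots> \<le> D * brk v powr (- \<kappa>)"
      proof (rule mult_right_mono)
        have "brk v powr \<kappa> \<le> brk T powr \<kappa>" using False assms(1) by (intro powr_mono2) auto
        thus "\<bar>M\<bar> * brk v powr \<kappa> \<le> D" by (auto simp: D_def intro!: add_increasing mult_left_mono)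
      qed simp
      finally show ?thesis .
    qed
  qed
qed

text \<open>The bridge between contour integrals along segments, which are gauge integrals, and
  Lebesgue integrals over the whole line, by dominated convergence.\<close>

lemma line_integral_LIMSEQ:
  fixes g :: "real \<Rightarrow> complex"
  assumes "integrable lborel g" "continuous_on UNIV g"
  shows "(\<lambda>n. integral {- real n..real n} g) \<longlonglongrightarrow> (LINT v|lborel. g v)"
proof -
  have "(\<lambda>n. LINT v|lborel. indicator {- real n..real n} v *\<^sub>R g v) \<longlonglongrightarrow> (LINT v|lborel. g v)"
  proof (rule integral_dominated_convergence[where w = "\<lambda>v. norm (g v)"])
    show "AE v in lborel. (\<lambda>n. indicator {- real n..real n} v *\<^sub>R g v) \<longlonglongrightarrow> g v"
    proof (rule AE_I2, rule tendsto_eventually)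
      fix v :: real
      show "\<forall>\<^sub>F n in sequentially. indicator {- real n..real n} v *\<^sub>R g v = g v"
        using eventually_ge_at_top[of "nat \<lceil>\<bar>v\<bar>\<rceil>"]
        by (rule eventually_mono) (auto simp: indicator_def; linarith)
    qed
  qed (use assms in \<open>auto simp: indicator_def borel_measurable_integrable\<close>)
  moreover have "(LINT v|lborel. indicator {- real n..real n} v *\<^sub>R g v) = integral {- real n..real n} g" for n
  proof -
    have "set_integrable lborel {- real n..real n} g"
      unfolding set_integrable_def by (intro borel_integrable_compact continuous_on_subset[OF assms(2)]) auto
    from set_borel_integral_eq_integral(2)[OF this] show ?thesis by (simp add: set_lebesgue_integral_def)
  qed
  ultimately show ?thesis by simp
qed

lemma continuous_on_vertical_line:
  assumes "G holomorphic_on S" "\<And>v. Complex a v \<in> S"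
  shows "continuous_on UNIV (\<lambda>v. G (Complex a v))"
  by (rule continuous_on_compose2[OF holomorphic_on_imp_continuous_on[OF assms(1)]])
     (use assms(2) in \<open>auto intro!: continuous_intros\<close>)

text \<open>Residue theorem on rectangles of height n \<rightarrow> \<infinity>; the horizontal
  sides contribute O(n^(-\<kappa>)). Integrals are taken in the ordinate v, so the factor i of ds =
  i dv cancels and 2 \<pi> remains. \<open>T\<close> and \<open>C\<close> do not enter the
  conclusion.\<close>

lemma contour_shift:
  assumes ab: "a < b" and S: "open S" "connected S" "{s. a \<le> Re s \<and> Re s \<le> b} \<subseteq> S"
    and P: "finite P" "\<And>p. p \<in> P \<Longrightarrow> a < Re p \<and> Re p < b"
    and G: "G holomorphic_on S - P" and \<kappa>: "1 < \<kappa>"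
    and bound: "\<And>s. \<lbrakk>a \<le> Re s; Re s \<le> b; T \<le> \<bar>Im s\<bar>\<rbrakk> \<Longrightarrow> norm (G s) \<le> C * brk (Im s) powr (- \<kappa>)"
  shows "(LINT v|lborel. G (Complex b v)) - (LINT v|lborel. G (Complex a v)) = 2 * pi * (\<Sum>p\<in>P. residue G p)"
    and "integrable lborel (\<lambda>v. G (Complex a v))" "integrable lborel (\<lambda>v. G (Complex b v))"
proof -
  let ?J = "\<lambda>n c. integral {- real n..real n} (\<lambda>v. G (Complex c v))"
  let ?Ib = "LINT v|lborel. G (Complex b v)"
  let ?Ia = "LINT v|lborel. G (Complex a v)"
  have cont: "continuous_on UNIV (\<lambda>v. G (Complex c v))" if "c = a \<or> c = b" for c
  proof (rule continuous_on_vertical_line[OF G])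
    fix v
    have "Complex c v \<in> S" using that S ab by auto
    moreover have "Complex c v \<notin> P" using that P(2)[of "Complex c v"] by auto
    ultimately show "Complex c v \<in> S - P" by simp
  qed
  have int: "integrable lborel (\<lambda>v. G (Complex c v))" if "c = a \<or> c = b" for c
    by (rule line_integrable[OF \<kappa> cont[OF that], of T C]) (use that ab bound[of "Complex c v" for v] in auto)
  show "integrable lborel (\<lambda>v. G (Complex a v))" "integrable lborel (\<lambda>v. G (Complex b v))"
    using int by auto
  define h where "h n = contour_integral (linepath (Complex a (- real n)) (Complex b (- real n))) G
    + contour_integral (linepath (Complex b (real n)) (Complex a (real n))) G" for n
  \<comment> \<open>Beyond this height a rectangle encloses all poles, and the decay bound holds on
    its horizontal sides.\<close>
  define N0 where "N0 = Max (insert \<bar>T\<bar> ((\<lambda>p. \<bar>Im p\<bar>) ` P))"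
  have N0: "\<bar>T\<bar> \<le> N0" "\<And>p. p \<in> P \<Longrightarrow> \<bar>Im p\<bar> \<le> N0" using P(1) by (auto simp: N0_def)
  have large: "\<forall>\<^sub>F n in sequentially. N0 < real n"
    by (rule eventually_mono[OF eventually_gt_at_top[of "nat \<lceil>N0\<rceil>"]]) linarith
  have seg: "closed_segment x y \<subseteq> S - P" if "x \<in> {Complex a u, Complex b u}" "y \<in> {Complex a u, Complex b u}" "N0 < \<bar>u\<bar>" for x y u
  proof
    fix z assume "z \<in> closed_segment x y"
    hence z: "Im z = u" "a \<le> Re z" "Re z \<le> b"
      using that ab by (auto simp: closed_segment_same_Im closed_segment_eq_real_ivl split: if_splits)
    moreover have "z \<notin> P" using N0(2)[of z] that z by auto
    ultimately show "z \<in> S - P" using S by auto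
  qed
  have seg': "closed_segment (Complex c u) (Complex c u') \<subseteq> S - P" if "c = a \<or> c = b" for c u u'
  proof
    fix z assume "z \<in> closed_segment (Complex c u) (Complex c u')"
    hence z: "Re z = c" using that ab by (auto simp: closed_segment_same_Re)
    moreover have "z \<notin> P" using P(2)[of z] that z by auto
    ultimately show "z \<in> S - P" using S that ab by auto
  qed
  have contS: "continuous_on (S - P) G" using G by (rule holomorphic_on_imp_continuous_on)
  have ci: "G contour_integrable_on linepath x y" if "closed_segment x y \<subseteq> S - P" for x y
    by (rule contour_integrable_continuous_linepath[OF continuous_on_subset[OF contS that]])
  have main: "\<i> * (?J n b - ?J n a) + h n
      = 2 * pi * \<i> * (\<Sum>p\<in>P. residue G p)" if n: "N0 < real n" for n
  proof -
    define a1 a3 where "a1 = Complex a (- real n)" and "a3 = Complex b (real n)"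
    have n0: "0 < real n" using n N0(1) by linarith
    have nn: "N0 < \<bar>- real n\<bar>" "N0 < \<bar>real n\<bar>" using n by auto
    have "contour_integral (rectpath a1 a3) G = 2 * pi * \<i> * (\<Sum>p\<in>P. winding_number (rectpath a1 a3) p * residue G p)"
    proof (rule Residue_theorem[OF S(1,2) P(1) G])
      show "valid_path (rectpath a1 a3)" by simp
      show "pathfinish (rectpath a1 a3) = pathstart (rectpath a1 a3)" by simp
      show "path_image (rectpath a1 a3) \<subseteq> S - P"
        unfolding rectpath_def Let_def a1_def a3_def complex.sel
        by (intro subset_path_image_join) (simp_all only: path_image_linepath, (intro seg[OF _ _ nn(1)] seg[OF _ _ nn(2)] seg'; simp)+)
      show "\<forall>z. z \<notin> S \<longrightarrow> winding_number (rectpath a1 a3) z = 0"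
      proof (intro allI impI winding_number_rectpath_outside)
        fix z assume "z \<notin> S"
        thus "z \<notin> cbox a1 a3" using S(3) by (auto simp: in_cbox_complex_iff a1_def a3_def)
      qed (use ab n0 in \<open>auto simp: a1_def a3_def\<close>)
    qed
    also have "(\<Sum>p\<in>P. winding_number (rectpath a1 a3) p * residue G p) = (\<Sum>p\<in>P. residue G p)"
    proof (rule sum.cong)
      fix p assume p: "p \<in> P"
      have "p \<in> box a1 a3" using P(2)[OF p] N0(2)[OF p] n by (auto simp: in_box_complex_iff a1_def a3_def)
      thus "winding_number (rectpath a1 a3) p * residue G p = residue G p"
        by (simp add: winding_number_rectpath)
    qed simp
    also have "contour_integral (rectpath a1 a3) G =
        contour_integral (linepath a1 (Complex b (- real n))) G + (contour_integral (linepath (Complex b (- real n)) a3) G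
        + (contour_integral (linepath a3 (Complex a (real n))) G + contour_integral (linepath (Complex a (real n)) a1) G))"
    proof -
      have i: "G contour_integrable_on linepath a1 (Complex b (- real n))"
        "G contour_integrable_on linepath (Complex b (- real n)) a3"
        "G contour_integrable_on linepath a3 (Complex a (real n))"
        "G contour_integrable_on linepath (Complex a (real n)) a1"
        unfolding a1_def a3_def by (intro ci seg[OF _ _ nn(1)] seg[OF _ _ nn(2)] seg'; simp)+
      have r: "rectpath a1 a3 = linepath a1 (Complex b (- real n)) +++ linepath (Complex b (- real n)) a3 +++
          linepath a3 (Complex a (real n)) +++ linepath (Complex a (real n)) a1"
        by (simp add: rectpath_def Let_def a1_def a3_def)
      show ?thesis unfolding r
        by (subst contour_integral_join; (simp add: i contour_integrable_joinI valid_path_join)?)+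
    qed
    also have "contour_integral (linepath (Complex b (- real n)) a3) G = \<i> * ?J n b"
      by (rule contour_integral_linepath_same_Re) (use n0 in \<open>auto simp: a3_def\<close>)
    also have "contour_integral (linepath (Complex a (real n)) a1) G = - contour_integral (linepath a1 (Complex a (real n))) G"
      unfolding a1_def by (intro contour_integral_reverse_linepath continuous_on_subset[OF contS] seg') auto
    also have "contour_integral (linepath a1 (Complex a (real n))) G = \<i> * ?J n a"
      by (rule contour_integral_linepath_same_Re) (use n0 in \<open>auto simp: a1_def\<close>)
    finally show ?thesis by (simp add: h_def a1_def a3_def algebra_simps)
  qed
  have h: "h \<longlonglongrightarrow> 0"
  proof (rule tendsto_0_le[where K = 1])
    define e where "e n = 2 * (\<bar>C\<bar> * (b - a)) * (1 + real n) powr (- \<kappa>)" for n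
    have "(\<lambda>n. (1 + real n) powr (- \<kappa>)) \<longlonglongrightarrow> 0"
      using \<kappa> by (intro tendsto_neg_powr filterlim_tendsto_add_at_top[OF tendsto_const filterlim_real_sequentially]) auto
    thus "e \<longlonglongrightarrow> 0" unfolding e_def by (rule tendsto_mult_right_zero)
    show "\<forall>\<^sub>F n in sequentially. norm (h n) \<le> norm (e n) * 1"
      using large
    proof (rule eventually_mono)
      fix n assume n: "N0 < real n"
      have b: "norm (contour_integral (linepath x y) G) \<le> (\<bar>C\<bar> * (1 + real n) powr (- \<kappa>)) * norm (y - x)"
        if xy: "x \<in> {Complex a u, Complex b u}" "y \<in> {Complex a u, Complex b u}" "\<bar>u\<bar> = real n" for x y u
      proof (rule contour_integral_bound_linepath)
        have nu: "N0 < \<bar>u\<bar>" using n xy by simp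
        show "G contour_integrable_on linepath x y" by (rule ci[OF seg[OF xy(1,2) nu]])
        fix z assume "z \<in> closed_segment x y"
        hence z: "Im z = u" "a \<le> Re z" "Re z \<le> b"
          using xy ab by (auto simp: closed_segment_same_Im closed_segment_eq_real_ivl split: if_splits)
        have "norm (G z) \<le> C * brk (Im z) powr (- \<kappa>)" using z nu N0(1) by (intro bound) auto
        also have "\<dots> \<le> \<bar>C\<bar> * (1 + real n) powr (- \<kappa>)" using z xy by (intro mult_mono) auto
        finally show "norm (G z) \<le> \<bar>C\<bar> * (1 + real n) powr (- \<kappa>)" .
      qed auto
      have d: "norm (Complex b u - Complex a u) = b - a" "norm (Complex a u - Complex b u) = b - a" for u
      proof -
        have "Complex b u - Complex a u = of_real (b - a)" "Complex a u - Complex b u = of_real (a - b)"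
          by (simp_all add: complex_eq_iff)
        thus "norm (Complex b u - Complex a u) = b - a" "norm (Complex a u - Complex b u) = b - a"
          using ab by (simp_all only: norm_of_real)
      qed
      have "norm (h n) \<le> (\<bar>C\<bar> * (1 + real n) powr (- \<kappa>)) * (b - a) + (\<bar>C\<bar> * (1 + real n) powr (- \<kappa>)) * (b - a)"
        unfolding h_def
        using b[of "Complex a (- real n)" "- real n" "Complex b (- real n)"] b[of "Complex b (real n)" "real n" "Complex a (real n)"]
        by (intro norm_triangle_le add_mono) (auto simp: d)
      also have "\<dots> = norm (e n) * 1" unfolding e_def using ab by (simp add: abs_mult)
      finally show "norm (h n) \<le> norm (e n) * 1" .
    qed
  qed
  have "(\<lambda>n. \<i> * (?J n b - ?J n a) + h n)
     \<longlonglongrightarrow> \<i> * (?Ib - ?Ia) + 0"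
    by (intro tendsto_intros line_integral_LIMSEQ int cont h) auto
  moreover have "\<forall>\<^sub>F n in sequentially. \<i> * (?J n b - ?J n a) + h n
      = 2 * pi * \<i> * (\<Sum>p\<in>P. residue G p)"
    using large by (rule eventually_mono) (rule main)
  ultimately have "\<i> * (?Ib - ?Ia) + 0 = 2 * pi * \<i> * (\<Sum>p\<in>P. residue G p)"
    using tendsto_unique[OF sequentially_bot _ tendsto_eventually] by blast
  thus "?Ib - ?Ia = 2 * pi * (\<Sum>p\<in>P. residue G p)"
    by (simp add: mult_ac)
qed

section \<open>A smoothed Perron formula\<close>

text \<open>The Perron kernel integrated once in \<open>y\<close>. It picks out the weight max(0, y
  - 1) instead of a jump, and its quadratic decay makes the integrals converge absolutely.\<close>

definition kern :: "real \<Rightarrow> complex \<Rightarrow> complex" where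
  "kern y s = of_real y powr (s + 1) / (s * (s + 1))"

lemma norm_Complex_ge:
  assumes "m \<le> 1" "m \<le> \<bar>a\<bar>"
  shows "m / 2 * brk v \<le> norm (Complex a v)"
proof -
  have "\<bar>a\<bar> \<le> norm (Complex a v)" "\<bar>v\<bar> \<le> norm (Complex a v)"
    using abs_Re_le_cmod[of "Complex a v"] abs_Im_le_cmod[of "Complex a v"] by auto
  moreover have "m * \<bar>v\<bar> \<le> 1 * \<bar>v\<bar>" using assms by (intro mult_right_mono) auto
  ultimately show ?thesis using assms by (simp add: field_simps)
qed

lemma norm_of_real_powr: "0 < y \<Longrightarrow> norm (of_real y powr s :: complex) = y powr Re s"
  by (simp add: norm_powr_real_powr)


text \<open>The quadratic decay is divided into two parts: the power -3/2 of the ordinate remains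
  integrable, and the power -1/2 of the distance b of the vertical line makes the integral vanish
  when the line is moved to infinity.\<close>

lemma inverse_norm_le:
  assumes "1 \<le> b" "b \<le> norm z" "b \<le> norm w" "\<bar>v\<bar> \<le> norm z" "\<bar>v\<bar> \<le> norm w"
  shows "1 / (norm z * norm w) \<le> 4 * b powr (- (1 / 2)) * brk v powr (- (3 / 2))"
proof -
  define m where "m = min (norm z) (norm w)"
  have m: "b \<le> m" "\<bar>v\<bar> \<le> m" "m \<le> norm z" "m \<le> norm w" using assms by (auto simp: m_def)
  hence m0: "0 < m" "1 + \<bar>v\<bar> \<le> 2 * m" using assms(1) by auto
  have zw: "0 < norm z" "0 < norm w" using m m0 by linarith+
  have "1 / (norm z * norm w) \<le> 1 / (m * m)"
    using m m0 zw by (intro divide_left_mono mult_mono mult_pos_pos) auto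
  also have "\<dots> = m powr (- 2)" using m0 by (simp add: powr_minus powr_numeral power2_eq_square inverse_eq_divide)
  also have "\<dots> = m powr (- (1 / 2)) * m powr (- (3 / 2))" by (simp flip: powr_add)
  also have "\<dots> \<le> b powr (- (1 / 2)) * (brk v / 2) powr (- (3 / 2))"
    using m m0 assms(1) by (intro mult_mono powr_mono2') auto
  also have "(brk v / 2) powr (- (3 / 2)) = 2 powr (3 / 2) * brk v powr (- (3 / 2))"
    by (simp add: powr_divide powr_minus field_simps)
  also have "b powr (- (1 / 2)) * (2 powr (3 / 2) * brk v powr (- (3 / 2))) \<le> b powr (- (1 / 2)) * (4 * brk v powr (- (3 / 2)))"
  proof (intro mult_left_mono mult_right_mono)
    have "2 powr (3 / 2) \<le> 2 powr (2 :: real)" by (intro powr_mono) auto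
    thus "2 powr (3 / 2) \<le> (4 :: real)" by (simp add: powr_numeral)
  qed auto
  finally show ?thesis by (simp add: mult_ac)
qed

lemma kern_line_decay:
  assumes "0 < y" "1 \<le> b" "b \<le> \<bar>a\<bar>" "b \<le> \<bar>a + 1\<bar>"
  shows "norm (kern y (Complex a v)) \<le> y powr (a + 1) * (4 * b powr (- (1 / 2))) * brk v powr (- (3 / 2))"
proof -
  have c: "Complex a v + 1 = Complex (a + 1) v" by (simp add: complex_eq_iff)
  have "1 / (norm (Complex a v) * norm (Complex (a + 1) v)) \<le> 4 * b powr (- (1 / 2)) * brk v powr (- (3 / 2))"
    using assms abs_Re_le_cmod[of "Complex a v"] abs_Im_le_cmod[of "Complex a v"]
      abs_Re_le_cmod[of "Complex (a + 1) v"] abs_Im_le_cmod[of "Complex (a + 1) v"]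
    by (intro inverse_norm_le) auto
  hence "y powr (a + 1) * (1 / (norm (Complex a v) * norm (Complex (a + 1) v))) \<le>
    y powr (a + 1) * (4 * b powr (- (1 / 2)) * brk v powr (- (3 / 2)))"
    by (intro mult_left_mono) auto
  thus ?thesis using assms by (simp add: kern_def norm_divide norm_mult norm_of_real_powr c mult_ac)
qed

lemma kern_strip_decay:
  assumes "0 < y" "1 \<le> \<bar>Im s\<bar>" "a \<le> Re s" "Re s \<le> b"
  shows "norm (kern y s) \<le> (y powr (a + 1) + y powr (b + 1)) * 4 * brk (Im s) powr (- (3 / 2))"
proof -
  have "1 / (norm s * norm (s + 1)) \<le> 4 * 1 powr (- (1 / 2)) * brk (Im s) powr (- (3 / 2))"
    using assms abs_Im_le_cmod[of s] abs_Im_le_cmod[of "s + 1"] by (intro inverse_norm_le) auto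
  moreover have "y powr (Re s + 1) \<le> y powr (a + 1) + y powr (b + 1)"
  proof (cases "1 \<le> y")
    case True
    hence "y powr (Re s + 1) \<le> y powr (b + 1)" using assms by (intro powr_mono) auto
    thus ?thesis by (simp add: add_increasing)
  next
    case False
    hence "y powr (Re s + 1) \<le> y powr (a + 1)" using assms by (intro powr_mono') auto
    thus ?thesis by (simp add: add_increasing2)
  qed
  ultimately have "y powr (Re s + 1) * (1 / (norm s * norm (s + 1))) \<le>
      (y powr (a + 1) + y powr (b + 1)) * (4 * brk (Im s) powr (- (3 / 2)))"
    by (intro mult_mono) auto
  moreover have "norm (kern y s) = y powr (Re s + 1) * (1 / (norm s * norm (s + 1)))"
    unfolding kern_def norm_divide norm_mult using assms(1) by (simp add: norm_of_real_powr)
  ultimately show ?thesis by (simp only: mult.assoc)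
qed

lemma kern_holomorphic: "0 < y \<Longrightarrow> kern y holomorphic_on UNIV - {0, -1}"
  unfolding kern_def[abs_def] by (intro holomorphic_intros) (auto simp: add_eq_0_iff2)

lemma residue_kern:
  assumes "0 < y"
  shows "residue (kern y) 0 = of_real y" "residue (kern y) (-1) = -1"
proof -
  have "residue (\<lambda>s. (of_real y powr (s + 1) / (s + 1)) / (s - 0)) 0 = of_real y powr (0 + 1) / (0 + 1)"
    by (rule residue_simple[of "{s. -1 < Re s}"])
       (use assms in \<open>auto intro!: holomorphic_intros simp: open_halfspace_Re_gt add_eq_0_iff2\<close>)
  moreover have "(\<lambda>s. (of_real y powr (s + 1) / (s + 1)) / (s - 0)) = kern y"
    by (simp add: kern_def fun_eq_iff field_simps)
  ultimately show "residue (kern y) 0 = of_real y" using assms by simp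
  have "residue (\<lambda>s. (of_real y powr (s + 1) / s) / (s - (-1))) (-1) = of_real y powr (- 1 + 1) / (-1)"
    by (rule residue_simple[of "{s. Re s < 0}"])
       (use assms in \<open>auto intro!: holomorphic_intros simp: open_halfspace_Re_lt\<close>)
  moreover have "(\<lambda>s. (of_real y powr (s + 1) / s) / (s - (-1))) = kern y"
    by (simp add: kern_def fun_eq_iff field_simps)
  ultimately show "residue (kern y) (-1) = -1" using assms by simp
qed

lemma kern_line_lim:
  assumes y: "0 < y" and ab: "\<And>n. n0 \<le> n \<Longrightarrow> real n \<le> \<bar>a n\<bar> \<and> real n \<le> \<bar>a n + 1\<bar> \<and> y powr (a n + 1) \<le> 1" and n0: "1 \<le> n0"
  shows "(\<lambda>n. LINT v|lborel. kern y (Complex (a n) v)) \<longlonglongrightarrow> 0"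
proof (rule tendsto_0_le[where K = "4 * J (3 / 2)" and f = "\<lambda>n. real n powr (- (1 / 2))"])
  show "(\<lambda>n. real n powr (- (1 / 2))) \<longlonglongrightarrow> 0"
    by (intro tendsto_neg_powr filterlim_real_sequentially) auto
  show "\<forall>\<^sub>F n in sequentially. norm (LINT v|lborel. kern y (Complex (a n) v)) \<le> norm (real n powr (- (1 / 2))) * (4 * J (3 / 2))"
    using eventually_ge_at_top[of n0]
  proof (rule eventually_mono)
    fix n assume n: "n0 \<le> n"
    have n1: "1 \<le> real n" using n n0 by simp
    note an = ab[OF n]
    have "norm (LINT v|lborel. kern y (Complex (a n) v)) \<le> (4 * real n powr (- (1 / 2))) * J (3 / 2)"
    proof (rule line_integral_bound(2))
      show "continuous_on UNIV (\<lambda>v. kern y (Complex (a n) v))"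
        by (rule continuous_on_vertical_line[OF kern_holomorphic[OF y]]) (use an n1 in \<open>auto simp: complex_eq_iff\<close>)
      fix v
      have "norm (kern y (Complex (a n) v)) \<le> y powr (a n + 1) * (4 * real n powr (- (1 / 2))) * brk v powr (- (3 / 2))"
        using an n1 by (intro kern_line_decay y) auto
      also have "\<dots> \<le> 1 * (4 * real n powr (- (1 / 2))) * brk v powr (- (3 / 2))"
        using an by (intro mult_right_mono) auto
      finally show "norm (kern y (Complex (a n) v)) \<le> (4 * real n powr (- (1 / 2))) * brk v powr (- (3 / 2))" by simp
    qed simp
    thus "norm (LINT v|lborel. kern y (Complex (a n) v)) \<le> norm (real n powr (- (1 / 2))) * (4 * J (3 / 2))"
      by (simp add: mult_ac)
  qed
qed

text \<open>For y \<le> 1 the power of y stays bounded to the right, so the line is pushed to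
  +\<infinity> without crossing a pole. For y > 1 it is pushed to -\<infinity> across 0 and -1,
  whose residues y and -1 add up to y - 1.\<close>

lemma kern_integral:
  assumes c: "0 < c" and y: "0 < y"
  shows "(LINT v|lborel. kern y (Complex c v)) = 2 * pi * of_real (max 0 (y - 1))"
    and "integrable lborel (\<lambda>v. kern y (Complex c v))"
proof -
  let ?I = "\<lambda>b. LINT v|lborel. kern y (Complex b v)"
  have right: "?I b - ?I c = 2 * pi * (\<Sum>p\<in>{}. residue (kern y) p)"
    "integrable lborel (\<lambda>v. kern y (Complex c v))" if "c < b" for b
    using that c y kern_strip_decay[OF y, of _ c b]
    by (intro contour_shift[where S = "{s. 0 < Re s}" and P = "{}" and T = 1 and \<kappa> = "3 / 2"
          and C = "(y powr (c + 1) + y powr (b + 1)) * 4"] holomorphic_on_subset[OF kern_holomorphic[OF y]],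
        auto simp: open_halfspace_Re_gt intro!: convex_connected convex_halfspace_Re_gt)+
  show "integrable lborel (\<lambda>v. kern y (Complex c v))" by (rule right(2)[of "c + 1"]) simp
  show "?I c = 2 * pi * of_real (max 0 (y - 1))"
  proof (cases "y \<le> 1")
    case True
    define n0 where "n0 = nat \<lceil>c\<rceil> + 1"
    have n0: "c < real n" if "n0 \<le> n" for n using that unfolding n0_def by linarith
    have A: "(\<lambda>n. ?I (real n)) \<longlonglongrightarrow> 0"
      by (rule kern_line_lim[OF y, of n0]) (use True y in \<open>auto simp: n0_def powr_le1\<close>)
    have B: "\<forall>\<^sub>F n in sequentially. ?I (real n) = ?I c"
      using eventually_ge_at_top[of n0] by (rule eventually_mono) (use right(1)[OF n0] in auto)
    have "?I c = 0"
      using tendsto_unique[OF sequentially_bot A tendsto_eventually[OF B]] by simp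
    thus ?thesis using True by simp
  next
    case False
    have left: "?I c - ?I b = 2 * pi * (\<Sum>p\<in>{0, -1}. residue (kern y) p)"
      if "b < - 1" for b
      using that c y kern_strip_decay[OF y, of _ b c]
      by (intro contour_shift[where S = UNIV and P = "{0, -1}" and T = 1 and \<kappa> = "3 / 2"
          and C = "(y powr (b + 1) + y powr (c + 1)) * 4"] holomorphic_on_subset[OF kern_holomorphic[OF y]]) auto
    have "(\<lambda>n. ?I (- real n - 1)) \<longlonglongrightarrow> 0"
      by (rule kern_line_lim[OF y, of 1]) (use False in \<open>auto simp: powr_minus field_simps ge_one_powr_ge_zero\<close>)
    hence A: "(\<lambda>n. ?I c - ?I (- real n - 1)) \<longlonglongrightarrow> ?I c - 0"
      by (intro tendsto_diff tendsto_const)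
    have B: "\<forall>\<^sub>F n in sequentially. ?I c - ?I (- real n - 1) = 2 * pi * (of_real y - 1)"
      using eventually_ge_at_top[of 1] by (rule eventually_mono) (subst left, auto simp: residue_kern[OF y])
    have "?I c - 0 = 2 * pi * (of_real y - 1)"
      by (rule tendsto_unique[OF sequentially_bot A tendsto_eventually[OF B]])
    thus ?thesis using False by simp
  qed
qed

text \<open>Interchange of sum and integral: the factors \<open>e n\<close> have a summable majorant
  uniform in v, and integrability is supplied by \<open>B\<close> alone. It serves for Perron's
  formula and again for the sum over l in the tail.\<close>

lemma integral_sums_line:
  fixes e :: "nat \<Rightarrow> real \<Rightarrow> complex" and B :: "real \<Rightarrow> complex"
  assumes e: "\<And>n. continuous_on UNIV (e n)" "\<And>n v. norm (e n v) \<le> w n" and w: "summable w"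
    and B: "integrable lborel B"
  shows "(\<lambda>n. LINT v|lborel. e n v * B v) sums (LINT v|lborel. (\<Sum>n. e n v) * B v)"
    and "integrable lborel (\<lambda>v. (\<Sum>n. e n v) * B v)"
proof -
  have meas: "e n \<in> borel_measurable lborel" for n
    using borel_measurable_continuous_onI[OF e(1)] by simp
  have w0: "0 \<le> w n" for n by (rule order_trans[OF norm_ge_zero e(2)[of n 0]])
  have int: "integrable lborel (\<lambda>v. e n v * B v)" for n
    by (rule Bochner_Integration.integrable_bound[of _ "\<lambda>v. w n *\<^sub>R norm (B v)"])
       (use B meas w0 in \<open>auto simp: norm_mult abs_mult intro!: borel_measurable_times AE_I2 mult_right_mono e(2)\<close>)
  have sn: "summable (\<lambda>n. norm (e n v))" for v
    by (rule summable_comparison_test'[OF w, of 0]) (simp add: e(2))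
  have AE: "AE v in lborel. summable (\<lambda>n. norm (e n v * B v))"
    by (intro AE_I2) (simp add: norm_mult summable_mult2[OF sn])
  have sI: "summable (\<lambda>n. LINT v|lborel. norm (e n v * B v))"
  proof (rule summable_comparison_test'[of _ 0])
    show "summable (\<lambda>n. w n * (LINT v|lborel. norm (B v)))" by (rule summable_mult2[OF w])
    fix n
    have "(LINT v|lborel. norm (e n v * B v)) \<le> (LINT v|lborel. w n * norm (B v))"
      by (rule integral_mono[OF integrable_norm[OF int] integrable_mult_right[OF integrable_norm[OF B]]])
         (simp add: norm_mult mult_right_mono e(2))
    thus "norm (LINT v|lborel. norm (e n v * B v)) \<le> w n * (LINT v|lborel. norm (B v))" by simp
  qed
  have eq: "(\<Sum>n. e n v * B v) = (\<Sum>n. e n v) * B v" for v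
    by (rule suminf_mult2[symmetric, OF summable_norm_cancel[OF sn]])
  show "(\<lambda>n. LINT v|lborel. e n v * B v) sums (LINT v|lborel. (\<Sum>n. e n v) * B v)"
    using sums_integral[OF int AE sI] by (simp only: eq)
  show "integrable lborel (\<lambda>v. (\<Sum>n. e n v) * B v)"
    using integrable_suminf[OF int AE sI] by (simp only: eq)
qed

theorem perron:
  fixes a :: "nat \<Rightarrow> complex"
  assumes c: "0 < c" and a: "ds_abs a c" and y: "0 < y"
  shows "(LINT v|lborel. ds a (Complex c v) * kern y (Complex c v)) =
     2 * pi * (\<Sum>n | 0 < n \<and> real n \<le> y. a n * of_real (y - real n))"
    and "integrable lborel (\<lambda>v. ds a (Complex c v) * kern y (Complex c v))"
proof -
  let ?S = "{n :: nat. 0 < n \<and> real n \<le> y}"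
  define e where "e n v = a n * of_nat n powr (- Complex c v)" for n v
  have e: "continuous_on UNIV (e n)" "norm (e n v) \<le> norm (a n) * real n powr (- c)" for n v
  proof -
    show "continuous_on UNIV (e n)"
    proof (cases "n = 0")
      case False
      thus ?thesis unfolding e_def by (intro continuous_intros) auto
    qed (simp add: e_def)
    show "norm (e n v) \<le> norm (a n) * real n powr (- c)" unfolding e_def norm_ds_term by simp
  qed
  note * = integral_sums_line[OF e a[unfolded ds_abs_def] kern_integral(2)[OF c y]]
  have eq: "(\<lambda>v. (\<Sum>n. e n v) * kern y (Complex c v)) = (\<lambda>v. ds a (Complex c v) * kern y (Complex c v))"
    by (simp add: e_def ds_def)
  show "integrable lborel (\<lambda>v. ds a (Complex c v) * kern y (Complex c v))"
    using * unfolding eq by blast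
  have "(\<lambda>n. LINT v|lborel. e n v * kern y (Complex c v)) sums (LINT v|lborel. ds a (Complex c v) * kern y (Complex c v))"
    using * unfolding eq by blast
  also have "(\<lambda>n. LINT v|lborel. e n v * kern y (Complex c v)) =
      (\<lambda>n. if n \<in> ?S then 2 * pi * (a n * of_real (y - real n)) else 0)"
  proof
    fix n
    show "(LINT v|lborel. e n v * kern y (Complex c v)) = (if n \<in> ?S then 2 * pi * (a n * of_real (y - real n)) else 0)"
    proof (cases "n = 0")
      case False
      \<comment> \<open>The identity n^(-s) y^(s+1) = n (y / n)^(s+1) reduces the n-th term to the
        kernel at y / n, and n (y / n - 1) = y - n is the weight.\<close>
      have "e n v * kern y (Complex c v) = (a n * of_nat n) * kern (y / real n) (Complex c v)" for v
      proof -
        define s where "s = Complex c v"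
        have "of_real y powr (s + 1) = of_real (y / real n) powr (s + 1) * of_real (real n) powr (s + 1)"
          using False y powr_times_real[of "of_real (y / real n)" "of_real (real n)" "s + 1"] by simp
        also have "of_real (real n) powr (s + 1) = of_nat n powr s * of_nat n"
          using False by (simp add: powr_add)
        finally have "of_nat n powr (- s) * of_real y powr (s + 1) = of_nat n * of_real (y / real n) powr (s + 1)"
          using False by (simp add: powr_minus field_simps)
        hence "a n * (of_nat n powr (- s) * of_real y powr (s + 1)) / (s * (s + 1)) =
               a n * (of_nat n * of_real (y / real n) powr (s + 1)) / (s * (s + 1))" by simp
        thus ?thesis unfolding e_def kern_def s_def[symmetric] by (simp add: mult_ac)
      qed
      hence "(LINT v|lborel. e n v * kern y (Complex c v)) = (a n * of_nat n) * (2 * pi * of_real (max 0 (y / real n - 1)))"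
        using False y by (simp add: kern_integral[OF c])
      also have "\<dots> = (if n \<in> ?S then 2 * pi * (a n * of_real (y - real n)) else 0)"
        using False by (auto simp: max_def field_simps)
      finally show ?thesis .
    qed (simp add: e_def)
  qed
  finally have "(LINT v|lborel. ds a (Complex c v) * kern y (Complex c v)) = (\<Sum>n\<in>?S. 2 * pi * (a n * of_real (y - real n)))"
    using sums_If_finite_set[of ?S "\<lambda>n. 2 * pi * (a n * of_real (y - real n))"] sums_unique2 by (simp del: mem_Collect_eq)
  thus "(LINT v|lborel. ds a (Complex c v) * kern y (Complex c v)) =
     2 * pi * (\<Sum>n | 0 < n \<and> real n \<le> y. a n * of_real (y - real n))"
    by (simp add: sum_distrib_left)
qed

section \<open>Tails of the Dirichlet series of the inverse square of zeta\<close>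

definition kdiff :: "real \<Rightarrow> complex \<Rightarrow> complex" where
  "kdiff y s = kern (y + 1) s - kern y s"

text \<open>The mean value bound saves a factor y but costs |s + 1|, which would spoil absolute
  convergence; the trivial bound does the opposite. Both are kept for interpolation.\<close>

lemma powr_diff_bound:
  assumes y: "1 \<le> y" and s: "-1 \<le> Re s" "Re s \<le> 2"
  shows "norm (of_real (y + 1) powr (s + 1) - of_real y powr (s + 1) :: complex) \<le> norm (s + 1) * (4 * y powr Re s)"
    and "norm (of_real (y + 1) powr (s + 1) - of_real y powr (s + 1) :: complex) \<le> 16 * y powr (Re s + 1)"
proof -
  let ?D = "of_real (y + 1) powr (s + 1) - of_real y powr (s + 1) :: complex"
  define S where "S = closed_segment (of_real y :: complex) (of_real (y + 1))"
  have S: "\<exists>u. z = of_real u \<and> y \<le> u \<and> u \<le> y + 1" if "z \<in> S" for z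
  proof -
    have "S = complex_of_real ` closed_segment y (y + 1)"
      unfolding S_def by (metis closed_segment_of_real)
    with that show ?thesis by (auto simp: closed_segment_eq_real_ivl)
  qed
  have up: "u powr r \<le> 2 powr e * y powr r" if "y \<le> u" "u \<le> y + 1" "r \<le> e" "0 \<le> e" for u r e
  proof (cases "0 \<le> r")
    case True
    have "u powr r \<le> (2 * y) powr r" using that y True by (intro powr_mono2) auto
    also have "\<dots> = 2 powr r * y powr r" using y by (simp add: powr_mult)
    also have "\<dots> \<le> 2 powr e * y powr r" using that by (intro mult_right_mono powr_mono) auto
    finally show ?thesis .
  next
    case False
    have "u powr r \<le> 1 * y powr r" using that y False by (simp add: powr_mono2')
    also have "\<dots> \<le> 2 powr e * y powr r" using that by (intro mult_right_mono ge_one_powr_ge_zero) auto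
    finally show ?thesis .
  qed
  have "norm (?D) \<le>
      (norm (s + 1) * (4 * y powr Re s)) * norm (of_real (y + 1) - of_real y :: complex)"
  proof (rule field_differentiable_bound[where S = S])
    show "convex S" by (simp add: S_def)
    show "of_real (y + 1) \<in> S" "of_real y \<in> S" by (simp_all add: S_def)
  next
    fix z assume "z \<in> S"
    then obtain u where u: "z = of_real u" "y \<le> u" "u \<le> y + 1" using S by blast
    hence "z \<notin> \<real>\<^sub>\<le>\<^sub>0" using y by (auto simp: complex_nonpos_Reals_iff)
    thus "((\<lambda>z. z powr (s + 1)) has_field_derivative (s + 1) * z powr s) (at z within S)"
      using has_field_derivative_powr[of z "s + 1"] by (simp add: has_field_derivative_at_within)
    have "u powr Re s \<le> 2 powr 2 * y powr Re s" using u s by (intro up) auto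
    thus "norm ((s + 1) * z powr s) \<le> norm (s + 1) * (4 * y powr Re s)"
      unfolding norm_mult using u y by (intro mult_left_mono) (auto simp: norm_of_real_powr)
  qed
  thus "norm (?D) \<le> norm (s + 1) * (4 * y powr Re s)"
    by simp
  have "norm (?D) \<le>
     (y + 1) powr (Re s + 1) + y powr (Re s + 1)"
    using norm_triangle_ineq4[of "of_real (y + 1) powr (s + 1)" "of_real y powr (s + 1)"]
      norm_of_real_powr[of "y + 1" "s + 1"] norm_of_real_powr[of y "s + 1"] y by simp
  also have "(y + 1) powr (Re s + 1) \<le> 2 powr 3 * y powr (Re s + 1)" using s by (intro up) auto
  also have "2 powr 3 * y powr (Re s + 1) + y powr (Re s + 1) \<le> 16 * y powr (Re s + 1)" by simp
  finally show "norm (?D) \<le> 16 * y powr (Re s + 1)" by simp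
qed

text \<open>Interpolation between the derivative bound and the trivial bound; this makes the integrals
  of the difference kernel absolutely convergent at the cost of a factor \<open>y powr \<theta>\<close>.\<close>

lemma kdiff_bound:
  assumes y: "1 \<le> y" and a: "-1 \<le> a" "a \<le> 2" "1 / 4 \<le> \<bar>a\<bar>" "1 / 4 \<le> \<bar>a + 1\<bar>" and \<theta>: "0 \<le> \<theta>" "\<theta> \<le> 1"
  shows "norm (kdiff y (Complex a v)) \<le> 1024 * y powr (a + \<theta>) * brk v powr (- (1 + \<theta>))"
proof -
  define s where "s = Complex a v"
  define A where "A = norm (of_real (y + 1) powr (s + 1) - of_real y powr (s + 1) :: complex)"
  define q where "q = brk v / 8"
  have s1: "s + 1 = Complex (a + 1) v" by (simp add: s_def complex_eq_iff)
  have q: "0 < q" "q \<le> norm s" "q \<le> norm (s + 1)"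
    using norm_Complex_ge[of "1 / 4" a v] norm_Complex_ge[of "1 / 4" "a + 1" v] a
    unfolding s1 by (auto simp: q_def s_def)
  have n0: "0 < norm s" "0 < norm (s + 1)" using q by linarith+
  have A: "A \<le> norm (s + 1) * (4 * y powr a)" "A \<le> 16 * y powr (a + 1)" "0 \<le> A"
    using powr_diff_bound[OF y, of s] a by (auto simp: A_def s_def)
  \<comment> \<open>The derivative bound is used with weight 1 - \<theta> and the trivial one with
    weight \<theta>; this leaves decay 1 + \<theta> in the ordinate.\<close>
  have "A = A powr (1 - \<theta>) * A powr \<theta>" using A(3) by (cases "A = 0") (auto simp flip: powr_add)
  also have "\<dots> \<le> (norm (s + 1) * (4 * y powr a)) powr (1 - \<theta>) * (16 * y powr (a + 1)) powr \<theta>"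
    using A \<theta> by (intro mult_mono powr_mono2) auto
  also have "\<dots> \<le> (norm (s + 1) * (16 * y powr a)) powr (1 - \<theta>) * (16 * y powr (a + 1)) powr \<theta>"
    using \<theta> by (intro mult_right_mono powr_mono2 mult_left_mono) auto
  also have "\<dots> = norm (s + 1) powr (1 - \<theta>) * (16 powr (1 - \<theta>) * 16 powr \<theta>) *
      (y powr (a * (1 - \<theta>)) * y powr ((a + 1) * \<theta>))"
    by (simp add: powr_mult powr_powr mult_ac)
  also have "\<dots> = norm (s + 1) powr (1 - \<theta>) * 16 * y powr (a + \<theta>)"
    by (simp add: algebra_simps flip: powr_add)
  finally have A': "A \<le> norm (s + 1) powr (1 - \<theta>) * 16 * y powr (a + \<theta>)" .
  have "norm (kdiff y s) = A / (norm s * norm (s + 1))"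
    by (simp add: kdiff_def kern_def A_def norm_divide norm_mult flip: diff_divide_distrib)
  also have "\<dots> \<le> norm (s + 1) powr (1 - \<theta>) * 16 * y powr (a + \<theta>) / (norm s * norm (s + 1))"
    using A' n0 by (intro divide_right_mono) auto
  also have "\<dots> = 16 * y powr (a + \<theta>) * (1 / norm s) * norm (s + 1) powr (- \<theta>)"
    using n0 by (simp add: powr_diff powr_minus field_simps)
  also have "\<dots> \<le> 16 * y powr (a + \<theta>) * (1 / q) * q powr (- \<theta>)"
  proof -
    have "1 / norm s \<le> 1 / q" using q n0 by (intro divide_left_mono mult_pos_pos) auto
    moreover have "norm (s + 1) powr (- \<theta>) \<le> q powr (- \<theta>)" using q \<theta> by (intro powr_mono2') auto
    ultimately show ?thesis using q by (intro mult_mono mult_left_mono) auto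
  qed
  also have "\<dots> \<le> 16 * y powr (a + \<theta>) * (1 / q) * (8 * brk v powr (- \<theta>))"
  proof (intro mult_left_mono)
    have "8 powr \<theta> \<le> 8 powr (1 :: real)" using \<theta> by (intro powr_mono) auto
    hence "8 powr \<theta> * brk v powr (- \<theta>) \<le> 8 * brk v powr (- \<theta>)" by (intro mult_right_mono) auto
    thus "q powr (- \<theta>) \<le> 8 * brk v powr (- \<theta>)"
      by (simp add: q_def powr_divide powr_minus field_simps)
  qed (use q in auto)
  also have "16 * y powr (a + \<theta>) * (1 / q) * (8 * brk v powr (- \<theta>)) =
      1024 * y powr (a + \<theta>) * (brk v powr (- 1) * brk v powr (- \<theta>))"
    by (simp add: q_def powr_minus field_simps)
  also have "brk v powr (- 1) * brk v powr (- \<theta>) = brk v powr (- (1 + \<theta>))"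
    by (subst powr_add[symmetric]) (rule arg_cong[where f = "\<lambda>e. brk v powr e"], simp)
  finally show ?thesis by (simp only: s_def)
qed

text \<open>Here the constant depends on \<open>y\<close>; it only licenses a shift of the
  contour.\<close>

lemma kdiff_strip_decay:
  assumes "0 < y" "a < b"
  obtains C where "0 \<le> C" "\<And>s. \<lbrakk>1 \<le> \<bar>Im s\<bar>; a \<le> Re s; Re s \<le> b\<rbrakk> \<Longrightarrow>
     norm (kdiff y s) \<le> C * brk (Im s) powr (- (3 / 2))"
proof
  define c where "c y = (y powr (a + 1) + y powr (b + 1)) * 4" for y :: real
  show "0 \<le> c (y + 1) + c y" by (simp add: c_def)
  fix s assume s: "1 \<le> \<bar>Im s\<bar>" "a \<le> Re s" "Re s \<le> b"
  have "norm (kdiff y s) \<le> norm (kern (y + 1) s) + norm (kern y s)"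
    unfolding kdiff_def by (rule norm_triangle_ineq4)
  also have "\<dots> \<le> c (y + 1) * brk (Im s) powr (- (3 / 2)) + c y * brk (Im s) powr (- (3 / 2))"
    unfolding c_def using s assms by (intro add_mono kern_strip_decay) auto
  finally show "norm (kdiff y s) \<le> (c (y + 1) + c y) * brk (Im s) powr (- (3 / 2))"
    by (simp add: algebra_simps)
qed

lemma one_plus_abs_add_powr:
  assumes "0 \<le> e"
  shows "brk (t + u) powr e \<le> brk t powr e * brk u powr (e :: real)"
proof -
  have "1 + \<bar>t + u\<bar> \<le> brk t * brk u"
  proof -
    have "0 \<le> \<bar>t\<bar> * \<bar>u\<bar>" by simp
    hence "1 + \<bar>t + u\<bar> \<le> 1 + \<bar>t\<bar> + \<bar>u\<bar> + \<bar>t\<bar> * \<bar>u\<bar>" using abs_triangle_ineq[of t u] by linarith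
    thus ?thesis by (simp add: algebra_simps)
  qed
  hence "brk (t + u) powr e \<le> (brk t * brk u) powr e" using assms by (intro powr_mono2) auto
  thus ?thesis by (simp add: powr_mult)
qed

section \<open>Removing the smoothing weights; tails of the series for 1 / zeta^2\<close>

lemma nat_between_Suc:
  fixes Y :: real
  assumes "0 \<le> Y"
  shows "{l :: nat. 0 < l \<and> real l \<le> Y + 1} = insert (nat \<lfloor>Y\<rfloor> + 1) {l. 0 < l \<and> real l \<le> Y}"
    and "nat \<lfloor>Y\<rfloor> + 1 \<notin> {l. 0 < l \<and> real l \<le> Y}" "Y < real (nat \<lfloor>Y\<rfloor> + 1)" "real (nat \<lfloor>Y\<rfloor> + 1) \<le> Y + 1"
  using assms by (auto; linarith)+

text \<open>The weights of each l \<le> Y differ by exactly 1, so the sharp sum appears; the one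
  integer in (Y, Y + 1] contributes the extra term.\<close>

lemma sum_smoothing:
  fixes f :: "nat \<Rightarrow> complex"
  assumes "0 \<le> Y"
  shows "(\<Sum>l | 0 < l \<and> real l \<le> Y + 1. f l * of_real (Y + 1 - real l)) - (\<Sum>l | 0 < l \<and> real l \<le> Y. f l * of_real (Y - real l)) =
    (\<Sum>l | 0 < l \<and> real l \<le> Y. f l) + f (nat \<lfloor>Y\<rfloor> + 1) * of_real (Y + 1 - real (nat \<lfloor>Y\<rfloor> + 1))"
proof -
  have "(\<Sum>l | 0 < l \<and> real l \<le> Y. f l * of_real (Y + 1 - real l)) - (\<Sum>l | 0 < l \<and> real l \<le> Y. f l * of_real (Y - real l)) =
    (\<Sum>l | 0 < l \<and> real l \<le> Y. f l)"
    unfolding sum_subtractf[symmetric] by (intro sum.cong) (auto simp: algebra_simps)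
  thus ?thesis unfolding nat_between_Suc(1)[OF assms]
    using nat_between_Suc(2)[OF assms] by (subst sum.insert) auto
qed

text \<open>The sum of the terms with l > Y on the line Re w = 1 + 2 \<eta>, written as the full
  value minus a finite sum. The abscissa is twice 1/2 + \<eta>, as w = 2 s later on.\<close>

definition tail :: "real \<Rightarrow> real \<Rightarrow> real \<Rightarrow> complex" where
  "tail \<eta> Y t = 1 / zeta (Complex (1 + 2 * \<eta>) t) ^ 2 -
      (\<Sum>l | 0 < l \<and> real l \<le> Y. of_int (mu2 l) * of_nat l powr (- Complex (1 + 2 * \<eta>) t))"

text \<open>Perron's formula for the coefficients \<open>mu2 l\<close> times l^(-w) gives the
  partial sum; the residue at z = 0 is the full value 1 / zeta(w)^2, so the shifted integral is the
  tail up to one term. The factor zeta^(-2) takes \<theta> / 2 of the decay 1 + \<theta>, and 1 +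
  \<theta> / 2 is still integrable.\<close>

lemma zeta_inverse_square_tail:
  assumes RH: "riemann_hypothesis" and \<eta>: "0 < \<eta>" "\<eta> \<le> 1 / 8" and \<theta>: "0 < \<theta>" "\<theta> < 1"
  obtains C where "0 < C" "\<And>Y t. 1 \<le> Y \<Longrightarrow>
    norm (tail \<eta> Y t)
    \<le> C * Y powr (- (1 / 2) + \<theta>) * brk t powr \<theta>"
proof -
  obtain C1 where C1: "0 < C1" "\<And>s. \<lbrakk>1 / 2 + \<eta> \<le> Re s; Re s \<le> 4\<rbrakk> \<Longrightarrow> norm (1 / zeta s) \<le> C1 * brk (Im s) powr (\<theta> / 4)"
    using RH_zeta_bounds[OF RH \<eta>(1), of "\<theta> / 4" "{}"] \<theta> by auto
  obtain C2 where C2: "0 < C2" "\<And>n. 0 < n \<Longrightarrow> real (divisor_count n) \<le> C2 * real n powr \<theta>"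
    using divisor_count_bound[OF \<theta>(1)] by blast
  \<comment> \<open>Then Re (w + z) = 1/2 + \<eta>. As \<eta> \<le> 1/8, the line stays to the right
    of the pole at -1, at the distance that \<open>kdiff_bound\<close> asks for.\<close>
  define a where "a = - (1 / 2) - \<eta>"
  define K where "K = C1 ^ 2 * 1024 * J (1 + \<theta> / 2)"
  have K0: "0 \<le> K" using J_nonneg by (simp add: K_def)
  define F where "F s = 1 / zeta s ^ 2" for s
  have F_holo: "F holomorphic_on {s. 1 / 2 < Re s}"
  proof -
    have "(\<lambda>s. (1 / zeta s) ^ 2) holomorphic_on {s. 1 / 2 < Re s}"
      by (intro holomorphic_on_power RH_inverse_zeta_holomorphic RH)
    thus ?thesis by (simp add: F_def[abs_def] power_divide)
  qed
  show thesis
  proof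
    show "0 < C2 + K" using C2 K0 by simp
    fix Y t :: real assume Y: "1 \<le> Y"
    define w where "w = Complex (1 + 2 * \<eta>) t"
    have Rew: "Re w = 1 + 2 * \<eta>" "Im w = t" by (simp_all add: w_def)
    have FB: "norm (F (w + z)) \<le> C1 ^ 2 * brk t powr (\<theta> / 2) * brk (Im z) powr (\<theta> / 2)"
      if z: "a \<le> Re z" "Re z \<le> 1" for z
    proof -
      have "norm (F (w + z)) = norm (1 / zeta (w + z)) ^ 2" by (simp add: F_def norm_divide norm_power power_divide)
      also have "\<dots> \<le> (C1 * brk (t + Im z) powr (\<theta> / 4)) ^ 2"
        using C1(2)[of "w + z"] z \<eta> by (intro power_mono) (auto simp: Rew a_def)
      also have "\<dots> = C1 ^ 2 * brk (t + Im z) powr (\<theta> / 2)"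
        by (simp add: power_mult_distrib power2_eq_square flip: powr_add)
      also have "\<dots> \<le> C1 ^ 2 * (brk t powr (\<theta> / 2) * brk (Im z) powr (\<theta> / 2))"
        using \<theta> by (intro mult_left_mono one_plus_abs_add_powr) auto
      finally show ?thesis by (simp add: mult_ac)
    qed
    define f where "f l = of_int (mu2 l) * of_nat l powr (- w)" for l
    have f_abs: "ds_abs f 1"
    proof -
      have "norm (f l) * real l powr (- 1) = norm (of_int (mu2 l) :: complex) * real l powr (- (2 + 2 * \<eta>))" for l
      proof -
        have "real l powr (- (1 + 2 * \<eta>)) * real l powr (- 1) = real l powr (- (2 + 2 * \<eta>))"
          by (subst powr_add[symmetric]) (rule arg_cong[where f = "\<lambda>e. real l powr e"], simp)
        thus ?thesis unfolding f_def norm_mult norm_of_nat_powr by (simp only: Rew mult.assoc uminus_complex.sel)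
      qed
      thus ?thesis using ds_abs_mu2[of "2 + 2 * \<eta>"] \<eta> unfolding ds_abs_def by simp
    qed
    have ds_f: "ds f z = F (w + z)" if "0 < Re z" for z
    proof -
      have "ds f z = ds (\<lambda>l. of_int (mu2 l)) (w + z)"
        unfolding ds_def f_def by (intro suminf_cong) (simp add: powr_add[symmetric] mult.assoc)
      thus ?thesis using ds_mu2[of "w + z"] that \<eta> by (simp add: F_def Rew)
    qed
    define G where "G z = F (w + z) * kdiff Y z" for z
    have Gint: "(LINT v|lborel. G (Complex 1 v)) = 2 * pi * ((\<Sum>l | 0 < l \<and> real l \<le> Y + 1. f l * of_real (Y + 1 - real l))
        - (\<Sum>l | 0 < l \<and> real l \<le> Y. f l * of_real (Y - real l)))"
    proof -
      have G: "G (Complex 1 v) = ds f (Complex 1 v) * kern (Y + 1) (Complex 1 v) - ds f (Complex 1 v) * kern Y (Complex 1 v)" for v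
        by (simp add: G_def kdiff_def ds_f algebra_simps)
      show ?thesis unfolding G
        using Y by (subst Bochner_Integration.integral_diff) (auto simp: perron f_abs algebra_simps)
    qed
    define S where "S = {z. - (1 / 2) - 2 * \<eta> < Re z}"
    have F_holo': "(\<lambda>z. F (w + z)) holomorphic_on S"
    proof -
      have "F \<circ> (\<lambda>z. w + z) holomorphic_on S"
        by (intro holomorphic_on_compose_gen[OF _ F_holo] holomorphic_intros) (auto simp: S_def Rew)
      thus ?thesis by (simp add: o_def)
    qed
    have k_holo: "kdiff Y holomorphic_on UNIV - {0, -1}"
      unfolding kdiff_def[abs_def] using Y by (intro holomorphic_intros kern_holomorphic) auto
    have k_holo': "kdiff Y holomorphic_on S - {0}"
      by (rule holomorphic_on_subset[OF k_holo]) (use \<eta> in \<open>auto simp: S_def\<close>)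
    obtain Ck where Ck: "0 \<le> Ck" "\<And>s. \<lbrakk>1 \<le> \<bar>Im s\<bar>; a \<le> Re s; Re s \<le> 1\<rbrakk> \<Longrightarrow>
       norm (kdiff Y s) \<le> Ck * brk (Im s) powr (- (3 / 2))"
      using kdiff_strip_decay[of Y a 1] Y \<eta> by (auto simp: a_def)
    have "(LINT v|lborel. G (Complex 1 v)) - (LINT v|lborel. G (Complex a v)) = 2 * pi * (\<Sum>p\<in>{0}. residue G p)"
    proof (rule contour_shift(1))
      show "a < 1" using \<eta> by (simp add: a_def)
      show "open S" unfolding S_def by (rule open_halfspace_Re_gt)
      show "connected S" unfolding S_def by (intro convex_connected convex_halfspace_Re_gt)
      show "{s. a \<le> Re s \<and> Re s \<le> 1} \<subseteq> S" using \<eta> by (auto simp: S_def a_def)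
      show "G holomorphic_on S - {0}" unfolding G_def[abs_def]
        by (intro holomorphic_on_mult k_holo' holomorphic_on_subset[OF F_holo']) auto
      show "1 < 3 / 2 - \<theta> / 2" using \<theta> by simp
      fix z assume z: "a \<le> Re z" "Re z \<le> 1" "1 \<le> \<bar>Im z\<bar>"
      have "norm (G z) \<le> (C1 ^ 2 * brk t powr (\<theta> / 2) * brk (Im z) powr (\<theta> / 2)) * (Ck * brk (Im z) powr (- (3 / 2)))"
        unfolding G_def norm_mult using z by (intro mult_mono FB Ck) auto
      also have "\<dots> = (C1 ^ 2 * brk t powr (\<theta> / 2) * Ck) * (brk (Im z) powr (\<theta> / 2) * brk (Im z) powr (- (3 / 2)))"
        by (simp add: mult_ac)
      also have "brk (Im z) powr (\<theta> / 2) * brk (Im z) powr (- (3 / 2)) = brk (Im z) powr (- (3 / 2 - \<theta> / 2))"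
        by (simp flip: powr_add)
      finally show "norm (G z) \<le> (C1 ^ 2 * brk t powr (\<theta> / 2) * Ck) * brk (Im z) powr (- (3 / 2 - \<theta> / 2))" .
    qed (use \<eta> in \<open>auto simp: a_def\<close>)
    also have "(\<Sum>p\<in>{0}. residue G p) = residue G 0" by simp
    also have "residue G 0 = F w"
    proof -
      \<comment> \<open>At z = 0 the difference of powers is (Y + 1) - Y = 1, so the residue is F(w)
        itself.\<close>
      define g where "g z = F (w + z) * ((of_real (Y + 1) powr (z + 1) - of_real Y powr (z + 1)) / (z + 1))" for z
      have "residue (\<lambda>z. g z / (z - 0)) 0 = g 0"
      proof (rule residue_simple[of S])
        show "open S" unfolding S_def by (rule open_halfspace_Re_gt)
        show "0 \<in> S" using \<eta> by (simp add: S_def)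
        show "g holomorphic_on S" unfolding g_def
          using Y \<eta> by (intro holomorphic_intros F_holo') (auto simp: S_def add_eq_0_iff2)
      qed
      moreover have "(\<lambda>z. g z / (z - 0)) = G"
        by (simp add: g_def G_def kdiff_def kern_def fun_eq_iff field_simps diff_divide_distrib)
      moreover have "g 0 = F w" using Y by (simp add: g_def)
      ultimately show ?thesis by simp
    qed
    finally have shift: "(LINT v|lborel. G (Complex 1 v)) - (LINT v|lborel. G (Complex a v)) = 2 * pi * F w" by simp
    have small: "norm (LINT v|lborel. G (Complex a v)) \<le> (C1 ^ 2 * brk t powr (\<theta> / 2) * 1024 * Y powr (a + \<theta>)) * J (1 + \<theta> / 2)"
    proof (rule line_integral_bound(2))
      show "continuous_on UNIV (\<lambda>v. G (Complex a v))"
      proof (rule continuous_on_vertical_line[of G "S - {0}"])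
        show "G holomorphic_on S - {0}" unfolding G_def[abs_def]
          by (intro holomorphic_on_mult k_holo' holomorphic_on_subset[OF F_holo']) auto
      qed (use \<eta> in \<open>auto simp: S_def a_def complex_eq_iff\<close>)
      fix v
      have "norm (G (Complex a v)) \<le> (C1 ^ 2 * brk t powr (\<theta> / 2) * brk v powr (\<theta> / 2)) * (1024 * Y powr (a + \<theta>) * brk v powr (- (1 + \<theta>)))"
        unfolding G_def norm_mult using FB[of "Complex a v"] kdiff_bound[OF Y, of a \<theta> v] \<eta> \<theta>
        by (intro mult_mono) (auto simp: a_def)
      also have "\<dots> = (C1 ^ 2 * brk t powr (\<theta> / 2) * 1024 * Y powr (a + \<theta>)) * (brk v powr (\<theta> / 2) * brk v powr (- (1 + \<theta>)))"
        by (simp add: mult_ac)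
      also have "brk v powr (\<theta> / 2) * brk v powr (- (1 + \<theta>)) = brk v powr (- (1 + \<theta> / 2))"
        by (subst powr_add[symmetric]) (rule arg_cong[where f = "\<lambda>e. brk v powr e"], simp)
      finally show "norm (G (Complex a v)) \<le> (C1 ^ 2 * brk t powr (\<theta> / 2) * 1024 * Y powr (a + \<theta>)) * brk v powr (- (1 + \<theta> / 2))" .
    qed (use \<theta> in simp)
    define l0 where "l0 = nat \<lfloor>Y\<rfloor> + 1"
    define r where "r = f l0 * of_real (Y + 1 - real l0)"
    have l0: "Y < real l0" "real l0 \<le> Y + 1" using nat_between_Suc(3,4)[of Y] Y by (auto simp: l0_def)
    have "norm r \<le> norm (f l0) * 1"
      unfolding r_def norm_mult norm_of_real using l0 by (intro mult_left_mono) auto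
    also have "norm (f l0) = \<bar>real_of_int (mu2 l0)\<bar> * real l0 powr (- (1 + 2 * \<eta>))"
      unfolding f_def norm_mult norm_of_nat_powr by (simp add: Rew)
    also have "\<dots> \<le> (C2 * real l0 powr \<theta>) * real l0 powr (- (1 + 2 * \<eta>))"
      using C2(2)[of l0] abs_mu2_le[of l0] by (intro mult_right_mono) (auto simp: l0_def)
    also have "\<dots> = C2 * real l0 powr (\<theta> - 1 - 2 * \<eta>)" by (simp add: mult.assoc algebra_simps flip: powr_add)
    also have "\<dots> \<le> C2 * Y powr (\<theta> - 1 - 2 * \<eta>)"
      using l0 C2 Y \<eta> \<theta> by (intro mult_left_mono powr_mono2') auto
    also have "\<dots> \<le> C2 * Y powr (- (1 / 2) + \<theta>)"
      using C2 Y \<eta> by (intro mult_left_mono powr_mono) auto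
    finally have r: "norm r \<le> C2 * Y powr (- (1 / 2) + \<theta>)" by simp
    define P where "P = (\<Sum>l | 0 < l \<and> real l \<le> Y. f l)"
    define I where "I = (LINT v|lborel. G (Complex a v))"
    have "2 * pi * (P + r) - I = 2 * pi * F w"
      using shift sum_smoothing[of Y f] Y unfolding Gint P_def r_def I_def l0_def by simp
    hence "F w - P = r - I / (2 * pi)" by (simp add: field_simps)
    hence "norm (F w - P) \<le> norm r + norm I / (2 * pi)"
      using norm_triangle_ineq4[of r "I / (2 * pi)"] by (simp add: norm_divide norm_mult)
    also have "norm I / (2 * pi) \<le> norm I / 1" using pi_ge_two by (intro divide_left_mono) auto
    also have "norm r + norm I / 1 \<le> C2 * Y powr (- (1 / 2) + \<theta>) * brk t powr \<theta> + K * Y powr (- (1 / 2) + \<theta>) * brk t powr \<theta>"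
    proof (rule add_mono)
      have "C2 * Y powr (- (1 / 2) + \<theta>) * 1 \<le> C2 * Y powr (- (1 / 2) + \<theta>) * brk t powr \<theta>"
        using C2 \<theta> by (intro mult_left_mono ge_one_powr_ge_zero) auto
      with r show "norm r \<le> C2 * Y powr (- (1 / 2) + \<theta>) * brk t powr \<theta>" by simp
      have "norm I \<le> K * (Y powr (a + \<theta>) * brk t powr (\<theta> / 2))"
        using small by (simp add: I_def K_def mult_ac)
      also have "\<dots> \<le> K * (Y powr (- (1 / 2) + \<theta>) * brk t powr \<theta>)"
        using K0 Y \<eta> \<theta> by (intro mult_left_mono mult_mono powr_mono) (auto simp: a_def)
      finally show "norm I / 1 \<le> K * Y powr (- (1 / 2) + \<theta>) * brk t powr \<theta>" by (simp add: mult_ac)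
    qed
    finally show "norm (tail \<eta> Y t)
      \<le> (C2 + K) * Y powr (- (1 / 2) + \<theta>) * brk t powr \<theta>"
      by (simp add: tail_def F_def P_def f_def w_def algebra_simps)
  qed
qed

section \<open>The integrated error term of the divisor problem\<close>

definition dmain :: "real \<Rightarrow> real" where
  "dmain y = y * (ln y + 2 * euler_mascheroni - 1)"

text \<open>The antiderivative of \<open>dmain\<close> that tends to 0 at 0. Likewise
  \<open>dsum1\<close> is the integral of the divisor sum, so \<open>derr1\<close> is the integral
  of \<Delta>.\<close>

definition dmain1 :: "real \<Rightarrow> real" where
  "dmain1 y = y ^ 2 / 2 * (ln y + 2 * euler_mascheroni - 3 / 2)"

definition dsum1 :: "real \<Rightarrow> real" where
  "dsum1 y = (\<Sum>n | 0 < n \<and> real n \<le> y. real (divisor_count n) * (y - real n))"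

definition derr1 :: "real \<Rightarrow> real" where
  "derr1 y = dsum1 y - dmain1 y"

lemma divisor_error_eq: "divisor_error y = real (divisor_sum y) - dmain y"
  by (simp add: divisor_error_def divisor_sum_def dmain_def)

text \<open>zeta^2 has a double pole, so the residue is the derivative of Hz^2 times the kernel at
  1. Here Hz(1) = 1 and Hz'(1) = \<gamma>, and the factor 1 / (s (s + 1)) accounts for the constant
  -3/2.\<close>

lemma residue_zeta_sq_kern:
  assumes y: "0 < y"
  shows "residue (\<lambda>s. zeta s ^ 2 * kern y s) 1 = of_real (dmain1 y)"
proof -
  define A where "A = {s. 0 < Re s}"
  have A: "open A" "1 \<in> A" unfolding A_def by (rule open_halfspace_Re_gt, simp)
  define h where "h s = Hz s ^ 2 * kern y s" for s
  have h: "h holomorphic_on A" unfolding h_def[abs_def] A_def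
    by (intro holomorphic_intros Hz_holomorphic holomorphic_on_subset[OF kern_holomorphic[OF y]]) auto
  have "residue (\<lambda>s. zeta s ^ 2 * kern y s) 1 = residue (\<lambda>s. h s / (s - 1) ^ Suc 1) 1"
  proof (rule residue_cong)
    have "\<forall>\<^sub>F s in at 1. s \<in> A" using A by (intro eventually_at_in_open') auto
    thus "\<forall>\<^sub>F s in at 1. zeta s ^ 2 * kern y s = h s / (s - 1) ^ Suc 1"
      by (rule eventually_mono) (simp add: A_def h_def zeta_eq_Hz power_divide power2_eq_square)
  qed simp
  also have "\<dots> = deriv h 1" using residue_holomorphic_over_power[OF A h, of 1] by simp
  also have "deriv h 1 = of_real (dmain1 y)"
  proof (rule DERIV_imp_deriv)
    define k where "k s = exp ((s + 1) * of_real (ln y))" for s :: complex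
    have k: "of_real y powr (s + 1) = k s" for s
      using y by (simp add: powr_def k_def Ln_of_real)
    have k1: "k 1 = of_real (y ^ 2)"
    proof -
      have "k 1 = exp (of_real (2 * ln y))" by (simp add: k_def)
      also have "\<dots> = of_real (exp (2 * ln y))" by (rule exp_of_real)
      also have "exp (2 * ln y) = y ^ 2" using y by (simp add: exp_double)
      finally show ?thesis .
    qed
    have dk: "(k has_field_derivative k 1 * of_real (ln y)) (at 1)"
      unfolding k_def by (auto intro!: derivative_eq_intros)
    have "((\<lambda>s. Hz s ^ 2 * (k s / (s * (s + 1)))) has_field_derivative
       (2 * euler_mascheroni * (k 1 / 2) + ((k 1 * of_real (ln y)) * 2 - k 1 * 3) / 4)) (at 1)"
      by (rule derivative_eq_intros Hz_deriv_1 dk refl | simp add: Hz_1 field_simps)+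
    moreover have "(\<lambda>s. Hz s ^ 2 * (k s / (s * (s + 1)))) = h"
      by (simp add: h_def kern_def k fun_eq_iff)
    moreover have "2 * euler_mascheroni * (k 1 / 2) + ((k 1 * of_real (ln y)) * 2 - k 1 * 3) / 4 = complex_of_real (dmain1 y)"
      unfolding k1 by (simp add: dmain1_def field_simps)
    ultimately show "(h has_field_derivative of_real (dmain1 y)) (at 1)" by simp
  qed
  finally show ?thesis .
qed

abbreviation zk :: "real \<Rightarrow> real \<Rightarrow> real \<Rightarrow> complex" where
  "zk \<eta> y v \<equiv> zeta (Complex (1 / 2 + \<eta>) v) ^ 2 * kern y (Complex (1 / 2 + \<eta>) v)"

text \<open>On Re s = 2 Perron's formula gives \<open>dsum1\<close>; moving to Re s = 1/2 + \<eta>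
  crosses only the double pole at 1, whose residue is the main term. What remains is the error
  term.\<close>

lemma derr1_integral:
  assumes RH: "riemann_hypothesis" and \<eta>: "0 < \<eta>" "\<eta> < 1 / 2" and y: "0 < y"
  shows "(LINT v|lborel. zk \<eta> y v) = 2 * pi * of_real (derr1 y)"
    and "integrable lborel (\<lambda>v. zk \<eta> y v)"
proof -
  define G where "G s = zeta s ^ 2 * kern y s" for s
  define S :: "complex set" where "S = {s. 0 < Re s}"
  have closed: "closed {s. 1 \<le> \<bar>Im s\<bar>}" by (intro closed_Collect_le continuous_intros)
  obtain C where C: "0 < C" "\<And>s. \<lbrakk>1 / 2 + \<eta> \<le> Re s; Re s \<le> 4; s \<in> {s. 1 \<le> \<bar>Im s\<bar>}\<rbrakk> \<Longrightarrow> norm (zeta s) \<le> C * brk (Im s) powr (1 / 8)"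
    by (rule RH_zeta_bounds[OF RH \<eta>(1) _ closed, of "1 / 8"]) (simp, simp, blast)
  define K where "K = (y powr (1 / 2 + \<eta> + 1) + y powr (2 + 1)) * 4"
  have S: "open S" "connected S" "{s. 1 / 2 + \<eta> \<le> Re s \<and> Re s \<le> 2} \<subseteq> S"
  proof -
    show "open S" unfolding S_def by (rule open_halfspace_Re_gt)
    show "connected S" unfolding S_def by (intro convex_connected convex_halfspace_Re_gt)
    show "{s. 1 / 2 + \<eta> \<le> Re s \<and> Re s \<le> 2} \<subseteq> S"
    proof
      fix s assume "s \<in> {s. 1 / 2 + \<eta> \<le> Re s \<and> Re s \<le> 2}"
      hence "1 / 2 + \<eta> \<le> Re s" by simp
      hence "0 < Re s" using \<eta> by linarith
      thus "s \<in> S" by (simp add: S_def)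
    qed
  qed
  have holo: "G holomorphic_on S - {1}" unfolding G_def[abs_def]
    by (intro holomorphic_intros holomorphic_on_subset[OF zeta_holomorphic] holomorphic_on_subset[OF kern_holomorphic[OF y]]) (auto simp: S_def)
  have bound: "norm (G s) \<le> (C ^ 2 * K) * brk (Im s) powr (- (5 / 4))"
    if s: "1 / 2 + \<eta> \<le> Re s" "Re s \<le> 2" "1 \<le> \<bar>Im s\<bar>" for s
  proof -
    have "norm (G s) \<le> (C * brk (Im s) powr (1 / 8)) ^ 2 * (K * brk (Im s) powr (- (3 / 2)))"
      unfolding G_def norm_mult norm_power K_def using s y by (intro mult_mono power_mono C kern_strip_decay) auto
    also have "\<dots> = (C ^ 2 * K) * (brk (Im s) powr (1 / 8) * brk (Im s) powr (1 / 8) * brk (Im s) powr (- (3 / 2)))"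
      by (simp add: power2_eq_square mult_ac)
    also have "brk (Im s) powr (1 / 8) * brk (Im s) powr (1 / 8) * brk (Im s) powr (- (3 / 2)) = brk (Im s) powr (- (5 / 4))"
      by (simp flip: powr_add)
    finally show ?thesis .
  qed
  have ab: "1 / 2 + \<eta> < 2" "finite {1 :: complex}" "(1 :: real) < 5 / 4"
    "\<And>p. p \<in> {1} \<Longrightarrow> 1 / 2 + \<eta> < Re p \<and> Re p < 2" using \<eta> by auto
  note shift = contour_shift[OF ab(1) S ab(2,4) holo ab(3) bound]
  show "integrable lborel (\<lambda>v. zk \<eta> y v)"
    using shift(2) by (simp add: G_def)
  have "(LINT v|lborel. G (Complex 2 v)) = 2 * pi * of_real (dsum1 y)"
    using perron(1)[of 2 "\<lambda>n. of_nat (divisor_count n)" y] y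
    by (simp add: ds_abs_divisor_count ds_divisor_count G_def dsum1_def)
  with shift(1) show "(LINT v|lborel. zk \<eta> y v) = 2 * pi * of_real (derr1 y)"
    using residue_zeta_sq_kern[OF y] by (simp add: G_def[abs_def] derr1_def algebra_simps)
qed

section \<open>The tail of the error term as a line integral\<close>

lemma mu2_0 [simp]: "mu2 0 = 0"
  by (simp add: dirichlet_conv_def)

lemma mu2_1 [simp]: "mu2 (Suc 0) = 1"
proof -
  have "{d :: nat. d dvd Suc 0} = {1}" by auto
  thus ?thesis by (simp add: dirichlet_conv_def moebius_mu_def)
qed

lemma tail_sums:
  fixes f :: "nat \<Rightarrow> 'a :: real_normed_vector"
  assumes "f sums s" "f 0 = 0"
  shows "(\<lambda>l. if Y < real l then f l else 0) sums (s - (\<Sum>l | 0 < l \<and> real l \<le> Y. f l))"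
proof -
  have "(\<lambda>l. f l - (if l \<in> {l. 0 < l \<and> real l \<le> Y} then f l else 0)) sums (s - (\<Sum>l | 0 < l \<and> real l \<le> Y. f l))"
    by (intro sums_diff assms sums_If_finite_set) simp
  also have "(\<lambda>l. f l - (if l \<in> {l. 0 < l \<and> real l \<le> Y} then f l else 0)) = (\<lambda>l. if Y < real l then f l else 0)"
    using assms(2) by (auto simp: fun_eq_iff)
  finally show ?thesis .
qed

text \<open>For Y < 1 the finite sum is empty, whereas at Y = 1 it is the single term 1. So the case
  Y = 1 covers these values at the price of adding 1.\<close>

lemma tail_bound:
  assumes RH: "riemann_hypothesis" and \<eta>: "0 < \<eta>" "\<eta> \<le> 1 / 8" and \<theta>: "0 < \<theta>" "\<theta> < 1"
  obtains C where "0 < C" "\<And>Y t. norm (tail \<eta> Y t) \<le> C * max 1 Y powr (- (1 / 2) + \<theta>) * brk t powr \<theta>"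
proof -
  obtain C where C: "0 < C" "\<And>Y t. 1 \<le> Y \<Longrightarrow> norm (tail \<eta> Y t) \<le> C * Y powr (- (1 / 2) + \<theta>) * brk t powr \<theta>"
    using zeta_inverse_square_tail[OF assms] by blast
  show thesis
  proof
    show "0 < C + 1" using C by simp
    fix Y t
    show "norm (tail \<eta> Y t) \<le> (C + 1) * max 1 Y powr (- (1 / 2) + \<theta>) * brk t powr \<theta>"
    proof (cases "1 \<le> Y")
      case True
      have "norm (tail \<eta> Y t) \<le> C * Y powr (- (1 / 2) + \<theta>) * brk t powr \<theta>" by (rule C(2)[OF True])
      also have "\<dots> \<le> (C + 1) * Y powr (- (1 / 2) + \<theta>) * brk t powr \<theta>" by (intro mult_right_mono) auto
      finally show ?thesis using True by (simp add: max_def)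
    next
      case False
      have e: "{l :: nat. 0 < l \<and> real l \<le> Y} = {}" "{l :: nat. 0 < l \<and> real l \<le> 1} = {1}" using False by auto
      have "tail \<eta> Y t = tail \<eta> 1 t + 1" unfolding tail_def e by simp
      hence "norm (tail \<eta> Y t) \<le> norm (tail \<eta> 1 t) + 1" using norm_triangle_ineq[of "tail \<eta> 1 t" 1] by simp
      also have "\<dots> \<le> C * brk t powr \<theta> + brk t powr \<theta>"
        using C(2)[of 1 t] \<theta> by (intro add_mono ge_one_powr_ge_zero) auto
      finally show ?thesis using False by (simp add: max_def algebra_simps)
    qed
  qed
qed

text \<open>With w = 2 s one has l^(-2 s) x^(s+1) = l^2 (x / l^2)^(s+1), so the l-th term of the
  tail turns the integral for \<open>derr1 x\<close> into l^2 times that for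
  \<open>derr1 (x / l^2)\<close>.\<close>

lemma tail_integral:
  assumes RH: "riemann_hypothesis" and \<eta>: "0 < \<eta>" "\<eta> < 1 / 2" and x: "0 < x"
  shows "(\<lambda>l. if Y < real l then of_real (2 * pi * (of_int (mu2 l) * (real l ^ 2 * derr1 (x / real l ^ 2)))) else 0) sums
     (LINT v|lborel. tail \<eta> Y (2 * v) * (zk \<eta> x v))"
    and "integrable lborel (\<lambda>v. tail \<eta> Y (2 * v) * (zk \<eta> x v))"
proof -
  define e where "e l v = (if Y < real l then of_int (mu2 l) * of_nat l powr (- Complex (1 + 2 * \<eta>) (2 * v)) else 0 :: complex)" for l v
  define B where "B v = zk \<eta> x v" for v
  have e_cont: "continuous_on UNIV (e l)" for l
  proof (cases "l = 0")
    case False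
    thus ?thesis unfolding e_def by (cases "Y < real l") (auto intro!: continuous_intros)
  qed (cases "Y < 0"; simp add: e_def)
  have e_norm: "norm (e l v) \<le> norm (of_int (mu2 l) :: complex) * real l powr (- (1 + 2 * \<eta>))" for l v
    unfolding e_def by (auto simp: norm_mult norm_of_nat_powr)
  have w: "summable (\<lambda>l. norm (of_int (mu2 l) :: complex) * real l powr (- (1 + 2 * \<eta>)))"
    using ds_abs_mu2[of "1 + 2 * \<eta>"] \<eta> by (simp add: ds_abs_def)
  have B: "integrable lborel B" unfolding B_def by (rule derr1_integral(2)[OF RH \<eta> x])
  note * = integral_sums_line[OF e_cont e_norm w B]
  have e_sum: "(\<Sum>l. e l v) = tail \<eta> Y (2 * v)" for v
  proof -
    have "(\<lambda>l. of_int (mu2 l) * of_nat l powr (- Complex (1 + 2 * \<eta>) (2 * v))) sums (1 / zeta (Complex (1 + 2 * \<eta>) (2 * v)) ^ 2)"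
      using ds_sums[of "\<lambda>l. of_int (mu2 l)" "Complex (1 + 2 * \<eta>) (2 * v)"] ds_abs_mu2[of "1 + 2 * \<eta>"] \<eta> by (simp add: ds_mu2)
    from tail_sums[OF this, of Y] show ?thesis by (simp add: e_def tail_def sums_iff)
  qed
  show "integrable lborel (\<lambda>v. tail \<eta> Y (2 * v) * (zk \<eta> x v))"
    using *(2) by (simp only: e_sum B_def)
  have tm: "(LINT v|lborel. e l v * B v) = (if Y < real l then of_real (2 * pi * (of_int (mu2 l) * (real l ^ 2 * derr1 (x / real l ^ 2)))) else 0)" for l
  proof (cases "Y < real l \<and> l \<noteq> 0")
    case True
    have "e l v * B v = (of_int (mu2 l) * of_nat l ^ 2) * (zeta (Complex (1 / 2 + \<eta>) v) ^ 2 * kern (x / real l ^ 2) (Complex (1 / 2 + \<eta>) v))" for v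
    proof -
      define s where "s = Complex (1 / 2 + \<eta>) v"
      have s2: "Complex (1 + 2 * \<eta>) (2 * v) = s + s" by (simp add: s_def complex_eq_iff)
      have L: "of_real (real l ^ 2) powr (s + 1) = (of_nat l powr s * of_nat l) * (of_nat l powr s * of_nat l :: complex)"
        using True powr_times_real[of "of_real (real l)" "of_real (real l)" "s + 1"] by (simp add: power2_eq_square powr_add)
      have h: "of_real x powr (s + 1) = of_real (x / real l ^ 2) powr (s + 1) * of_real (real l ^ 2) powr (s + 1)"
        using True x powr_times_real[of "of_real (x / real l ^ 2)" "of_real (real l ^ 2)" "s + 1"] by simp
      have "of_nat l powr (- (s + s)) * of_real x powr (s + 1) = of_nat l ^ 2 * of_real (x / real l ^ 2) powr (s + 1)"
      proof -
        have p: "of_nat l powr (- (s + s)) = 1 / (of_nat l powr s * of_nat l powr s :: complex)"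
          by (simp only: powr_minus powr_add inverse_eq_divide)
        have nz: "of_nat l powr s \<noteq> (0 :: complex)" using True by simp
        show ?thesis unfolding h L p using nz by (simp add: power2_eq_square)
      qed
      hence "of_int (mu2 l) * zeta s ^ 2 * (of_nat l powr (- (s + s)) * of_real x powr (s + 1)) / (s * (s + 1)) =
             of_int (mu2 l) * zeta s ^ 2 * (of_nat l ^ 2 * of_real (x / real l ^ 2) powr (s + 1)) / (s * (s + 1))" by simp
      thus ?thesis using True unfolding e_def B_def kern_def s2 s_def[symmetric] by (simp add: mult_ac)
    qed
    hence "(LINT v|lborel. e l v * B v) = (of_int (mu2 l) * of_nat l ^ 2) * (2 * pi * of_real (derr1 (x / real l ^ 2)))"
      using derr1_integral(1)[OF RH \<eta>, of "x / real l ^ 2"] x True by simp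
    thus ?thesis using True by (simp add: mult_ac)
  qed (auto simp: e_def)
  show "(\<lambda>l. if Y < real l then of_real (2 * pi * (of_int (mu2 l) * (real l ^ 2 * derr1 (x / real l ^ 2)))) else 0) sums
     (LINT v|lborel. tail \<eta> Y (2 * v) * (zk \<eta> x v))"
    using *(1) unfolding e_sum tm by (simp only: B_def)
qed

text \<open>\<open>mu2 l\<close> times the mean of \<Delta>(u / l^2) over u in [x, x + 1]; the
  factor l^2 comes from the substitution u / l^2.\<close>

abbreviation smooth_term :: "real \<Rightarrow> nat \<Rightarrow> real" where
  "smooth_term x l \<equiv> of_int (mu2 l) * (real l ^ 2 * (derr1 ((x + 1) / real l ^ 2) - derr1 (x / real l ^ 2)))"

text \<open>Taking the difference at x + 1 and x replaces the kernel by \<open>kdiff\<close>. The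
  tail and zeta^2 each cost \<theta> / 4 in the ordinate, so half of the extra decay \<theta> is
  left for convergence.\<close>

lemma smoothed_tail_bound:
  assumes RH: "riemann_hypothesis" and \<eta>: "0 < \<eta>" "\<eta> \<le> 1 / 8" and \<theta>: "0 < \<theta>" "\<theta> < 1"
  obtains C where "0 < C" "\<And>x Y. 1 \<le> x \<Longrightarrow> \<exists>R.
    (\<lambda>l. if Y < real l then smooth_term x l else 0) sums R \<and>
    \<bar>R\<bar> \<le> C * x powr (1 / 2 + \<eta> + \<theta>) * max 1 Y powr (- (1 / 2) + \<theta>)"
proof -
  obtain Ct where Ct: "0 < Ct" "\<And>Y t. norm (tail \<eta> Y t) \<le> Ct * max 1 Y powr (- (1 / 2) + \<theta> / 4) * brk t powr (\<theta> / 4)"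
    by (rule tail_bound[OF RH \<eta>, of "\<theta> / 4"]) (use \<theta> in \<open>simp, simp, blast\<close>)
  obtain Cz where Cz: "0 < Cz" "\<And>s. \<lbrakk>1 / 2 + \<eta> \<le> Re s; Re s \<le> 4; s \<in> {s. Re s = 1 / 2 + \<eta>}\<rbrakk> \<Longrightarrow> norm (zeta s) \<le> Cz * brk (Im s) powr (\<theta> / 8)"
    by (rule RH_zeta_bounds[OF RH \<eta>(1), of "\<theta> / 8" "{s. Re s = 1 / 2 + \<eta>}"])
       (use \<theta> \<eta> in \<open>simp, simp add: closed_halfspace_Re_eq, simp, blast\<close>)
  define a where "a = 1 / 2 + \<eta>"
  define K where "K = Ct * 2 * Cz ^ 2 * 1024 * J (1 + \<theta> / 2)"
  have K0: "0 \<le> K" using Ct Cz J_nonneg by (simp add: K_def)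
  have \<eta>1: "\<eta> < 1 / 2" using \<eta> by simp
  show thesis
  proof
    show "0 < K + 1" using K0 by simp
    fix x Y :: real assume x: "1 \<le> x"
    define I where "I x = (LINT v|lborel. tail \<eta> Y (2 * v) * (zeta (Complex a v) ^ 2 * kern x (Complex a v)))" for x
    define M where "M = max 1 Y powr (- (1 / 2) + \<theta> / 4)"
    define g where "g v = tail \<eta> Y (2 * v) * (zeta (Complex a v) ^ 2 * kdiff x (Complex a v))" for v
    have M0: "0 \<le> M" by (simp add: M_def)
    have int: "integrable lborel (\<lambda>v. tail \<eta> Y (2 * v) * (zeta (Complex a v) ^ 2 * kern z (Complex a v)))" if "0 < z" for z
      unfolding a_def by (rule tail_integral(2)[OF RH \<eta>(1) \<eta>1 that])
    have "I (x + 1) - I x = (LINT v|lborel. g v)"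
      unfolding I_def g_def kdiff_def using int[of "x + 1"] int[of x] x
      by (subst Bochner_Integration.integral_diff[symmetric]) (auto simp: algebra_simps)
    also have "norm \<dots> \<le> (Ct * M * 2 * Cz ^ 2 * 1024 * x powr (a + \<theta>)) * J (1 + \<theta> / 2)"
    proof -
      have int_g: "integrable lborel g"
        unfolding g_def kdiff_def using Bochner_Integration.integrable_diff[OF int[of "x + 1"] int[of x]] x
        by (simp add: algebra_simps)
      have g: "norm (g v) \<le> (Ct * M * 2 * Cz ^ 2 * 1024 * x powr (a + \<theta>)) * brk v powr (- (1 + \<theta> / 2))" for v
      proof -
        define u where "u = 1 + \<bar>v\<bar>"
        have u: "1 \<le> u" by (simp add: u_def)
        have "brk (2 * v) powr (\<theta> / 4) \<le> (2 * u) powr (\<theta> / 4)" using \<theta> by (intro powr_mono2) (auto simp: u_def)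
        also have "\<dots> = 2 powr (\<theta> / 4) * u powr (\<theta> / 4)" using u by (simp add: powr_mult)
        also have "\<dots> \<le> 2 powr 1 * u powr (\<theta> / 4)" using \<theta> by (intro mult_right_mono powr_mono) auto
        finally have "Ct * M * brk (2 * v) powr (\<theta> / 4) \<le> Ct * M * (2 * u powr (\<theta> / 4))"
          using Ct M0 by (intro mult_left_mono) auto
        hence t: "norm (tail \<eta> Y (2 * v)) \<le> Ct * M * (2 * u powr (\<theta> / 4))"
          using Ct(2)[of Y "2 * v"] by (simp add: M_def)
        have z: "norm (zeta (Complex a v)) \<le> Cz * u powr (\<theta> / 8)"
          using Cz(2)[of "Complex a v"] \<eta> by (simp add: a_def u_def)
        have k: "norm (kdiff x (Complex a v)) \<le> 1024 * x powr (a + \<theta>) * u powr (- (1 + \<theta>))"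
          unfolding u_def using \<eta> \<theta> by (intro kdiff_bound x) (auto simp: a_def)
        have "norm (g v) \<le> (Ct * M * (2 * u powr (\<theta> / 4))) * ((Cz * u powr (\<theta> / 8)) ^ 2 * (1024 * x powr (a + \<theta>) * u powr (- (1 + \<theta>))))"
          unfolding g_def norm_mult norm_power using Ct M0 by (intro mult_mono power_mono t z k) auto
        also have "\<dots> = (Ct * M * 2 * Cz ^ 2 * 1024 * x powr (a + \<theta>)) * (u powr (\<theta> / 4) * u powr (\<theta> / 8) * u powr (\<theta> / 8) * u powr (- (1 + \<theta>)))"
          by (simp add: power2_eq_square mult_ac)
        also have "u powr (\<theta> / 4) * u powr (\<theta> / 8) * u powr (\<theta> / 8) * u powr (- (1 + \<theta>)) = u powr (- (1 + \<theta> / 2))"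
          unfolding powr_add[symmetric] by (rule arg_cong[where f = "\<lambda>e. u powr e"]) simp
        finally show ?thesis by (simp only: u_def)
      qed
      have int_b: "integrable lborel (\<lambda>v. (Ct * M * 2 * Cz ^ 2 * 1024 * x powr (a + \<theta>)) * brk v powr (- (1 + \<theta> / 2)))"
        using integrable_one_plus_abs_powr[of "1 + \<theta> / 2"] \<theta> by simp
      have "norm (LINT v|lborel. g v) \<le> (LINT v|lborel. (Ct * M * 2 * Cz ^ 2 * 1024 * x powr (a + \<theta>)) * brk v powr (- (1 + \<theta> / 2)))"
        by (rule Bochner_Integration.integral_norm_bound_integral[OF int_g int_b g])
      thus ?thesis by (simp add: J_def)
    qed
    also have "\<dots> = K * x powr (a + \<theta>) * M" by (simp add: K_def mult_ac)
    also have "\<dots> \<le> (K + 1) * x powr (1 / 2 + \<eta> + \<theta>) * max 1 Y powr (- (1 / 2) + \<theta>)"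
      unfolding M_def a_def using K0 \<theta> x by (intro mult_mono powr_mono) auto
    finally have bound: "norm (I (x + 1) - I x) \<le> (K + 1) * x powr (1 / 2 + \<eta> + \<theta>) * max 1 Y powr (- (1 / 2) + \<theta>)" .
    define r where "r l = (if Y < real l then smooth_term x l else 0)" for l
    let ?d = "\<lambda>l. (if Y < real l then of_real (2 * pi * (of_int (mu2 l) * (real l ^ 2 * derr1 ((x + 1) / real l ^ 2)))) else 0) -
          (if Y < real l then of_real (2 * pi * (of_int (mu2 l) * (real l ^ 2 * derr1 (x / real l ^ 2)))) else 0)"
    have "(\<lambda>l. complex_of_real (2 * pi * r l)) sums (I (x + 1) - I x)"
    proof -
      have "?d sums (I (x + 1) - I x)"
        unfolding I_def a_def using x by (intro sums_diff tail_integral(1)[OF RH \<eta>(1) \<eta>1]) auto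
      moreover have "?d = (\<lambda>l. complex_of_real (2 * pi * r l))"
        by (auto simp: r_def fun_eq_iff algebra_simps)
      ultimately show ?thesis by simp
    qed
    from sums_Re[OF this] have "(\<lambda>l. 2 * pi * r l) sums Re (I (x + 1) - I x)" by simp
    from sums_divide[OF this, of "2 * pi"] have R: "r sums (Re (I (x + 1) - I x) / (2 * pi))" by simp
    have "\<bar>Re (I (x + 1) - I x) / (2 * pi)\<bar> = \<bar>Re (I (x + 1) - I x)\<bar> / (2 * pi)" by (simp add: abs_divide)
    also have "\<dots> \<le> \<bar>Re (I (x + 1) - I x)\<bar> / 1" using pi_ge_two by (intro divide_left_mono) auto
    also have "\<dots> \<le> norm (I (x + 1) - I x)" using abs_Re_le_cmod[of "I (x + 1) - I x"] by simp
    also note bound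
    finally show "\<exists>R. (\<lambda>l. if Y < real l then smooth_term x l else 0) sums R \<and>
      \<bar>R\<bar> \<le> (K + 1) * x powr (1 / 2 + \<eta> + \<theta>) * max 1 Y powr (- (1 / 2) + \<theta>)"
      using R unfolding r_def by blast
  qed
qed

section \<open>The error term as a series\<close>

lemma DERIV_dmain1: "0 < y \<Longrightarrow> (dmain1 has_real_derivative dmain y) (at y)"
  unfolding dmain1_def[abs_def] dmain_def
  by (auto intro!: derivative_eq_intros simp: field_simps power2_eq_square)

lemma DERIV_dmain: "0 < y \<Longrightarrow> (dmain has_real_derivative (ln y + 2 * euler_mascheroni)) (at y)"
  unfolding dmain_def[abs_def] by (auto intro!: derivative_eq_intros simp: field_simps)

text \<open>Two applications of the mean value theorem: the average of \<open>dmain\<close> over an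
  interval of length 1 / l^2 differs from its left end value by at most that length times a
  logarithm. The exponent -3/2 leaves room for ln l and keeps the sum against \<open>mu2\<close>
  convergent.\<close>

lemma dmain_smoothing:
  assumes x: "1 \<le> x" and l: "0 < l"
  shows "\<bar>real l ^ 2 * (dmain1 ((x + 1) / real l ^ 2) - dmain1 (x / real l ^ 2)) - dmain (x / real l ^ 2)\<bar>
    \<le> 5 * (ln (x + 1) + 2 * euler_mascheroni + 1) * real l powr (- (3 / 2))"
proof -
  define L where "L = real l ^ 2"
  define a where "a = x / L"
  have L: "0 < L" "1 \<le> L" using l unfolding L_def by (auto simp: Suc_le_eq intro: one_le_power)
  have a: "0 < a" using x L by (simp add: a_def)
  have ab: "a < (x + 1) / L" using L by (simp add: a_def divide_strict_right_mono)
  obtain z where z: "a < z" "z < (x + 1) / L" "dmain1 ((x + 1) / L) - dmain1 a = ((x + 1) / L - a) * dmain z"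
    using MVT2[OF ab, of dmain1 dmain] DERIV_dmain1 a by (meson less_le_trans)
  obtain u where u: "a < u" "u < z" "dmain z - dmain a = (z - a) * (ln u + 2 * euler_mascheroni)"
    using MVT2[OF z(1), of dmain "\<lambda>y. ln y + 2 * euler_mascheroni"] DERIV_dmain a by (meson less_le_trans)
  have "L * (dmain1 ((x + 1) / L) - dmain1 a) - dmain a = (z - a) * (ln u + 2 * euler_mascheroni)"
    unfolding z(3) u(3)[symmetric] using L by (simp add: a_def field_simps)
  moreover have "\<bar>(z - a) * (ln u + 2 * euler_mascheroni)\<bar> \<le> (1 / L) * (ln (x + 1) + 2 * ln (real l) + 2 * euler_mascheroni)"
    unfolding abs_mult
  proof (intro mult_mono)
    have "z - a \<le> (x + 1) / L - x / L" using z by (simp add: a_def)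
    thus "\<bar>z - a\<bar> \<le> 1 / L" using z by (simp add: diff_divide_distrib[symmetric])
    have u0: "0 < u" using u a by simp
    have "u \<le> (x + 1) / L" using u z by simp
    also have "\<dots> \<le> (x + 1) / 1" using L x by (intro divide_left_mono) auto
    finally have "ln u \<le> ln (x + 1)" using u0 x by simp
    moreover have "1 / L \<le> a" unfolding a_def using x L by (intro divide_right_mono) auto
    hence "1 / L \<le> u" using u by simp
    hence "ln (1 / L) \<le> ln u" using u0 L by (subst ln_le_cancel_iff) auto
    hence "- (2 * ln (real l)) \<le> ln u" using l by (simp add: L_def ln_div ln_realpow)
    moreover have "0 \<le> ln (x + 1)" "0 \<le> ln (real l)" using x l by auto
    ultimately show "\<bar>ln u + 2 * euler_mascheroni\<bar> \<le> ln (x + 1) + 2 * ln (real l) + 2 * euler_mascheroni"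
      using euler_mascheroni_pos by linarith
  qed (use L in auto)
  moreover have "(1 / L) * (ln (x + 1) + 2 * ln (real l) + 2 * euler_mascheroni) \<le>
      5 * (ln (x + 1) + 2 * euler_mascheroni + 1) * real l powr (- (3 / 2))"
  proof -
    define E where "E = ln (x + 1) + 2 * euler_mascheroni"
    have E: "0 \<le> E" using x euler_mascheroni_pos by (simp add: E_def)
    have l1: "1 \<le> real l powr (1 / 2)" using l by (intro ge_one_powr_ge_zero) auto
    have "ln (real l) \<le> real l powr (1 / 2) / (1 / 2)" using l by (intro ln_powr_bound) auto
    hence "E + 2 * ln (real l) \<le> E * 1 + 4 * real l powr (1 / 2)" by simp
    also have "\<dots> \<le> E * real l powr (1 / 2) + 4 * real l powr (1 / 2)" using E l1 by (intro add_mono mult_left_mono) auto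
    also have "\<dots> \<le> 5 * (E + 1) * real l powr (1 / 2)"
      using E mult_nonneg_nonneg[OF E, of "real l powr (1 / 2)"] by (simp add: algebra_simps)
    finally have "(1 / L) * (E + 2 * ln (real l)) \<le> (1 / L) * (5 * (E + 1) * real l powr (1 / 2))"
      using L by (intro mult_left_mono) auto
    also have "1 / L = real l powr (- 2)" using l by (simp add: L_def powr_minus powr_numeral inverse_eq_divide)
    also have "real l powr (- 2) * (5 * (E + 1) * real l powr (1 / 2)) = 5 * (E + 1) * (real l powr (- 2) * real l powr (1 / 2))"
      by (simp add: mult_ac)
    also have "real l powr (- 2) * real l powr (1 / 2) = real l powr (- (3 / 2))" by (simp flip: powr_add)
    finally show ?thesis using l by (simp add: E_def L_def powr_minus powr_numeral inverse_eq_divide algebra_simps)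
  qed
  ultimately show ?thesis unfolding a_def L_def by linarith
qed

text \<open>A new n in the sum satisfies x < n l^2 \<le> x + 1, hence n l^2 = \<open>N\<close>. So
  there is none unless l^2 divides \<open>N\<close>, and then at most n = N / l^2, with weight at
  most 1.\<close>

lemma dsum_smoothing:
  assumes x: "1 \<le> x" and l: "0 < l"
  defines "N \<equiv> nat \<lfloor>x\<rfloor> + 1"
  shows "\<bar>real l ^ 2 * (dsum1 ((x + 1) / real l ^ 2) - dsum1 (x / real l ^ 2)) - real (divisor_sum (x / real l ^ 2))\<bar>
    \<le> (if l ^ 2 dvd N then real (divisor_count (N div l ^ 2)) else 0)"
proof -
  define L where "L = real l ^ 2"
  have L: "0 < L" using l by (simp add: L_def)
  define A where "A = {n :: nat. 0 < n \<and> real n \<le> x / L}"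
  define A' where "A' = {n :: nat. 0 < n \<and> real n \<le> (x + 1) / L}"
  have fin: "finite A" "finite A'" by (simp_all add: A_def A'_def)
  have sub: "A \<subseteq> A'"
  proof
    fix n assume "n \<in> A"
    moreover have "x / L \<le> (x + 1) / L" using L by (intro divide_right_mono) auto
    ultimately show "n \<in> A'" by (auto simp: A_def A'_def)
  qed
  have N: "n * l ^ 2 = N" if "n \<in> A' - A" for n
  proof -
    have "x < real (n * l ^ 2)" "real (n * l ^ 2) \<le> x + 1"
      using that L unfolding A_def A'_def L_def by (auto simp: field_simps)
    hence "\<lfloor>x\<rfloor> = int (n * l ^ 2) - 1" by (intro floor_unique) auto
    moreover have "1 \<le> \<lfloor>x\<rfloor>" using x by simp
    ultimately show ?thesis unfolding N_def by linarith
  qed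
  have "L * dsum1 ((x + 1) / L) = (\<Sum>n\<in>A'. real (divisor_count n) * (x + 1 - real n * L))"
    unfolding dsum1_def A'_def sum_distrib_left using L by (intro sum.cong) (auto simp: field_simps)
  moreover have "L * dsum1 (x / L) = (\<Sum>n\<in>A. real (divisor_count n) * (x - real n * L))"
    unfolding dsum1_def A_def sum_distrib_left using L by (intro sum.cong) (auto simp: field_simps)
  moreover have "(\<Sum>n\<in>A'. real (divisor_count n) * (x + 1 - real n * L)) =
      (\<Sum>n\<in>A' - A. real (divisor_count n) * (x + 1 - real n * L)) + (\<Sum>n\<in>A. real (divisor_count n) * (x + 1 - real n * L))"
    using fin sub by (rule_tac sum.subset_diff)
  moreover have "(\<Sum>n\<in>A. real (divisor_count n) * (x + 1 - real n * L)) =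
     (\<Sum>n\<in>A. real (divisor_count n) * (x - real n * L)) + real (divisor_sum (x / L))"
    by (simp add: divisor_sum_def A_def algebra_simps sum.distrib sum_subtractf)
  ultimately have eq: "L * (dsum1 ((x + 1) / L) - dsum1 (x / L)) - real (divisor_sum (x / L)) =
     (\<Sum>n\<in>A' - A. real (divisor_count n) * (x + 1 - real n * L))"
    by (simp add: right_diff_distrib)
  have "\<bar>\<Sum>n\<in>A' - A. real (divisor_count n) * (x + 1 - real n * L)\<bar> \<le> (\<Sum>n\<in>A' - A. real (divisor_count n))"
  proof (rule order_trans[OF sum_abs], intro sum_mono)
    fix n assume n: "n \<in> A' - A"
    have "x < real n * L" "real n * L \<le> x + 1" using n L by (auto simp: A_def A'_def field_simps)
    hence "\<bar>x + 1 - real n * L\<bar> \<le> 1" by linarith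
    thus "\<bar>real (divisor_count n) * (x + 1 - real n * L)\<bar> \<le> real (divisor_count n)"
      unfolding abs_mult using mult_left_mono[of "\<bar>x + 1 - real n * L\<bar>" 1 "real (divisor_count n)"] by simp
  qed
  also have "\<dots> \<le> (if l ^ 2 dvd N then real (divisor_count (N div l ^ 2)) else 0)"
  proof (cases "A' - A = {}")
    case False
    then obtain n where n: "n \<in> A' - A" by blast
    hence "A' - A = {N div l ^ 2}" using N l by (auto simp: div_mult_self_is_m) (metis N DiffI div_mult_self_is_m zero_less_power)+
    moreover have "l ^ 2 dvd N" using N[OF n] by (metis dvd_triv_right)
    ultimately show ?thesis by simp
  next
    case True
    show ?thesis unfolding True by simp
  qed
  finally show ?thesis unfolding L_def[symmetric] eq .
qed

text \<open>Each such l divides \<open>N\<close>, so there are at most d(N) of them, and both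
  factors of a term are at most d(N).\<close>

lemma sum_mu2_divisor_count_le:
  assumes "0 < N"
  shows "(\<Sum>l | l ^ 2 dvd N. \<bar>real_of_int (mu2 l)\<bar> * real (divisor_count (N div l ^ 2))) \<le> real (divisor_count N) ^ 3"
proof -
  have dvd: "l dvd N" if "l ^ 2 dvd N" for l using that by (meson dvd_power dvd_trans zero_less_numeral)
  have fin: "finite {l. l dvd N}" using assms by simp
  have "(\<Sum>l | l ^ 2 dvd N. \<bar>real_of_int (mu2 l)\<bar> * real (divisor_count (N div l ^ 2))) \<le>
     (\<Sum>l | l ^ 2 dvd N. real (divisor_count N) * real (divisor_count N))"
  proof (intro sum_mono mult_mono)
    fix l assume "l \<in> {l. l ^ 2 dvd N}"
    hence l: "l ^ 2 dvd N" by simp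
    have "\<bar>mu2 l\<bar> \<le> int (divisor_count N)"
      using abs_mu2_le[of l] divisor_count_mono_dvd[OF dvd[OF l] assms] by linarith
    thus "\<bar>real_of_int (mu2 l)\<bar> \<le> real (divisor_count N)" by linarith
    have "N div l ^ 2 dvd N" using l by (metis dvd_div_mult_self dvd_triv_left)
    thus "real (divisor_count (N div l ^ 2)) \<le> real (divisor_count N)"
      using divisor_count_mono_dvd[OF _ assms] by simp
  qed auto
  also have "\<dots> \<le> (\<Sum>l | l dvd N. real (divisor_count N) * real (divisor_count N))"
    using fin dvd by (intro sum_mono2) auto
  also have "\<dots> = real (divisor_count N) ^ 3" by (simp add: divisor_count_def power3_eq_cube)
  finally show ?thesis .
qed

section \<open>The main term and the constants at s = 2\<close>

lemma ds_real:
  assumes "ds_abs (\<lambda>n. of_real (b n)) r"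
  shows "(\<lambda>n. b n * real n powr (- r)) sums Re (ds (\<lambda>n. of_real (b n)) (of_real r))" "Im (ds (\<lambda>n. of_real (b n)) (of_real r)) = 0"
proof -
  have eq: "of_real (b n) * of_nat n powr (- of_real r) = complex_of_real (b n * real n powr (- r))" for n
    using powr_of_real[of "real n" "- r"] by simp
  have s: "(\<lambda>n. complex_of_real (b n * real n powr (- r))) sums ds (\<lambda>n. of_real (b n)) (of_real r)"
    using ds_sums[of "\<lambda>n. of_real (b n)" "of_real r"] assms unfolding eq by simp
  show "(\<lambda>n. b n * real n powr (- r)) sums Re (ds (\<lambda>n. of_real (b n)) (of_real r))"
    using sums_Re[OF s] by simp
  show "Im (ds (\<lambda>n. of_real (b n)) (of_real r)) = 0"
    using sums_unique2[OF sums_Im[OF s]] by simp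
qed

lemma zeta_2_real: "Im (zeta 2) = 0" and zeta_deriv_2_real: "Im (deriv zeta 2) = 0"
proof -
  have "zeta 2 = ds (\<lambda>n. of_real 1) (of_real 2)" using zeta_eq_ds[of 2] by simp
  thus "Im (zeta 2) = 0" using ds_real(2)[of "\<lambda>_. 1" 2] ds_abs_1[of 2] by simp
  have "deriv zeta 2 = - zeta 2 * ds mangoldt 2" by (rule zeta_ds_mangoldt) simp
  moreover have "Im (ds mangoldt 2) = 0"
    using ds_real(2)[of "\<lambda>n. mangoldt n" 2] ds_abs_mangoldt[of 2] by simp
  ultimately show "Im (deriv zeta 2) = 0" using \<open>Im (zeta 2) = 0\<close> by simp
qed

text \<open>The values of 1 / zeta^2 and of minus its derivative at 2, transferred to real series
  because zeta and its derivative are real there.\<close>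

lemma mu2_sums:
  "(\<lambda>l. of_int (mu2 l) * real l powr (- 2)) sums (1 / Re (zeta 2) ^ 2)"
  "(\<lambda>l. of_int (mu2 l) * ln (real l) * real l powr (- 2)) sums (2 * Re (deriv zeta 2) / Re (zeta 2) ^ 3)"
proof -
  define z d where "z = Re (zeta 2)" and "d = Re (deriv zeta 2)"
  have z: "zeta 2 = of_real z" and d: "deriv zeta 2 = of_real d"
    using zeta_2_real zeta_deriv_2_real by (simp_all add: z_def d_def complex_eq_iff)
  have z0: "z \<noteq> 0" using zeta_nonzero_gt_1[of 2] z by auto
  have g: "ds_abs (\<lambda>l. of_int (mu2 l)) r" if "1 < r" for r by (rule ds_abs_mu2[OF that])
  have "(\<lambda>l. of_int (mu2 l) * real l powr (- 2)) sums Re (ds (\<lambda>l. of_int (mu2 l)) 2)"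
    using ds_real(1)[of "\<lambda>l. of_int (mu2 l)" 2] g[of 2] by simp
  also have "ds (\<lambda>l. of_int (mu2 l)) 2 = of_real (1 / z ^ 2)" using ds_mu2[of 2] by (simp add: z)
  finally show "(\<lambda>l. of_int (mu2 l) * real l powr (- 2)) sums (1 / Re (zeta 2) ^ 2)" by (simp add: z_def)
  have "(ds (\<lambda>l. of_int (mu2 l)) has_field_derivative - 2 * of_real d / of_real z ^ 3) (at 2)"
  proof (rule has_field_derivative_transform_within_open[where S = "{s. 1 < Re s}"])
    have "(zeta has_field_derivative of_real d) (at 2)"
      using zeta_deriv_ds[of 2] d DERIV_imp_deriv[OF zeta_deriv_ds[of 2]] by simp
    thus "((\<lambda>s. 1 / zeta s ^ 2) has_field_derivative - 2 * of_real d / of_real z ^ 3) (at 2)"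
      using z z0 by (auto intro!: derivative_eq_intros simp: power_numeral_reduce field_simps)
  qed (auto simp: ds_mu2 open_halfspace_Re_gt)
  hence "ds (\<lambda>n. - (of_int (mu2 n) * ln (of_nat n))) 2 = - 2 * of_real d / of_real z ^ 3"
    using ds_deriv(1)[OF g[of "3 / 2"], of 2] DERIV_unique by fastforce
  hence "(\<lambda>n. - (of_int (mu2 n) * ln (of_nat n)) * of_nat n powr (- 2)) sums (- 2 * of_real d / of_real z ^ 3 :: complex)"
    using ds_deriv(2)[OF g[of "3 / 2"], of 2] by simp
  from sums_Re[OF sums_minus[OF this]]
  have "(\<lambda>n. Re (- (- (of_int (mu2 n) * ln (of_nat n)) * of_nat n powr (- 2)))) sums Re (- (- 2 * of_real d / of_real z ^ 3))" .
  moreover have "Re (- (- (of_int (mu2 n) * ln (of_nat n)) * of_nat n powr (- 2))) = of_int (mu2 n) * ln (real n) * real n powr (- 2)" for n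
  proof (cases "n = 0")
    case False
    have "of_nat n powr (- 2) = complex_of_real (real n powr (- 2))" using powr_of_real[of "real n" "- 2"] by simp
    thus ?thesis using False by (simp add: Ln_of_nat)
  qed simp
  moreover have "Re (- (- 2 * of_real d / of_real z ^ 3)) = 2 * d / z ^ 3"
    by (simp flip: of_real_power of_real_divide of_real_mult)
  ultimately show "(\<lambda>l. of_int (mu2 l) * ln (real l) * real l powr (- 2)) sums (2 * Re (deriv zeta 2) / Re (zeta 2) ^ 3)"
    by (simp add: z_def d_def)
qed

text \<open>The divisor sums vanish for l^2 > x, so extending to all l affects only the main terms.
  There ln (x / l^2) = ln x - 2 ln l, and the series with ln l produces the term -4 zeta'(2) /
  zeta(2).\<close>

lemma E_mu_sums:
  assumes x: "0 < x"
  shows "(\<lambda>l. of_int (mu2 l) * divisor_error (x / real l ^ 2)) sums E_mu x"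
proof -
  define z d c where "z = Re (zeta 2)" and "d = Re (deriv zeta 2)" and "c = 2 * euler_mascheroni - (1 :: real)"
  let ?L = "{l :: nat. 0 < l \<and> real l ^ 2 \<le> x}"
  have finL: "finite ?L"
  proof (rule finite_subset[OF _ finite_nat_real_le[of x]], clarify)
    fix l :: nat assume l: "0 < l" "real l ^ 2 \<le> x"
    have "real l \<le> real l ^ 2" using l by (intro self_le_power) auto
    with l(2) show "real l \<le> x" by linarith
  qed
  have "(\<lambda>l. if l \<in> ?L then of_int (mu2 l) * real (divisor_sum (x / real l ^ 2)) else 0) sums
     (\<Sum>l\<in>?L. of_int (mu2 l) * real (divisor_sum (x / real l ^ 2)))"
    using finL by (rule sums_If_finite_set)
  also have "(\<Sum>l\<in>?L. of_int (mu2 l) * real (divisor_sum (x / real l ^ 2))) = of_int (S_mu x)"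
    by (simp add: S_mu_eq)
  also have "(\<lambda>l. if l \<in> ?L then of_int (mu2 l) * real (divisor_sum (x / real l ^ 2)) else 0) =
      (\<lambda>l. of_int (mu2 l) * real (divisor_sum (x / real l ^ 2)))"
  proof
    fix l
    have "divisor_sum (x / real l ^ 2) = 0" if "0 < l" "x < real l ^ 2"
    proof -
      have empty: "{n :: nat. 0 < n \<and> real n \<le> x / real l ^ 2} = {}"
      proof (safe; simp)
        fix n :: nat assume "0 < n" "real n \<le> x / real l ^ 2"
        hence "1 \<le> x / real l ^ 2" by linarith
        with that show False by (simp add: field_simps)
      qed
      show ?thesis unfolding divisor_sum_def empty by (rule sum.empty)
    qed
    thus "(if l \<in> ?L then of_int (mu2 l) * real (divisor_sum (x / real l ^ 2)) else 0) = of_int (mu2 l) * real (divisor_sum (x / real l ^ 2))"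
      by (cases "l = 0") auto
  qed
  finally have S: "(\<lambda>l. of_int (mu2 l) * real (divisor_sum (x / real l ^ 2))) sums of_int (S_mu x)" .
  have "(\<lambda>l. x * (ln x + c) * (of_int (mu2 l) * real l powr (- 2)) - 2 * x * (of_int (mu2 l) * ln (real l) * real l powr (- 2))) sums
     (x * (ln x + c) * (1 / z ^ 2) - 2 * x * (2 * d / z ^ 3))"
    unfolding z_def d_def by (intro sums_diff sums_mult mu2_sums)
  also have "(\<lambda>l. x * (ln x + c) * (of_int (mu2 l) * real l powr (- 2)) - 2 * x * (of_int (mu2 l) * ln (real l) * real l powr (- 2))) =
     (\<lambda>l. of_int (mu2 l) * dmain (x / real l ^ 2))"
  proof
    fix l :: nat
    show "x * (ln x + c) * (of_int (mu2 l) * real l powr (- 2)) - 2 * x * (of_int (mu2 l) * ln (real l) * real l powr (- 2)) =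
      of_int (mu2 l) * dmain (x / real l ^ 2)"
    proof (cases "l = 0")
      case False
      have p: "real l powr (- 2) = 1 / real l ^ 2" using False by (simp add: powr_minus powr_numeral inverse_eq_divide)
      have ln: "ln (x / real l ^ 2) = ln x - 2 * ln (real l)" using False x by (simp add: ln_div ln_realpow)
      show ?thesis unfolding dmain_def p ln
        by (simp add: c_def algebra_simps add_divide_distrib diff_divide_distrib)
    qed simp
  qed
  finally have "(\<lambda>l. of_int (mu2 l) * dmain (x / real l ^ 2)) sums (x * (ln x + c) * (1 / z ^ 2) - 2 * x * (2 * d / z ^ 3))" .
  from sums_diff[OF S this] have "(\<lambda>l. of_int (mu2 l) * divisor_error (x / real l ^ 2)) sums
     (of_int (S_mu x) - (x * (ln x + c) * (1 / z ^ 2) - 2 * x * (2 * d / z ^ 3)))"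
    by (simp add: divisor_error_eq algebra_simps)
  moreover have "x * (ln x + c) * (1 / z ^ 2) - 2 * x * (2 * d / z ^ 3) = x / z ^ 2 * (ln x + 2 * euler_mascheroni - 1 - 4 * (d / z))"
    by (simp add: c_def power_numeral_reduce algebra_simps)
  ultimately show ?thesis unfolding E_mu_def z_def[symmetric] d_def[symmetric] by simp
qed

section \<open>From the smoothed tail to the error term\<close>

abbreviation tail_error :: "real \<Rightarrow> real \<Rightarrow> real" where
  "tail_error x Y \<equiv> E_mu x - (\<Sum>l | 0 < l \<and> real l \<le> Y. of_int (mu2 l) * divisor_error (x / real l ^ 2))"

text \<open>The tail is compared with its average term by term. The main terms differ by a
  convergent series times a logarithm, and the divisor sums by the cube of d(N); both are
  O(x^\<theta>).\<close>

lemma E_mu_tail_bound: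
  assumes RH: "riemann_hypothesis" and \<eta>: "0 < \<eta>" "\<eta> \<le> 1 / 8" and \<theta>: "0 < \<theta>" "\<theta> < 1"
  obtains C where "0 < C" "\<And>x Y. 1 \<le> x \<Longrightarrow>
    \<bar>tail_error x Y\<bar>
      \<le> C * (x powr (1 / 2 + \<eta> + \<theta>) * max 1 Y powr (- (1 / 2) + \<theta>) + x powr \<theta>)"
proof -
  obtain C1 where C1: "0 < C1" "\<And>x Y. 1 \<le> x \<Longrightarrow> \<exists>R.
    (\<lambda>l. if Y < real l then smooth_term x l else 0) sums R \<and>
    \<bar>R\<bar> \<le> C1 * x powr (1 / 2 + \<eta> + \<theta>) * max 1 Y powr (- (1 / 2) + \<theta>)"
    by (rule smoothed_tail_bound[OF assms]) blast
  \<comment> \<open>The exponent is \<theta> / 3 because the third power of d(N) is needed.\<close>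
  obtain C2 where C2: "0 < C2" "\<And>n. 0 < n \<Longrightarrow> real (divisor_count n) \<le> C2 * real n powr (\<theta> / 3)"
    by (rule divisor_count_bound[of "\<theta> / 3"]) (use \<theta> in \<open>simp, blast\<close>)
  define w where "w l = \<bar>real_of_int (mu2 l)\<bar> * real l powr (- (3 / 2))" for l
  define K where "K = suminf w"
  have w: "summable w" using ds_abs_mu2[of "3 / 2"] by (simp add: ds_abs_def w_def[abs_def])
  have K0: "0 \<le> K" unfolding K_def by (intro suminf_nonneg w) (simp add: w_def)
  define C3 where "C3 = 5 * (2 / \<theta> + 2 * euler_mascheroni + 1) * K"
  define C where "C = C1 + 2 * C2 ^ 3 + C3"
  have C3: "0 \<le> C3" using K0 \<theta> euler_mascheroni_pos by (simp add: C3_def)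
  show thesis
  proof
    show "0 < C" using C1 C2 C3 by (simp add: C_def add_pos_nonneg)
    fix x Y :: real assume x: "1 \<le> x"
    define N where "N = nat \<lfloor>x\<rfloor> + 1"
    define L where "L = ln (x + 1) + 2 * euler_mascheroni + 1"
    have x1: "1 \<le> x powr \<theta>" using x \<theta> by (intro ge_one_powr_ge_zero) auto
    have two_x: "z powr \<theta> \<le> 2 * x powr \<theta>" if "0 \<le> z" "z \<le> x + 1" for z
    proof -
      have "z powr \<theta> \<le> (2 * x) powr \<theta>" using that x \<theta> by (intro powr_mono2) auto
      also have "\<dots> = 2 powr \<theta> * x powr \<theta>" using x by (simp add: powr_mult)
      also have "\<dots> \<le> 2 powr 1 * x powr \<theta>" using \<theta> by (intro mult_right_mono powr_mono) auto
      finally show ?thesis by simp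
    qed
    obtain R where R: "(\<lambda>l. if Y < real l then smooth_term x l else 0) sums R"
      "\<bar>R\<bar> \<le> C1 * x powr (1 / 2 + \<eta> + \<theta>) * max 1 Y powr (- (1 / 2) + \<theta>)"
      using C1(2)[OF x, of Y] by blast
    define T where "T = tail_error x Y"
    have T: "(\<lambda>l. if Y < real l then of_int (mu2 l) * divisor_error (x / real l ^ 2) else 0) sums T"
      unfolding T_def by (rule tail_sums[OF E_mu_sums]) (use x in auto)
    define q where "q l = (if Y < real l then smooth_term x l else 0)
      - (if Y < real l then of_int (mu2 l) * divisor_error (x / real l ^ 2) else 0)" for l
    have q: "q sums (R - T)" unfolding q_def by (intro sums_diff R T)
    define b where "b l = (if l \<in> {l. l ^ 2 dvd N} then \<bar>real_of_int (mu2 l)\<bar> * real (divisor_count (N div l ^ 2)) else 0)" for l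
    have finN: "finite {l. l ^ 2 dvd N}"
    proof (rule finite_subset)
      show "{l. l ^ 2 dvd N} \<subseteq> {l. l dvd N}" by (auto intro: dvd_trans[of _ "_ ^ 2"])
    qed (simp add: N_def)
    have b: "b sums (\<Sum>l | l ^ 2 dvd N. \<bar>real_of_int (mu2 l)\<bar> * real (divisor_count (N div l ^ 2)))"
      unfolding b_def by (rule sums_If_finite_set[OF finN])
    have q_le: "norm (q l) \<le> b l + 5 * L * w l" for l
    proof (cases "l = 0")
      case False
      define p m where "p = real l ^ 2 * (dsum1 ((x + 1) / real l ^ 2) - dsum1 (x / real l ^ 2)) - real (divisor_sum (x / real l ^ 2))"
        and "m = real l ^ 2 * (dmain1 ((x + 1) / real l ^ 2) - dmain1 (x / real l ^ 2)) - dmain (x / real l ^ 2)"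
      have p: "\<bar>p\<bar> \<le> (if l ^ 2 dvd N then real (divisor_count (N div l ^ 2)) else 0)"
        unfolding p_def N_def by (rule dsum_smoothing[OF x]) (use False in simp)
      have m: "\<bar>m\<bar> \<le> 5 * L * real l powr (- (3 / 2))"
        unfolding m_def L_def by (rule dmain_smoothing[OF x]) (use False in simp)
      have "q l = (if Y < real l then of_int (mu2 l) * (p - m) else 0)"
        by (simp add: q_def p_def m_def derr1_def divisor_error_eq algebra_simps)
      hence "norm (q l) \<le> \<bar>real_of_int (mu2 l)\<bar> * \<bar>p - m\<bar>" by (simp add: abs_mult)
      also have "\<dots> \<le> \<bar>real_of_int (mu2 l)\<bar> * ((if l ^ 2 dvd N then real (divisor_count (N div l ^ 2)) else 0) + 5 * L * real l powr (- (3 / 2)))"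
        using p m by (intro mult_left_mono) linarith+
      also have "\<dots> = b l + 5 * L * w l" by (simp add: b_def w_def algebra_simps)
      finally show ?thesis .
    qed (simp add: q_def b_def w_def)
    have sw: "(\<lambda>l. b l + 5 * L * w l) sums ((\<Sum>l | l ^ 2 dvd N. \<bar>real_of_int (mu2 l)\<bar> * real (divisor_count (N div l ^ 2))) + 5 * L * K)"
      unfolding K_def by (intro sums_add sums_mult b summable_sums w)
    have "norm (suminf q) \<le> (\<Sum>l. b l + 5 * L * w l)"
      using sw by (intro norm_suminf_le q_le) (simp add: sums_iff)
    hence "\<bar>R - T\<bar> \<le> (\<Sum>l | l ^ 2 dvd N. \<bar>real_of_int (mu2 l)\<bar> * real (divisor_count (N div l ^ 2))) + 5 * L * K"
      using q sw by (simp add: sums_iff)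
    also have "\<dots> \<le> real (divisor_count N) ^ 3 + 5 * L * K"
      by (intro add_right_mono sum_mu2_divisor_count_le) (simp add: N_def)
    also have "\<dots> \<le> 2 * C2 ^ 3 * x powr \<theta> + C3 * x powr \<theta>"
    proof (rule add_mono)
      have "real (divisor_count N) ^ 3 \<le> (C2 * real N powr (\<theta> / 3)) ^ 3"
        by (intro power_mono C2) (simp_all add: N_def)
      also have "\<dots> = C2 ^ 3 * real N powr \<theta>"
        by (simp add: power_mult_distrib power3_eq_cube flip: powr_add)
      also have "\<dots> \<le> C2 ^ 3 * (2 * x powr \<theta>)"
        using nat_between_Suc(4)[of x] x C2 by (intro mult_left_mono two_x) (auto simp: N_def)
      finally show "real (divisor_count N) ^ 3 \<le> 2 * C2 ^ 3 * x powr \<theta>" by simp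
      have "ln (x + 1) \<le> (x + 1) powr \<theta> / \<theta>" using x \<theta> by (intro ln_powr_bound) auto
      also have "\<dots> \<le> (2 * x powr \<theta>) / \<theta>" using x \<theta> by (intro divide_right_mono two_x) auto
      finally have "L \<le> 2 / \<theta> * x powr \<theta> + (2 * euler_mascheroni + 1) * 1" by (simp add: L_def)
      also have "\<dots> \<le> 2 / \<theta> * x powr \<theta> + (2 * euler_mascheroni + 1) * x powr \<theta>"
        using x1 euler_mascheroni_pos by (intro add_left_mono mult_left_mono) auto
      also have "\<dots> = (2 / \<theta> + 2 * euler_mascheroni + 1) * x powr \<theta>" by (simp add: algebra_simps)
      finally have "5 * L * K \<le> 5 * ((2 / \<theta> + 2 * euler_mascheroni + 1) * x powr \<theta>) * K"
        using K0 by (intro mult_right_mono mult_left_mono) auto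
      thus "5 * L * K \<le> C3 * x powr \<theta>" by (simp add: C3_def mult_ac)
    qed
    finally have "\<bar>T\<bar> \<le> C1 * (x powr (1 / 2 + \<eta> + \<theta>) * max 1 Y powr (- (1 / 2) + \<theta>)) + (2 * C2 ^ 3 + C3) * x powr \<theta>"
      using R(2) by (simp add: algebra_simps)
    also have "\<dots> \<le> C * (x powr (1 / 2 + \<eta> + \<theta>) * max 1 Y powr (- (1 / 2) + \<theta>)) + C * x powr \<theta>"
      using C1 C2 C3 by (intro add_mono mult_right_mono) (auto simp: C_def)
    finally show "\<bar>tail_error x Y\<bar>
      \<le> C * (x powr (1 / 2 + \<eta> + \<theta>) * max 1 Y powr (- (1 / 2) + \<theta>) + x powr \<theta>)"
      by (simp add: T_def algebra_simps)
  qed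
qed

theorem theorem3:
  fixes \<beta> \<epsilon> A B :: real
  assumes "riemann_hypothesis"
    and "1 / 4 < \<beta>" and "\<beta> < 1 / 2"
    and "0 < \<epsilon>"
    and "0 < A" and "0 < B"
  shows "\<exists>C. \<forall>x Y. 5 < x \<longrightarrow> A * x powr \<epsilon> \<le> Y \<longrightarrow> Y \<le> B * x powr (1 / 2 - \<epsilon>) \<longrightarrow>
           \<bar>E_mu x - (\<Sum>l | 0 < l \<and> real l \<le> Y.
              of_int (dirichlet_conv moebius_mu moebius_mu l) * divisor_error (x / (real l)\<^sup>2))\<bar>
             \<le> C * (x powr (1 / 2 + \<epsilon>) * Y powr ((1 - 4 * \<beta>) / (4 - 4 * \<beta>) + \<epsilon>))"
proof -
  define e where "e = (1 - 4 * \<beta>) / (4 - 4 * \<beta>) + \<epsilon>"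
  \<comment> \<open>The two losses in the exponent of x together stay below \<epsilon>, and the
    bound 1/8 meets the requirement of the tail estimates.\<close>
  define \<eta> where "\<eta> = min (1 / 8) (\<epsilon> / 2)"
  have \<eta>: "0 < \<eta>" "\<eta> \<le> 1 / 8" "\<eta> \<le> \<epsilon> / 2" "\<eta> < 1" using assms(4) by (auto simp: \<eta>_def)
  \<comment> \<open>The right side decreases in \<beta> and reaches -1/2 at \<beta> = 1/2.\<close>
  have "- (1 / 2) \<le> (1 - 4 * \<beta>) / (4 - 4 * \<beta>)" using assms(2,3) by (simp add: field_simps)
  hence e: "- (1 / 2) + \<epsilon> \<le> e" by (simp add: e_def)
  obtain C where C: "0 < C" "\<And>x Y. 1 \<le> x \<Longrightarrow>
    \<bar>tail_error x Y\<bar>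
      \<le> C * (x powr (1 / 2 + \<eta> + \<eta>) * max 1 Y powr (- (1 / 2) + \<eta>) + x powr \<eta>)"
    by (rule E_mu_tail_bound[OF assms(1) \<eta>(1,2) \<eta>(1,4)]) blast
  define D where "D = max 1 (max (B powr (1 / 2)) (2 * A powr (- \<bar>e\<bar>)))"
  have D1: "1 \<le> D" "B powr (1 / 2) \<le> D" "2 * A powr (- \<bar>e\<bar>) \<le> D" by (auto simp: D_def)
  show ?thesis unfolding e_def[symmetric]
  proof (intro exI allI impI)
    fix x Y :: real assume x: "5 < x" and Y: "A * x powr \<epsilon> \<le> Y" "Y \<le> B * x powr (1 / 2 - \<epsilon>)"
    have "1 \<le> x powr \<epsilon>" using x assms(4) by (intro ge_one_powr_ge_zero) auto
    hence "A * 1 \<le> A * x powr \<epsilon>" using assms(5) by (intro mult_left_mono) auto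
    hence "A \<le> Y" using Y(1) by linarith
    with assms(5) have AY: "A \<le> Y" "0 < Y" by auto
    define X where "X = x powr (1 / 2 + \<epsilon>)"
    have X1: "x powr (1 / 2 + \<eta> + \<eta>) \<le> X" "x powr \<eta> \<le> X" "0 \<le> X"
      unfolding X_def using x \<eta> assms(4) by (auto intro!: powr_mono)
    have "x powr (1 / 2 + \<eta> + \<eta>) * max 1 Y powr (- (1 / 2) + \<eta>) + x powr \<eta> \<le> 2 * D * (X * Y powr e)"
    proof (cases "1 \<le> Y")
      case True
      have "max 1 Y powr (- (1 / 2) + \<eta>) \<le> Y powr e"
        using True e \<eta> assms(4) by (simp add: max_def powr_mono)
      hence 1: "x powr (1 / 2 + \<eta> + \<eta>) * max 1 Y powr (- (1 / 2) + \<eta>) \<le> X * Y powr e"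
        using X1 by (intro mult_mono) auto
      \<comment> \<open>The upper bound on Y enters here: it prevents Y^e from being so small that
        the additive term x^\<eta> would dominate. Y^(1/2) costs at most a constant times x^(1/4),
        which the factor x^(1/2 + \<epsilon>) can pay.\<close>
      have "1 = Y powr (1 / 2) * Y powr (- (1 / 2))" using AY by (simp flip: powr_add)
      also have "\<dots> \<le> (B * x powr (1 / 2 - \<epsilon>)) powr (1 / 2) * Y powr e"
        using Y AY True e assms(4) by (intro mult_mono powr_mono2 powr_mono) auto
      also have "(B * x powr (1 / 2 - \<epsilon>)) powr (1 / 2) = B powr (1 / 2) * x powr ((1 / 2 - \<epsilon>) / 2)"
        using assms(6) x by (simp add: powr_mult powr_powr)
      also have "B powr (1 / 2) * x powr ((1 / 2 - \<epsilon>) / 2) * Y powr e \<le> D * x powr (1 / 4) * Y powr e"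
        using D1 x assms(4) by (intro mult_right_mono mult_mono powr_mono) auto
      finally have "x powr \<eta> * 1 \<le> x powr \<eta> * (D * x powr (1 / 4) * Y powr e)"
        by (intro mult_left_mono) auto
      also have "\<dots> = D * (x powr (\<eta> + 1 / 4) * Y powr e)" by (simp add: powr_add mult_ac)
      also have "\<dots> \<le> D * (X * Y powr e)"
        unfolding X_def using D1 x \<eta> assms(4) by (intro mult_left_mono mult_right_mono powr_mono) auto
      finally have "x powr \<eta> \<le> D * (X * Y powr e)" by simp
      moreover have "1 * (X * Y powr e) \<le> D * (X * Y powr e)" using D1 X1 by (intro mult_right_mono) auto
      ultimately show ?thesis using 1 by simp
    next
      case False
      \<comment> \<open>Here A \<le> Y < 1. For e \<ge> 0 the lower bound A keeps Y^e away from 0;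
        for e < 0 one has Y^e \<ge> 1.\<close>
      have "1 / 2 * 2 \<le> D * Y powr e"
      proof (cases "0 \<le> e")
        case True
        have "1 = A powr (- \<bar>e\<bar>) * A powr e" using True assms(5) by (simp flip: powr_add)
        also have "\<dots> \<le> A powr (- \<bar>e\<bar>) * Y powr e" using True AY assms(5) by (intro mult_left_mono powr_mono2) auto
        also have "\<dots> \<le> D * Y powr e"
        proof (rule mult_right_mono)
          show "A powr (- \<bar>e\<bar>) \<le> D" using D1 powr_ge_zero[of A "- \<bar>e\<bar>"] by linarith
        qed simp
        finally show ?thesis by simp
      next
        case e0: False
        have "1 powr e \<le> Y powr e" using False e0 AY by (intro powr_mono2') auto
        hence "1 * 1 \<le> D * Y powr e" using D1 by (intro mult_mono) auto
        thus ?thesis by simp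
      qed
      hence "X * 1 \<le> X * (D * Y powr e)" using X1 by (intro mult_left_mono) auto
      hence "2 * X \<le> 2 * D * (X * Y powr e)" by (simp add: mult_ac)
      thus ?thesis using False X1 by (simp add: max_def)
    qed
    hence "C * (x powr (1 / 2 + \<eta> + \<eta>) * max 1 Y powr (- (1 / 2) + \<eta>) + x powr \<eta>) \<le> C * (2 * D * (X * Y powr e))"
      using C(1) by (intro mult_left_mono) auto
    with C(2)[of x Y] x show "\<bar>tail_error x Y\<bar>
      \<le> (C * (2 * D)) * (x powr (1 / 2 + \<epsilon>) * Y powr e)"
      by (simp add: X_def mult.assoc)
  qed
qed

end
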